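(* Let $f,g,h,D,p,p_*$ be as in the context. Suppose the uniform ellipticity condition for the diffusion matrix $$\lambda:=\inf_{x\in\mathbb R^n}\lambda_{\min}(D(x))>0$$ and the strong logarithmic concavity condition for the nominal invariant PDF $p_*$ $$\mu:=-\sup_{x\in\mathbb R^n}\lambda_{\max}\big((\ln p_* )''(x)\big)>0$$ are satisfied. Also, suppose the function $|h|:\mathbb R^n\to\mathbb R_+$ for the noise drift map $h$ is not identically constant and satisfies $$\theta_*:=\sup\{\theta\ge0:\ \mathbf E_*e^{\theta|h|^2}<+\infty\}>0 .$$ Then the relative entropy $\mathbf D(p\|p_* )$ admits the upper bound $$\mathbf D(p\|p_* )\le\nu(\theta_K)=2K\,\Psi'(\theta_K)$$ in terms of the gain coefficient $K:=\frac1{\lambda\mu}$ and the unique solution $\theta=\theta_K$ of the equation $\nu_K(\theta)=0$. Here, for $\theta\in[0,\theta_* )$, $$\Psi(\theta):=\ln\mathbf E_*e^{\theta|h|^2},\qquad \nu(\theta):=\theta\Psi'(\theta)-\Psi(\theta),$$ $$\nu_K(\theta):=\nu(\theta)-2K\Psi'(\theta)=(\theta-2K)\Psi'(\theta)-\Psi(\theta),$$ so that $\Psi$ is the nominal cumulant-generating function of $|h|^2$.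
   Context: Setting. Let $f\in C^1(\mathbb R^n,\mathbb R^n)$, $g\in C^2(\mathbb R^n,\mathbb R^{n\times m})$, $h\in C^1(\mathbb R^n,\mathbb R^m)$, and $f_h:=f+gh$, all of these maps being Lipschitz. Let $D(x):=g(x)g(x)^{\mathrm T}$ be the diffusion matrix. The system state is governed by the Ito SDE $dX_t=f(X_t)\,dt+g(X_t)\,dW_t$ driven by a noise $W$ with $dW_t=h(X_t)\,dt+dV_t$, where $V$ is an $\mathbb R^m$-valued standard Wiener process and $h$ is the noise drift map; thus the perturbed system is $dX_t=f_h(X_t)\,dt+g(X_t)\,dV_t$. The nominal system corresponds to $h\equiv0$: $dX_t=f(X_t)\,dt+g(X_t)\,dV_t$. Notation. For a symmetric-matrix-valued function $G=(G_{jk})\in C^2$ on $\mathbb R^n$, $\mathrm{div}^2G:=\sum_{j,k}\partial_{x_j}\partial_{x_k}G_{jk}$. $\lambda_{\min}$ and $\lambda_{\max}$ are the smallest and largest eigenvalues of a real symmetric matrix, $(\cdot)''$ applied to a function on $\mathbb R^n$ is the Hessian matrix, and $|\cdot|$ is the Euclidean norm. Invariant PDFs. $p$ and $p_*$ are the $C^2$ probability density functions on $\mathbb R^n$ (assumed to exist and to be unique) which are steady-state solutions of the Fokker-Planck-Kolmogorov equations of the perturbed and nominal systems, respectively: $$\tfrac12\mathrm{div}^2(pD)-\mathrm{div}(pf_h)=0,\qquad \tfrac12\mathrm{div}^2(p_*D)-\mathrm{div}(p_*f)=0 .$$ Both are assumed to be positive everywhere. $\mathbf E_*\varphi:=\int_{\mathbb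 R^n}\varphi(x)p_*(x)\,dx$ is the expectation over the nominal invariant PDF. The Kullback-Leibler relative entropy is $\mathbf D(p\|p_* ):=\int_{\mathbb R^n}p(x)\ln\frac{p(x)}{p_*(x)}\,dx$.
   Formalization: Existence of a solution θ_K of ν_K(θ)=0 in [0,θ_* ) is assumed, since it can fail under the stated hypotheses (e.g. f=-ax, g=1, h=-cx on the line with 0<a≤c); its uniqueness and the entropy bound are proved. *)

theory Defs
  imports "HOL-Analysis.Analysis"
begin

section \<open>Regularity and differential operators\<close>

definition C1_fun :: "('a::real_normed_vector \<Rightarrow> 'b::real_normed_vector) \<Rightarrow> bool" where
  "C1_fun F \<longleftrightarrow> (\<exists>F' :: 'a \<Rightarrow> 'a \<Rightarrow>\<^sub>L 'b.
      (\<forall>x. (F has_derivative blinfun_apply (F' x)) (at x)) \<and> continuous_on UNIV F')"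

definition C2_fun :: "('a::real_normed_vector \<Rightarrow> 'b::real_normed_vector) \<Rightarrow> bool" where
  "C2_fun F \<longleftrightarrow> (\<exists>F' :: 'a \<Rightarrow> 'a \<Rightarrow>\<^sub>L 'b.
      (\<forall>x. (F has_derivative blinfun_apply (F' x)) (at x)) \<and> C1_fun F')"

definition pdiff :: "'n::finite \<Rightarrow> (real^'n \<Rightarrow> real) \<Rightarrow> real^'n \<Rightarrow> real" where
  "pdiff i u x = deriv (\<lambda>t. u (x + t *\<^sub>R axis i 1)) 0"

definition divergence :: "(real^'n::finite \<Rightarrow> real^'n) \<Rightarrow> real^'n \<Rightarrow> real" where
  "divergence F x = (\<Sum>j\<in>UNIV. pdiff j (\<lambda>y. F y $ j) x)"

definition div2 :: "(real^'n::finite \<Rightarrow> real^'n^'n) \<Rightarrow> real^'n \<Rightarrow> real" where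
  "div2 G x = (\<Sum>j\<in>UNIV. \<Sum>k\<in>UNIV. pdiff j (pdiff k (\<lambda>y. G y $ j $ k)) x)"

definition hessian :: "(real^'n::finite \<Rightarrow> real) \<Rightarrow> real^'n \<Rightarrow> real^'n^'n" where
  "hessian u x = (\<chi> j k. pdiff j (pdiff k u) x)"

section \<open>Extreme eigenvalues\<close>

definition eigenvals :: "real^'n^'n::finite \<Rightarrow> real set" where
  "eigenvals A = {c. \<exists>v. v \<noteq> 0 \<and> A *v v = c *\<^sub>R v}"

(* For symmetric A the set of real eigenvalues is finite and nonempty, so that Min and Max
   are meaningful; the two constants are only used for symmetric matrices. *)
definition lambda_min :: "real^'n^'n::finite \<Rightarrow> real" where
  "lambda_min A = Min (eigenvals A)"

definition lambda_max :: "real^'n^'n::finite \<Rightarrow> real" where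
  "lambda_max A = Max (eigenvals A)"

section \<open>Diffusion matrix and invariant densities\<close>

definition diffusion :: "(real^'n \<Rightarrow> real^'m^'n::finite) \<Rightarrow> real^'n \<Rightarrow> real^'n^'n" where
  "diffusion g x = g x ** transpose (g x)"

definition C2_pdf :: "(real^'n::finite \<Rightarrow> real) \<Rightarrow> bool" where
  "C2_pdf p \<longleftrightarrow> C2_fun p \<and> (\<forall>x. 0 \<le> p x) \<and> (\<integral>\<^sup>+x. ennreal (p x) \<partial>lborel) = 1"

text \<open>Steady-state solutions of the Fokker-Planck-Kolmogorov equation of
  \<open>dX = b(X) dt + g(X) dV\<close>, where \<open>V\<close> is a standard Wiener process.\<close>

definition steady_pdf ::
    "(real^'n \<Rightarrow> real^'n) \<Rightarrow> (real^'n \<Rightarrow> real^'m^'n::finite) \<Rightarrow> (real^'n \<Rightarrow> real) \<Rightarrow> bool" where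
  "steady_pdf b g p \<longleftrightarrow> C2_pdf p \<and>
     (\<forall>x. 1/2 * div2 (\<lambda>y. p y *\<^sub>R diffusion g y) x - divergence (\<lambda>y. p y *\<^sub>R b y) x = 0)"

definition unique_steady_pdf ::
    "(real^'n \<Rightarrow> real^'n) \<Rightarrow> (real^'n \<Rightarrow> real^'m^'n::finite) \<Rightarrow> (real^'n \<Rightarrow> real) \<Rightarrow> bool" where
  "unique_steady_pdf b g p \<longleftrightarrow> steady_pdf b g p \<and> (\<forall>q. steady_pdf b g q \<longrightarrow> q = p)"

section \<open>Relative entropy and the cumulant-generating function\<close>

(* Positive part minus negative part, with values in the extended reals: a divergent integral
   gives infinity here, whereas the Bochner integral would give 0. *)
definition rel_entropy :: "(real^'n::finite \<Rightarrow> real) \<Rightarrow> (real^'n \<Rightarrow> real) \<Rightarrow> ereal" where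
  "rel_entropy p q =
     enn2ereal (\<integral>\<^sup>+x. ennreal (p x * ln (p x / q x)) \<partial>lborel)
     - enn2ereal (\<integral>\<^sup>+x. ennreal (- (p x * ln (p x / q x))) \<partial>lborel)"

definition expect :: "(real^'n::finite \<Rightarrow> real) \<Rightarrow> (real^'n \<Rightarrow> real) \<Rightarrow> real" where
  "expect q \<phi> = (\<integral>x. \<phi> x * q x \<partial>lborel)"

(* The integrand is nonnegative, so integrability says that the expectation is finite.
   The supremum may be infinite. *)
definition theta_star :: "(real^'n::finite \<Rightarrow> real) \<Rightarrow> (real^'n \<Rightarrow> real^'m::finite) \<Rightarrow> ereal" where
  "theta_star q h =
     (SUP \<theta>\<in>{\<theta>. 0 \<le> \<theta> \<and> integrable lborel (\<lambda>x. exp (\<theta> * (norm (h x))\<^sup>2) * q x)}. ereal \<theta>)"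

(* The formula is finite and smooth for negative arguments as well, so the two-sided
   derivative at 0 agrees with the right-hand one. *)
definition Psi :: "(real^'n::finite \<Rightarrow> real) \<Rightarrow> (real^'n \<Rightarrow> real^'m::finite) \<Rightarrow> real \<Rightarrow> real" where
  "Psi q h \<theta> = ln (expect q (\<lambda>x. exp (\<theta> * (norm (h x))\<^sup>2)))"

definition nu :: "(real^'n::finite \<Rightarrow> real) \<Rightarrow> (real^'n \<Rightarrow> real^'m::finite) \<Rightarrow> real \<Rightarrow> real" where
  "nu q h \<theta> = \<theta> * deriv (Psi q h) \<theta> - Psi q h \<theta>"

definition nu_gain ::
    "(real^'n::finite \<Rightarrow> real) \<Rightarrow> (real^'n \<Rightarrow> real^'m::finite) \<Rightarrow> real \<Rightarrow> real \<Rightarrow> real" where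
  "nu_gain q h K \<theta> = nu q h \<theta> - 2 * K * deriv (Psi q h) \<theta>"

(* A root need not exist: it has to exceed 2 * K, which is impossible if theta_star \<le> 2 * K,
   as for f(x) = - a x, g(x) = 1, h(x) = - c x on the line with 0 < a \<le> c, where
   theta_star = a / c^2 and 2 * K = 1 / a. *)
definition is_root ::
    "(real^'n::finite \<Rightarrow> real) \<Rightarrow> (real^'n \<Rightarrow> real^'m::finite) \<Rightarrow> real \<Rightarrow> real \<Rightarrow> bool" where
  "is_root q h K \<theta> \<longleftrightarrow> 0 \<le> \<theta> \<and> ereal \<theta> < theta_star q h \<and> nu_gain q h K \<theta> = 0"

end

theory Submission
  imports Defs
begin

text \<open>Let \<open>v\<close> be the quotient of the two invariant densities, \<open>\<mu>\<close> the nominal measure, and \<open>Ent q\<close> the entropy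
  of a \<open>\<mu>\<close>-density \<open>q\<close>. Testing the difference of the two Fokker-Planck-Kolmogorov equations with \<open>ln v\<close>
  and using the Cauchy-Schwarz inequality bounds \<open>\<integral> \<bar>g\<^sup>T\<nabla>v\<bar>\<^sup>2 / v d\<mu>\<close> by \<open>4 \<integral> v \<bar>h\<bar>\<^sup>2 d\<mu>\<close>. The logarithmic
  Sobolev inequality for \<open>\<mu>\<close>, which follows from strong logarithmic concavity through the Prekopa-Leindler
  inequality (Bobkov and Ledoux), turns this into \<open>Ent v \<le> 2 K \<integral> v \<bar>h\<bar>\<^sup>2 d\<mu>\<close>, and the Donsker-Varadhan
  variational formula bounds \<open>\<theta> \<integral> v \<bar>h\<bar>\<^sup>2 d\<mu>\<close> by \<open>Ent v + \<Psi> \<theta>\<close>. Hence \<open>Ent v \<le> 2 K \<Psi> \<theta> / (\<theta> - 2 K)\<close> for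
  \<open>\<theta> > 2 K\<close>, which equals \<open>2 K \<Psi>' \<theta>\<close> at the root.

  None of these integrals is known to be finite beforehand. All steps are therefore carried out for the bounded
  function \<open>(v + a) / (1 + a v)\<close> instead of \<open>v\<close>, for which they hold exactly, and \<open>a\<close> tends to zero at the end.
  Lipschitz continuity of the coefficients makes the boundary terms of the integrations by parts vanish.\<close>

section \<open>The Prekopa-Leindler inequality\<close>

text \<open>Testing the equations produces terms with derivatives of the nominal density, whose
  integrability is not among the assumptions: only the densities themselves are integrable. The
  current of the perturbed density is therefore tested with \<Phi> v and that of the nominal density
  with another function of v, so chosen that everything containing the nominal current cancels
  pointwise, even under a cutoff. The cutoff terms that remain are bounded by a multiple of the sum
  of the two densities. The map v to (v + a) / (1 + a v) takes values in [a, 1/a], is smooth, and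
  loses no constant, neither in the energy bound nor in the passage to the Fisher information. Its
  mean m is not 1, so both functional inequalities are used in homogeneous form, with a term m ln m.
  As a tends to zero, Fatou's lemma is applied to t ln t - t + 1, which is nonnegative although t ln
  t is not; finiteness of the entropy is thus a conclusion. The factor 2 K is 4 / lam from the
  energy estimate and ellipticity, divided by 2 mu from the logarithmic Sobolev inequality.\<close>

lemma emeasure_lborel_inner_compact:
  fixes A :: "real set"
  assumes A: "A \<in> sets borel" and ne: "A \<noteq> {}"
  shows "emeasure lborel A = (SUP K\<in>{K. compact K \<and> K \<noteq> {} \<and> K \<subseteq> A}. emeasure lborel K)"
    (is "_ = ?S")
proof (rule antisym)
  obtain x0 where x0: "x0 \<in> A" using ne by auto
  have low: "emeasure lborel K \<le> ?S" if "compact K" "K \<subseteq> A" for K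
  proof (cases "K = {}")
    case False then show ?thesis using that by (intro SUP_upper) auto
  qed auto
  show "emeasure lborel A \<le> ?S"
  proof (rule dense_le)
    fix a assume a: "a < emeasure lborel A"
    \<comment> \<open>The set may have infinite measure. A bounded piece has finite measure, which
      leaves a positive real gap \<open>e\<close> above \<open>a\<close> to be spent on the inner
      approximation.\<close>
    define B where "B n = A \<inter> {- real n..real n}" for n
    have Bm: "B n \<in> sets lborel" for n using A by (auto simp: B_def)
    have inc: "incseq B" unfolding B_def incseq_def by (auto intro: order_trans)
    have UN: "(\<Union>n. B n) = A"
    proof -
      have "\<exists>n. x \<in> {- real n..real n}" for x :: real
      proof -
        obtain n where "\<bar>x\<bar> \<le> real n" using real_arch_simple by blast
        then show ?thesis by (intro exI[of _ n]) auto
      qed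
      then show ?thesis unfolding B_def by blast
    qed
    have "(SUP n. emeasure lborel (B n)) = emeasure lborel A"
      using SUP_emeasure_incseq[of B lborel] Bm inc UN by auto
    then obtain n where n: "a < emeasure lborel (B n)" using a by (metis less_SUP_iff)
    have fin: "emeasure lborel (B n) < \<infinity>"
      by (intro emeasure_bounded_finite) (auto simp: B_def intro: bounded_subset[OF bounded_closed_interval])
    obtain e where e: "e > 0" "a + ennreal e \<le> emeasure lborel (B n)"
    proof -
      obtain b where b: "emeasure lborel (B n) = ennreal b" "b \<ge> 0" using fin by (cases "emeasure lborel (B n)") auto
      obtain a' where a': "a = ennreal a'" "a' \<ge> 0" using n fin by (cases a) auto
      have "a' < b" using n a' b by (simp add: ennreal_less_iff)
      show thesis by (rule that[of "b - a'"]) (use \<open>a' < b\<close> a' b in \<open>auto simp flip: ennreal_plus\<close>)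
    qed
    have "B n \<in> sets lebesgue" using Bm by auto
    from sets_lebesgue_inner_closed[OF this e(1)] obtain T where
      T: "closed T" "T \<subseteq> B n" "B n - T \<in> lmeasurable" "emeasure lebesgue (B n - T) < ennreal e" by metis
    have cT: "compact T" using T(1,2) unfolding compact_eq_bounded_closed
      by (auto simp: B_def intro: bounded_subset[OF bounded_closed_interval])
    have Tm: "T \<in> sets lborel" using T(1) by (simp add: borel_closed)
    have "emeasure lborel (B n) = emeasure lborel T + emeasure lborel (B n - T)"
      using T(2) Tm Bm[of n] by (subst plus_emeasure) (auto intro!: arg_cong[where f="emeasure lborel"])
    also have "emeasure lborel (B n - T) = emeasure lebesgue (B n - T)" using Bm[of n] Tm by auto
    finally have eq: "emeasure lborel (B n) = emeasure lborel T + emeasure lebesgue (B n - T)" .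
    have "a \<le> emeasure lborel T"
    proof (rule ccontr)
      assume "\<not> ?thesis"
      then have "emeasure lborel T < a" by simp
      then have "emeasure lborel T + emeasure lebesgue (B n - T) < a + ennreal e"
        using T(4) by (intro add_strict_mono)
      then show False using eq e(2) by simp
    qed
    also have "\<dots> \<le> ?S" using cT T(2) by (intro low) (auto simp: B_def)
    finally show "a \<le> ?S" .
  qed
  show "?S \<le> emeasure lborel A" using A by (intro SUP_least emeasure_mono) auto
qed

lemma emeasure_lborel_translate:
  fixes K :: "real set"
  assumes "K \<in> sets borel"
  shows "emeasure lborel ((\<lambda>x. x + c) ` K) = emeasure lborel K"
proof -
  have eq: "(\<lambda>x. x + c) ` K = (\<lambda>x. (-c) + x) -` K" by (auto simp: image_iff) (metis add.commute add_uminus_conv_diff diff_add_cancel)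
  have "emeasure lborel K = emeasure (distr lborel borel ((+) (-c))) K"
    by (simp add: lborel_distr_plus)
  also have "\<dots> = emeasure lborel ((\<lambda>x. (-c) + x) -` K)"
    using assms by (subst emeasure_distr) auto
  finally show ?thesis by (simp add: eq)
qed

text \<open>On the line the sum of the two sets contains a translate of each: \<open>K\<close>
  shifted by the minimum of \<open>L\<close>, and \<open>L\<close> shifted by the maximum of
  \<open>K\<close>. The first lies to the left of the second and they share one point, so their
  measures add.\<close>

lemma Brunn_Minkowski_compact_real:
  fixes K L C :: "real set"
  assumes "compact K" "K \<noteq> {}" "compact L" "L \<noteq> {}" "C \<in> sets borel"
    and KLC: "\<And>x y. x \<in> K \<Longrightarrow> y \<in> L \<Longrightarrow> x + y \<in> C"
  shows "emeasure lborel K + emeasure lborel L \<le> emeasure lborel C"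
proof -
  obtain b where b: "b \<in> K" "\<And>x. x \<in> K \<Longrightarrow> x \<le> b" using compact_attains_sup[OF assms(1,2)] by auto
  obtain a where a: "a \<in> L" "\<And>x. x \<in> L \<Longrightarrow> a \<le> x" using compact_attains_inf[OF assms(3,4)] by auto
  define K' where "K' = (\<lambda>x. x + a) ` K"
  define L' where "L' = (\<lambda>x. x + b) ` L"
  have cK: "compact K'" and cL: "compact L'" unfolding K'_def L'_def
    by (intro compact_continuous_image continuous_intros assms)+
  have m: "K' \<in> sets borel" "L' \<in> sets borel" using cK cL by (auto simp: borel_compact)
  have "K' \<inter> L' \<subseteq> {a + b}" unfolding K'_def L'_def using a b by force
  then have "emeasure lborel (K' \<inter> L') \<le> emeasure lborel {a + b}" by (intro emeasure_mono) auto
  then have "emeasure lborel (K' \<inter> L') = 0" by simp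
  then have "AE x in lborel. \<not> (x \<in> K' \<and> x \<in> L')"
    using m by (intro AE_I[of _ _ "K' \<inter> L'"]) auto
  then have "emeasure lborel K' + emeasure lborel L' = emeasure lborel (K' \<union> L')"
    using m by (subst emeasure_Un') (auto intro: null_setsI simp: \<open>emeasure lborel (K' \<inter> L') = 0\<close>)
  also have "\<dots> \<le> emeasure lborel C" using assms(5) a b KLC
    by (intro emeasure_mono) (auto simp: K'_def L'_def, metis add.commute)
  finally show ?thesis unfolding K'_def L'_def
    using assms by (simp add: emeasure_lborel_translate borel_compact)
qed

text \<open>The sum of two Borel sets need not be Borel, hence the Borel superset \<open>C\<close>.
  Inner regularity is applied to one summand at a time; nonempty compact sets are used throughout
  because the compact case needs their extreme points.\<close>

lemma Brunn_Minkowski_real: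
  fixes A B C :: "real set"
  assumes A: "A \<in> sets borel" "A \<noteq> {}" and B: "B \<in> sets borel" "B \<noteq> {}" and C: "C \<in> sets borel"
    and ABC: "\<And>x y. x \<in> A \<Longrightarrow> y \<in> B \<Longrightarrow> x + y \<in> C"
  shows "emeasure lborel A + emeasure lborel B \<le> emeasure lborel C"
proof -
  have ne: "{K. compact K \<and> K \<noteq> {} \<and> K \<subseteq> A} \<noteq> {}" if "A \<noteq> {}" for A :: "real set"
  proof -
    from that obtain x where "x \<in> A" by auto
    then have "{x} \<in> {K. compact K \<and> K \<noteq> {} \<and> K \<subseteq> A}" by auto
    then show ?thesis by blast
  qed
  have 1: "emeasure lborel A + emeasure lborel L \<le> emeasure lborel C" if L: "compact L" "L \<noteq> {}" "L \<subseteq> B" for L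
    unfolding emeasure_lborel_inner_compact[OF A] ennreal_SUP_add_left[OF ne[OF A(2)], symmetric]
    using L ABC C by (intro SUP_least Brunn_Minkowski_compact_real) auto
  show ?thesis
    unfolding emeasure_lborel_inner_compact[OF B] ennreal_SUP_add_right[OF ne[OF B(2)]]
    by (intro SUP_least 1) auto
qed

section \<open>The one-dimensional inequality from superlevel sets\<close>

lemma borel_scale_image:
  fixes A :: "real set"
  assumes "A \<in> sets borel" "c > 0"
  shows "(\<lambda>x. c * x) ` A \<in> sets borel"
proof -
  have eq: "(\<lambda>x. c * x) ` A = (\<lambda>x. x / c) -` A" using assms(2) by (force simp: image_iff)
  have "(\<lambda>x. x / c) \<in> borel_measurable borel" by simp
  from measurable_sets_borel[OF this assms(1)] show ?thesis unfolding eq .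
qed

lemma emeasure_lborel_scale:
  fixes A :: "real set"
  assumes "A \<in> sets borel" "c > 0"
  shows "emeasure lborel ((\<lambda>x. c * x) ` A) = ennreal c * emeasure lborel A"
proof -
  have m: "(\<lambda>x. c * x) ` A \<in> sets borel" using assms by (rule borel_scale_image)
  have "emeasure lborel ((\<lambda>x. c * x) ` A) = (\<integral>\<^sup>+x. indicator ((\<lambda>x. c * x) ` A) x \<partial>lborel)"
    using m by simp
  also have "\<dots> = ennreal c * (\<integral>\<^sup>+x. indicator ((\<lambda>x. c * x) ` A) (0 + c * x) \<partial>lborel)"
    using m assms(2) by (subst nn_integral_real_affine[where c=c and t=0]) auto
  also have "(\<lambda>x. indicator ((\<lambda>x. c * x) ` A) (0 + c * x)) = (indicator A :: real \<Rightarrow> ennreal)"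
    using assms(2) by (auto simp: fun_eq_iff indicator_def)
  finally show ?thesis using assms by simp
qed

lemma nn_integral_layer_cake_unit:
  fixes u :: "real \<Rightarrow> real"
  assumes [measurable]: "u \<in> borel_measurable borel" and u: "\<And>x. 0 \<le> u x" "\<And>x. u x \<le> 1"
  shows "(\<integral>\<^sup>+x. ennreal (u x) \<partial>lborel)
    = (\<integral>\<^sup>+r. indicator {0<..<1} r * emeasure lborel {x. r < u x} \<partial>lborel)"
proof -
  let ?S = "{(x, r). 0 < r \<and> r < 1 \<and> r < u x}"
  have "(\<integral>\<^sup>+x. ennreal (u x) \<partial>lborel) = (\<integral>\<^sup>+x. \<integral>\<^sup>+r. indicator ?S (x, r) \<partial>lborel \<partial>lborel)"
  proof (intro nn_integral_cong)
    fix x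
    have "(\<integral>\<^sup>+r. indicator ?S (x, r) \<partial>lborel) = (\<integral>\<^sup>+r. indicator {0<..<u x} r \<partial>lborel)"
      using u[of x] by (intro nn_integral_cong) (auto simp: indicator_def)
    then show "ennreal (u x) = (\<integral>\<^sup>+r. indicator ?S (x, r) \<partial>lborel)"
      using u[of x] by simp
  qed
  also have "\<dots> = (\<integral>\<^sup>+r. \<integral>\<^sup>+x. indicator ?S (x, r) \<partial>lborel \<partial>lborel)"
    by (intro lborel_pair.Fubini') measurable
  also have "\<dots> = (\<integral>\<^sup>+r. indicator {0<..<1} r * emeasure lborel {x. r < u x} \<partial>lborel)"
  proof (intro nn_integral_cong)
    fix r :: real
    have "(\<integral>\<^sup>+x. indicator ?S (x, r) \<partial>lborel)
      = (\<integral>\<^sup>+x. indicator {0<..<1} r * indicator {x. r < u x} x \<partial>lborel)"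
      by (intro nn_integral_cong) (auto simp: indicator_def)
    then show "(\<integral>\<^sup>+x. indicator ?S (x, r) \<partial>lborel)
      = indicator {0<..<1} r * emeasure lborel {x. r < u x}"
      by (simp add: nn_integral_cmult)
  qed
  finally show ?thesis .
qed

text \<open>Supremum 1 for both functions makes their superlevel sets nonempty at exactly the same
  levels, as Brunn-Minkowski requires. Under this normalization the arithmetic mean of the integrals
  is bounded, which is stronger than the geometric mean.\<close>

lemma Prekopa_Leindler_unit:
  fixes u v :: "real \<Rightarrow> real" and w :: "real \<Rightarrow> ennreal"
  assumes [measurable]: "u \<in> borel_measurable borel" "v \<in> borel_measurable borel" "w \<in> borel_measurable borel"
    and u: "\<And>x. 0 \<le> u x" "\<And>x. u x \<le> 1" and v: "\<And>x. 0 \<le> v x" "\<And>x. v x \<le> 1"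
    and su: "\<And>r. r < 1 \<Longrightarrow> \<exists>x. r < u x" and sv: "\<And>r. r < 1 \<Longrightarrow> \<exists>x. r < v x"
    and t: "0 < t" "t < 1"
    and w: "\<And>x y r. 0 < r \<Longrightarrow> r < 1 \<Longrightarrow> r < u x \<Longrightarrow> r < v y \<Longrightarrow> ennreal r \<le> w (t * x + (1 - t) * y)"
  shows "ennreal t * (\<integral>\<^sup>+x. ennreal (u x) \<partial>lborel) + ennreal (1 - t) * (\<integral>\<^sup>+x. ennreal (v x) \<partial>lborel) \<le> (\<integral>\<^sup>+x. w x \<partial>lborel)"
proof -
  let ?S = "{(x, r). 0 < r \<and> r < 1 \<and> ennreal r \<le> w x}"
  have "ennreal t * (\<integral>\<^sup>+x. ennreal (u x) \<partial>lborel) + ennreal (1 - t) * (\<integral>\<^sup>+x. ennreal (v x) \<partial>lborel)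
    = (\<integral>\<^sup>+r. indicator {0<..<1} r * (ennreal t * emeasure lborel {x. r < u x} + ennreal (1 - t) * emeasure lborel {x. r < v x}) \<partial>lborel)"
    unfolding nn_integral_layer_cake_unit[OF assms(1) u] nn_integral_layer_cake_unit[OF assms(2) v]
    by (subst nn_integral_cmult[symmetric] nn_integral_add[symmetric], measurable)+
       (auto simp: algebra_simps intro!: nn_integral_cong)
  also have "\<dots> \<le> (\<integral>\<^sup>+r. indicator {0<..<1} r * emeasure lborel {x. ennreal r \<le> w x} \<partial>lborel)"
  proof (intro nn_integral_mono)
    fix r :: real
    show "indicator {0<..<1} r * (ennreal t * emeasure lborel {x. r < u x} + ennreal (1 - t) * emeasure lborel {x. r < v x})
      \<le> indicator {0<..<1} r * emeasure lborel {x. ennreal r \<le> w x}"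
    proof (cases "0 < r \<and> r < 1")
      case True
      have mm: "{x. r < u x} \<in> sets borel" "{x. r < v x} \<in> sets borel" "{x. ennreal r \<le> w x} \<in> sets borel"
        by measurable
      have "emeasure lborel ((\<lambda>x. t * x) ` {x. r < u x}) + emeasure lborel ((\<lambda>x. (1 - t) * x) ` {x. r < v x})
          \<le> emeasure lborel {x. ennreal r \<le> w x}"
        using t True su[of r] sv[of r] w[of r] by (intro Brunn_Minkowski_real borel_scale_image mm) auto
      then show ?thesis using t by (simp add: emeasure_lborel_scale mm True)
    qed auto
  qed
  also have "\<dots> = (\<integral>\<^sup>+r. \<integral>\<^sup>+x. indicator ?S (x, r) \<partial>lborel \<partial>lborel)"
  proof (intro nn_integral_cong)
    fix r :: real
    have "(\<integral>\<^sup>+x. indicator ?S (x, r) \<partial>lborel)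
      = (\<integral>\<^sup>+x. indicator {0<..<1} r * indicator {x. ennreal r \<le> w x} x \<partial>lborel)"
      by (intro nn_integral_cong) (auto simp: indicator_def)
    then show "indicator {0<..<1} r * emeasure lborel {x. ennreal r \<le> w x} = (\<integral>\<^sup>+x. indicator ?S (x, r) \<partial>lborel)"
      by (simp add: nn_integral_cmult)
  qed
  also have "\<dots> = (\<integral>\<^sup>+x. \<integral>\<^sup>+r. indicator ?S (x, r) \<partial>lborel \<partial>lborel)"
    by (intro lborel_pair.Fubini'[symmetric]) measurable
  \<comment> \<open>Only an inequality: levels stop at 1, so the inner integral is the smaller of 1
    and \<open>w x\<close>.\<close>
  also have "\<dots> \<le> (\<integral>\<^sup>+x. w x \<partial>lborel)"
  proof (intro nn_integral_mono)
    fix x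
    show "(\<integral>\<^sup>+r. indicator ?S (x, r) \<partial>lborel) \<le> w x"
    proof (cases "w x")
      case (real c)
      have "(\<integral>\<^sup>+r. indicator ?S (x, r) \<partial>lborel) \<le> (\<integral>\<^sup>+r. indicator {0..c} r \<partial>lborel)"
        using real by (intro nn_integral_mono) (auto simp: indicator_def)
      then show ?thesis using real by simp
    qed simp
  qed
  finally show ?thesis .
qed

text \<open>The relation \<open>U\<^sup>t V\<^bsup>1-t\<^esup> \<le> W\<close> for extended nonnegative numbers; quantifying over real minorants of
  \<open>U\<close> and \<open>V\<close> avoids powers of infinity and is stable under integration, hence suits induction on the dimension.\<close>

definition PL_rel :: "real \<Rightarrow> ennreal \<Rightarrow> ennreal \<Rightarrow> ennreal \<Rightarrow> bool" where
  "PL_rel t U V W \<longleftrightarrow> (\<forall>a>0. \<forall>b>0. ennreal a < U \<longrightarrow> ennreal b < V \<longrightarrow> ennreal (a powr t * b powr (1 - t)) \<le> W)"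

lemma less_nn_integral_truncate:
  fixes u :: "'a \<Rightarrow> ennreal"
  assumes [measurable]: "u \<in> borel_measurable M" and a: "a < (\<integral>\<^sup>+x. u x \<partial>M)"
  obtains k :: nat where "\<And>j. j \<ge> k \<Longrightarrow> a < (\<integral>\<^sup>+x. min (u x) (of_nat j) \<partial>M)"
proof -
  have lim: "(SUP k. min (u x) (of_nat k)) = u x" for x
  proof (rule antisym)
    show "u x \<le> (SUP k. min (u x) (of_nat k))"
    proof (rule dense_le)
      fix b assume b: "b < u x"
      then have "b < top" using top.not_eq_extremum by fastforce
      then obtain k where "b < of_nat k" using ennreal_Ex_less_of_nat[of b] by auto
      then have "b \<le> min (u x) (of_nat k)" using b by auto
      then show "b \<le> (SUP k. min (u x) (of_nat k))" by (rule SUP_upper2[OF UNIV_I])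
    qed
  qed (auto intro: SUP_least)
  have inc: "incseq (\<lambda>k x. min (u x) (of_nat k))"
    by (auto simp: incseq_def le_fun_def intro: min.coboundedI2 order_trans[OF min.cobounded2])
  have "(\<integral>\<^sup>+x. (SUP k. min (u x) (of_nat k)) \<partial>M) = (SUP k. \<integral>\<^sup>+x. min (u x) (of_nat k) \<partial>M)"
    by (rule nn_integral_monotone_convergence_SUP[OF inc]) measurable
  then obtain k where k: "a < (\<integral>\<^sup>+x. min (u x) (of_nat k) \<partial>M)"
    using a unfolding lim by (metis less_SUP_iff)
  show thesis
  proof (rule that[of k])
    fix j assume "k \<le> j"
    then have "(\<integral>\<^sup>+x. min (u x) (of_nat k) \<partial>M) \<le> (\<integral>\<^sup>+x. min (u x) (of_nat j) \<partial>M)"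
      using inc by (intro nn_integral_mono) (auto simp: incseq_def le_fun_def)
    with k show "a < (\<integral>\<^sup>+x. min (u x) (of_nat j) \<partial>M)" by simp
  qed
qed

text \<open>Division of the truncated function by its supremum \<open>M\<close>. Strict inequalities
  are kept because \<open>PL_rel\<close> speaks of strict minorants only; truncation is needed for
  \<open>M\<close> to be finite.\<close>

lemma normalize_bounded:
  fixes u :: "real \<Rightarrow> ennreal"
  assumes [measurable]: "u \<in> borel_measurable borel" and a: "0 < a"
    and less: "ennreal a < (\<integral>\<^sup>+x. min (u x) (of_nat k) \<partial>lborel)"
  obtains M :: real and u' :: "real \<Rightarrow> real" where "M > 0" "u' \<in> borel_measurable borel"
    "\<And>x. 0 \<le> u' x" "\<And>x. u' x \<le> 1" "\<And>r. r < 1 \<Longrightarrow> \<exists>x. r < u' x"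
    "\<And>x r. 0 \<le> r \<Longrightarrow> r < u' x \<Longrightarrow> ennreal (r * M) < u x" "ennreal (a / M) \<le> (\<integral>\<^sup>+x. ennreal (u' x) \<partial>lborel)"
proof -
  define f where "f x = enn2real (min (u x) (of_nat k))" for x
  have fm[measurable]: "f \<in> borel_measurable borel" unfolding f_def by measurable
  have lt: "min (u x) (of_nat k) < top" for x by (simp add: min_less_iff_disj ennreal_of_nat_eq_real_of_nat)
  have f: "ennreal (f x) = min (u x) (of_nat k)" for x
    unfolding f_def using lt[of x] by simp
  have f0: "0 \<le> f x" for x by (simp add: f_def)
  have fk: "f x \<le> real k" for x
  proof -
    have "ennreal (f x) \<le> ennreal (real k)" unfolding f by (simp add: ennreal_of_nat_eq_real_of_nat)
    then show ?thesis by simp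
  qed
  define M where "M = (SUP x. f x)"
  have bdd: "bdd_above (range f)" using fk by (auto intro!: bdd_aboveI)
  have fM: "f x \<le> M" for x unfolding M_def by (rule cSUP_upper[OF UNIV_I bdd])
  have M: "M > 0"
  proof (rule ccontr)
    assume "\<not> ?thesis"
    then have "f x = 0" for x using fM[of x] f0[of x] by linarith
    then have "min (u x) (of_nat k) = 0" for x using f[of x] by simp
    then show False using less by simp
  qed
  show thesis
  proof (rule that[of M "\<lambda>x. f x / M"])
    show "\<exists>x. r < f x / M" if "r < 1" for r
    proof -
      have "r * M < M" using that M by simp
      then obtain x where "r * M < f x" unfolding M_def using less_cSUP_iff[OF _ bdd] by auto
      then show ?thesis using M by (intro exI[of _ x]) (simp add: pos_less_divide_eq)
    qed
    show "ennreal (r * M) < u x" if "0 \<le> r" "r < f x / M" for x r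
    proof -
      have "r * M < f x" using that M by (simp add: pos_less_divide_eq)
      then have "ennreal (r * M) < ennreal (f x)" using that M by (intro ennreal_lessI) (auto intro: le_less_trans[of 0 "r * M"])
      then show ?thesis unfolding f by simp
    qed
    have "ennreal (a / M) = ennreal (1 / M) * ennreal a" using M a by (simp flip: ennreal_mult)
    also have "\<dots> \<le> ennreal (1 / M) * (\<integral>\<^sup>+x. ennreal (f x) \<partial>lborel)"
      using less unfolding f by (intro mult_left_mono) auto
    also have "\<dots> = (\<integral>\<^sup>+x. ennreal (f x / M) \<partial>lborel)"
      using M f0 by (subst nn_integral_cmult[symmetric]) (auto simp flip: ennreal_mult)
    finally show "ennreal (a / M) \<le> (\<integral>\<^sup>+x. ennreal (f x / M) \<partial>lborel)" .
  qed (use M f0 fM in auto)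
qed

lemma Prekopa_Leindler_real:
  fixes u v w :: "real \<Rightarrow> ennreal"
  assumes [measurable]: "u \<in> borel_measurable borel" "v \<in> borel_measurable borel" "w \<in> borel_measurable borel"
    and t: "0 < t" "t < 1"
    and R: "\<And>x y. PL_rel t (u x) (v y) (w (t * x + (1 - t) * y))"
  shows "PL_rel t (\<integral>\<^sup>+x. u x \<partial>lborel) (\<integral>\<^sup>+x. v x \<partial>lborel) (\<integral>\<^sup>+x. w x \<partial>lborel)"
  unfolding PL_rel_def
proof (intro allI impI)
  fix a b :: real
  assume ab: "0 < a" "0 < b" and a: "ennreal a < (\<integral>\<^sup>+x. u x \<partial>lborel)" and b: "ennreal b < (\<integral>\<^sup>+x. v x \<partial>lborel)"
  obtain k where k: "\<And>j. j \<ge> k \<Longrightarrow> ennreal a < (\<integral>\<^sup>+x. min (u x) (of_nat j) \<partial>lborel)"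
    by (rule less_nn_integral_truncate[OF _ a]) auto
  obtain l where l: "\<And>j. j \<ge> l \<Longrightarrow> ennreal b < (\<integral>\<^sup>+x. min (v x) (of_nat j) \<partial>lborel)"
    by (rule less_nn_integral_truncate[OF _ b]) auto
  obtain M u' where M: "M > 0" and u'[measurable]: "u' \<in> borel_measurable borel"
    and u: "\<And>x. 0 \<le> u' x" "\<And>x. u' x \<le> 1" "\<And>r. r < 1 \<Longrightarrow> \<exists>x. r < u' x"
      "\<And>x r. 0 \<le> r \<Longrightarrow> r < u' x \<Longrightarrow> ennreal (r * M) < u x" "ennreal (a / M) \<le> (\<integral>\<^sup>+x. ennreal (u' x) \<partial>lborel)"
    using normalize_bounded[OF assms(1) ab(1) k[OF order_refl]] by blast
  obtain N v' where N: "N > 0" and v'[measurable]: "v' \<in> borel_measurable borel"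
    and v: "\<And>x. 0 \<le> v' x" "\<And>x. v' x \<le> 1" "\<And>r. r < 1 \<Longrightarrow> \<exists>x. r < v' x"
      "\<And>x r. 0 \<le> r \<Longrightarrow> r < v' x \<Longrightarrow> ennreal (r * N) < v x" "ennreal (b / N) \<le> (\<integral>\<^sup>+x. ennreal (v' x) \<partial>lborel)"
    using normalize_bounded[OF assms(2) ab(2) l[OF order_refl]] by blast
  \<comment> \<open>Dividing \<open>u\<close> by \<open>M\<close> and \<open>v\<close> by
    \<open>N\<close> forces \<open>w\<close> to be divided by the corresponding geometric
    mean.\<close>
  define c where "c = M powr t * N powr (1 - t)"
  have c: "c > 0" using M N by (simp add: c_def)
  have "ennreal t * (\<integral>\<^sup>+x. ennreal (u' x) \<partial>lborel) + ennreal (1 - t) * (\<integral>\<^sup>+x. ennreal (v' x) \<partial>lborel)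
    \<le> (\<integral>\<^sup>+x. ennreal (1 / c) * w x \<partial>lborel)"
  proof (rule Prekopa_Leindler_unit[OF u' v' _ u(1,2) v(1,2) u(3) v(3) t])
    fix x y r :: real
    assume r: "0 < r" "r < 1" "r < u' x" "r < v' y"
    have "ennreal ((r * M) powr t * (r * N) powr (1 - t)) \<le> w (t * x + (1 - t) * y)"
      using R[of x y] u(4)[of r x] v(4)[of r y] r M N unfolding PL_rel_def by auto
    also have "(r * M) powr t * (r * N) powr (1 - t) = (r powr t * r powr (1 - t)) * c"
      using r M N by (simp add: powr_mult c_def)
    also have "r powr t * r powr (1 - t) = r" using r by (simp flip: powr_add)
    finally have "ennreal (1 / c) * ennreal (r * c) \<le> ennreal (1 / c) * w (t * x + (1 - t) * y)"
      by (intro mult_left_mono) auto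
    then show "ennreal r \<le> ennreal (1 / c) * w (t * x + (1 - t) * y)"
      using c r by (simp flip: ennreal_mult)
  qed measurable
  also have "\<dots> = ennreal (1 / c) * (\<integral>\<^sup>+x. w x \<partial>lborel)" by (rule nn_integral_cmult) measurable
  finally have "ennreal t * (\<integral>\<^sup>+x. ennreal (u' x) \<partial>lborel) + ennreal (1 - t) * (\<integral>\<^sup>+x. ennreal (v' x) \<partial>lborel)
    \<le> ennreal (1 / c) * (\<integral>\<^sup>+x. w x \<partial>lborel)" .
  then have "ennreal t * ennreal (a / M) + ennreal (1 - t) * ennreal (b / N) \<le> ennreal (1 / c) * (\<integral>\<^sup>+x. w x \<partial>lborel)"
    using u(5) v(5) by (meson add_mono mult_left_mono order_trans zero_le)
  moreover have "ennreal t * ennreal (a / M) + ennreal (1 - t) * ennreal (b / N) = ennreal (t * (a / M) + (1 - t) * (b / N))"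
    using t ab M N by (simp flip: ennreal_mult ennreal_plus)
  \<comment> \<open>The weighted inequality between arithmetic and geometric means turns the
    additive bound back into the multiplicative one, and the factor \<open>c\<close>
    cancels.\<close>
  moreover have "(a / M) powr t * (b / N) powr (1 - t) \<le> t * (a / M) + (1 - t) * (b / N)"
    using t ab M N by (intro Youngs_inequality_0) auto
  moreover have "(a / M) powr t * (b / N) powr (1 - t) = a powr t * b powr (1 - t) / c"
    using ab M N by (simp add: powr_divide c_def)
  ultimately have "ennreal (a powr t * b powr (1 - t) / c) \<le> ennreal (1 / c) * (\<integral>\<^sup>+x. w x \<partial>lborel)"
    by (metis ennreal_leI order_trans)
  then have "ennreal c * ennreal (a powr t * b powr (1 - t) / c) \<le> ennreal c * (ennreal (1 / c) * (\<integral>\<^sup>+x. w x \<partial>lborel))"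
    by (intro mult_left_mono) auto
  then show "ennreal (a powr t * b powr (1 - t)) \<le> (\<integral>\<^sup>+x. w x \<partial>lborel)"
    using c ab by (simp add: mult.assoc[symmetric] flip: ennreal_mult)
qed

section \<open>Induction on the dimension\<close>

lemma Prekopa_Leindler_PiM:
  fixes u v w :: "('i \<Rightarrow> real) \<Rightarrow> ennreal"
  assumes "finite I" and t: "0 < t" "t < 1"
    and "u \<in> borel_measurable (Pi\<^sub>M I (\<lambda>_. lborel))" "v \<in> borel_measurable (Pi\<^sub>M I (\<lambda>_. lborel))"
      "w \<in> borel_measurable (Pi\<^sub>M I (\<lambda>_. lborel))"
    and "\<And>x y. PL_rel t (u x) (v y) (w (\<lambda>i. t * x i + (1 - t) * y i))"
    and "\<And>x y. (\<And>i. i \<in> I \<Longrightarrow> x i = y i) \<Longrightarrow> w x = w y"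
  shows "PL_rel t (\<integral>\<^sup>+x. u x \<partial>Pi\<^sub>M I (\<lambda>_. lborel)) (\<integral>\<^sup>+x. v x \<partial>Pi\<^sub>M I (\<lambda>_. lborel)) (\<integral>\<^sup>+x. w x \<partial>Pi\<^sub>M I (\<lambda>_. lborel))"
  using assms(1,4-)
proof (induction I arbitrary: u v w rule: finite_induct)
  case empty
  \<comment> \<open>The product over no coordinates is a point mass at the constant function
    \<open>undefined\<close>, and a convex combination of \<open>undefined\<close> with itself need
    not simplify syntactically to it. The locality assumption on \<open>w\<close> bridges this; it
    serves the same purpose for the coordinates outside \<open>I\<close> in the induction
    step.\<close>
  have e: "w (\<lambda>i. t * undefined + (1 - t) * undefined) = w (\<lambda>x. undefined)" by (rule empty(5)) auto
  show ?case using empty(4)[of "\<lambda>_. undefined" "\<lambda>_. undefined"] e by (simp add: PiM_empty nn_integral_count_space_finite)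
next
  case (insert i I)
  interpret product_sigma_finite "\<lambda>_::'i. lborel :: real measure" by standard
  note [measurable] = insert(4-6)
  have m: "(\<lambda>x. f (x(i := c))) \<in> borel_measurable (Pi\<^sub>M I (\<lambda>_. lborel))"
    if [measurable]: "f \<in> borel_measurable (Pi\<^sub>M (insert i I) (\<lambda>_. lborel))" for f :: "('i \<Rightarrow> real) \<Rightarrow> ennreal" and c
    by (rule measurable_compose[OF _ that], rule measurable_fun_upd[where J = I]) auto
  have m2: "(\<lambda>c. \<integral>\<^sup>+x. f (x(i := c)) \<partial>Pi\<^sub>M I (\<lambda>_. lborel)) \<in> borel_measurable borel"
    if [measurable]: "f \<in> borel_measurable (Pi\<^sub>M (insert i I) (\<lambda>_. lborel))" for f :: "('i \<Rightarrow> real) \<Rightarrow> ennreal"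
  proof -
    have "(\<lambda>(c, x). f (x(i := c))) \<in> borel_measurable (lborel \<Otimes>\<^sub>M Pi\<^sub>M I (\<lambda>_. lborel))"
      by measurable
    from sigma_finite_measure.borel_measurable_nn_integral_fst[OF sigma_finite[OF insert(1)] this] show ?thesis by simp
  qed
  show ?case
    unfolding product_nn_integral_insert_rev[OF insert(1,2) insert(4)] product_nn_integral_insert_rev[OF insert(1,2) insert(5)]
      product_nn_integral_insert_rev[OF insert(1,2) insert(6)]
  proof (rule Prekopa_Leindler_real[OF m2[OF insert(4)] m2[OF insert(5)] m2[OF insert(6)] t])
    fix c d
    show "PL_rel t (\<integral>\<^sup>+x. u (x(i := c)) \<partial>Pi\<^sub>M I (\<lambda>_. lborel)) (\<integral>\<^sup>+x. v (x(i := d)) \<partial>Pi\<^sub>M I (\<lambda>_. lborel))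
       (\<integral>\<^sup>+x. w (x(i := t * c + (1 - t) * d)) \<partial>Pi\<^sub>M I (\<lambda>_. lborel))"
    proof (rule insert.IH[OF m[OF insert(4)] m[OF insert(5)] m[OF insert(6)]])
      fix x y
      have "(\<lambda>j. t * (x(i := c)) j + (1 - t) * (y(i := d)) j) = (\<lambda>j. t * x j + (1 - t) * y j)(i := t * c + (1 - t) * d)"
        by auto
      with insert(7)[of "x(i := c)" "y(i := d)"]
      show "PL_rel t (u (x(i := c))) (v (y(i := d))) (w ((\<lambda>j. t * x j + (1 - t) * y j)(i := t * c + (1 - t) * d)))"
        by (simp only:)
    next
      fix x y :: "'i \<Rightarrow> real" assume "\<And>j. j \<in> I \<Longrightarrow> x j = y j"
      then show "w (x(i := t * c + (1 - t) * d)) = w (y(i := t * c + (1 - t) * d))"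
        by (intro insert(8)) auto
    qed
  qed
qed

theorem Prekopa_Leindler:
  fixes u v w :: "'a::euclidean_space \<Rightarrow> ennreal"
  assumes [measurable]: "u \<in> borel_measurable borel" "v \<in> borel_measurable borel" "w \<in> borel_measurable borel"
    and t: "0 < t" "t < 1"
    and R: "\<And>x y. PL_rel t (u x) (v y) (w (t *\<^sub>R x + (1 - t) *\<^sub>R y))"
  shows "PL_rel t (\<integral>\<^sup>+x. u x \<partial>lborel) (\<integral>\<^sup>+x. v x \<partial>lborel) (\<integral>\<^sup>+x. w x \<partial>lborel)"
proof -
  define e :: "('a \<Rightarrow> real) \<Rightarrow> 'a" where "e f = (\<Sum>b\<in>Basis. f b *\<^sub>R b)" for f
  have e[measurable]: "e \<in> measurable (\<Pi>\<^sub>M b\<in>Basis. lborel) borel" unfolding e_def by measurable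
  have lin: "e (\<lambda>i. t * x i + (1 - t) * y i) = t *\<^sub>R e x + (1 - t) *\<^sub>R e y" for x y
    by (simp add: e_def scaleR_add_left sum.distrib scaleR_sum_right)
  have eq: "(\<integral>\<^sup>+x. f x \<partial>lborel) = (\<integral>\<^sup>+x. f (e x) \<partial>(\<Pi>\<^sub>M b\<in>Basis. lborel))"
    if [measurable]: "f \<in> borel_measurable borel" for f :: "'a \<Rightarrow> ennreal"
    unfolding lborel_eq[where 'a='a] e_def[abs_def, symmetric] by (subst nn_integral_distr) auto
  show ?thesis unfolding eq[OF assms(1)] eq[OF assms(2)] eq[OF assms(3)]
  proof (rule Prekopa_Leindler_PiM[OF finite_Basis t])
    show "w (e x) = w (e y)" if "\<And>i. i \<in> Basis \<Longrightarrow> x i = y i" for x y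
      using that by (simp add: e_def)
    show "PL_rel t (u (e x)) (v (e y)) (w (e (\<lambda>i. t * x i + (1 - t) * y i)))" for x y
      unfolding lin by (rule R)
  qed measurable
qed

section \<open>Partial derivatives and integration by parts\<close>

lemma C1_fun_continuous: "C1_fun F \<Longrightarrow> continuous_on UNIV F"
  unfolding C1_fun_def by (metis has_derivative_continuous continuous_at_imp_continuous_on)

lemma C1_fun_differentiable: "C1_fun F \<Longrightarrow> F differentiable (at x)"
  unfolding C1_fun_def differentiable_def by blast

lemma C1_fun_linear_compose:
  fixes F :: "'a::real_normed_vector \<Rightarrow> 'b::real_normed_vector" and L :: "'b \<Rightarrow> 'c::real_normed_vector"
  assumes "bounded_linear L" "C1_fun F"
  shows "C1_fun (\<lambda>x. L (F x))"
proof -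
  obtain F' where F': "\<And>x. (F has_derivative blinfun_apply (F' x)) (at x)" "continuous_on UNIV F'"
    using assms(2) unfolding C1_fun_def by blast
  show ?thesis unfolding C1_fun_def
  proof (intro exI[of _ "\<lambda>x. Blinfun L o\<^sub>L F' x"] conjI allI)
    fix x show "((\<lambda>x. L (F x)) has_derivative blinfun_apply (Blinfun L o\<^sub>L F' x)) (at x)"
      using bounded_linear.has_derivative[OF assms(1) F'(1)]
      by (simp add: blinfun_compose.rep_eq comp_def bounded_linear_Blinfun_apply[OF assms(1)])
  qed (intro continuous_intros F')
qed

lemma C2_fun_linear_compose:
  fixes F :: "'a::real_normed_vector \<Rightarrow> 'b::real_normed_vector" and L :: "'b \<Rightarrow> 'c::real_normed_vector"
  assumes "bounded_linear L" "C2_fun F"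
  shows "C2_fun (\<lambda>x. L (F x))"
proof -
  obtain F' where F': "\<And>x. (F has_derivative blinfun_apply (F' x)) (at x)" "C1_fun F'"
    using assms(2) unfolding C2_fun_def by blast
  have bl: "bounded_linear (\<lambda>A. Blinfun L o\<^sub>L A)" by (rule bounded_linear_intros) (rule bounded_linear_ident)
  show ?thesis unfolding C2_fun_def
  proof (intro exI[of _ "\<lambda>x. Blinfun L o\<^sub>L F' x"] conjI allI)
    fix x show "((\<lambda>x. L (F x)) has_derivative blinfun_apply (Blinfun L o\<^sub>L F' x)) (at x)"
      using bounded_linear.has_derivative[OF assms(1) F'(1)]
      by (simp add: blinfun_compose.rep_eq comp_def bounded_linear_Blinfun_apply[OF assms(1)])
  qed (rule C1_fun_linear_compose[OF bl F'(2)])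
qed

lemma has_derivative_along_axis:
  fixes u :: "real^'n \<Rightarrow> real"
  assumes "(u has_derivative D) (at x)"
  shows "((\<lambda>t. u (x + t *\<^sub>R axis j 1)) has_real_derivative D (axis j 1)) (at 0)"
proof -
  have "((\<lambda>t::real. x + t *\<^sub>R axis j 1) has_derivative (\<lambda>t. t *\<^sub>R axis j 1)) (at 0)"
    by (auto intro!: derivative_eq_intros)
  from diff_chain_at[OF this, of u D] assms
  have "((\<lambda>t. u (x + t *\<^sub>R axis j 1)) has_derivative (\<lambda>t. D (t *\<^sub>R axis j 1))) (at 0)"
    by (simp add: comp_def)
  moreover have "D (t *\<^sub>R axis j 1) = D (axis j 1) * t" for t
    using linear_cmul[OF has_derivative_linear[OF assms], of t] by simp
  ultimately show ?thesis by (simp add: has_field_derivative_def)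
qed

lemma pdiff_eq:
  fixes u :: "real^'n \<Rightarrow> real"
  assumes "(u has_derivative D) (at x)"
  shows "pdiff j u x = D (axis j 1)"
  unfolding pdiff_def by (rule DERIV_imp_deriv[OF has_derivative_along_axis[OF assms]])

definition grad :: "(real^'n \<Rightarrow> real) \<Rightarrow> real^'n \<Rightarrow> real^'n" where
  "grad u x = (\<chi> j. pdiff j u x)"

lemma grad_nth [simp]: "grad u x $ j = pdiff j u x"
  by (simp add: grad_def)

lemma has_derivative_grad:
  fixes u :: "real^'n \<Rightarrow> real"
  assumes "u differentiable (at x)"
  shows "(u has_derivative (\<lambda>h. grad u x \<bullet> h)) (at x)"
proof -
  obtain D where D: "(u has_derivative D) (at x)" using assms unfolding differentiable_def by blast
  have lin: "linear D" using D has_derivative_linear by blast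
  have "D h = grad u x \<bullet> h" for h
  proof -
    have "D h = D (\<Sum>j\<in>UNIV. h $ j *\<^sub>R axis j 1)" using basis_expansion[of h] by (simp add: scalar_mult_eq_scaleR)
    also have "\<dots> = (\<Sum>j\<in>UNIV. h $ j * pdiff j u x)"
      using lin by (simp add: linear_sum linear_cmul pdiff_eq[OF D])
    finally show ?thesis by (simp add: inner_vec_def mult.commute)
  qed
  then have "D = (\<lambda>h. grad u x \<bullet> h)" by auto
  with D show ?thesis by simp
qed

lemma pdiff_blinfun:
  fixes u :: "real^'n \<Rightarrow> real"
  assumes "(u has_derivative blinfun_apply (F' x)) (at x)"
  shows "pdiff j u x = blinfun_apply (F' x) (axis j 1)"
  using assms by (rule pdiff_eq)

text \<open>The bridge between the operator-valued derivative of the definition and the partial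
  derivatives in which all later computations are done.\<close>

lemma C1_fun_iff:
  fixes u :: "real^'n \<Rightarrow> real"
  shows "C1_fun u \<longleftrightarrow> (\<forall>x. u differentiable (at x)) \<and> (\<forall>j. continuous_on UNIV (pdiff j u))"
proof
  assume u: "C1_fun u"
  then obtain F' where F': "\<And>x. (u has_derivative blinfun_apply (F' x)) (at x)" "continuous_on UNIV F'"
    unfolding C1_fun_def by blast
  have "pdiff j u = (\<lambda>x. blinfun_apply (F' x) (axis j 1))" for j using pdiff_blinfun[of u F', OF F'(1)] by auto
  then have "continuous_on UNIV (pdiff j u)" for j
    by (simp add: continuous_intros F'(2))
  then show "(\<forall>x. u differentiable (at x)) \<and> (\<forall>j. continuous_on UNIV (pdiff j u))"
    using C1_fun_differentiable[OF u] by blast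
next
  assume r: "(\<forall>x. u differentiable (at x)) \<and> (\<forall>j. continuous_on UNIV (pdiff j u))"
  have cg: "continuous_on UNIV (grad u)" unfolding grad_def by (intro continuous_intros) (use r in auto)
  show "C1_fun u" unfolding C1_fun_def
  proof (intro exI[of _ "\<lambda>x. blinfun_inner_left (grad u x)"] conjI allI)
    fix x
    have "blinfun_apply (blinfun_inner_left (grad u x)) = (\<lambda>h. grad u x \<bullet> h)" by (auto simp: inner_commute)
    then show "(u has_derivative blinfun_apply (blinfun_inner_left (grad u x))) (at x)"
      using has_derivative_grad[of u x] r by simp
  next
    show "continuous_on UNIV (\<lambda>x. blinfun_inner_left (grad u x))"
      by (rule bounded_linear.continuous_on[OF bounded_linear_blinfun_inner_left cg])
  qed
qed

lemma C1_fun_pdiff_continuous: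
  fixes u :: "real^'n \<Rightarrow> real"
  shows "C1_fun u \<Longrightarrow> continuous_on UNIV (pdiff j u)"
  by (simp add: C1_fun_iff)

lemma C1_fun_grad_continuous:
  fixes u :: "real^'n \<Rightarrow> real"
  shows "C1_fun u \<Longrightarrow> continuous_on UNIV (grad u)"
  unfolding grad_def by (intro continuous_intros C1_fun_pdiff_continuous)

lemma C1_fun_const [simp]: "C1_fun (\<lambda>x. c)"
  unfolding C1_fun_def by (intro exI[of _ "\<lambda>_. 0"]) (auto simp: zero_blinfun.rep_eq)

lemma pdiff_const [simp]:
  "pdiff j (\<lambda>x::real^'n::finite. c) = (\<lambda>x. 0)"
  by (rule ext) (simp add: pdiff_def)

text \<open>This and the following rules are equations between functions, so that they can rewrite
  under a further \<open>pdiff\<close>.\<close>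

lemma pdiff_add:
  fixes u v :: "real^'n \<Rightarrow> real"
  assumes "C1_fun u" "C1_fun v"
  shows "pdiff j (\<lambda>x. u x + v x) = (\<lambda>x. pdiff j u x + pdiff j v x)"
proof
  fix x
  have "((\<lambda>x. u x + v x) has_derivative (\<lambda>h. grad u x \<bullet> h + grad v x \<bullet> h)) (at x)"
    by (intro has_derivative_add has_derivative_grad C1_fun_differentiable assms)
  from pdiff_eq[OF this] show "pdiff j (\<lambda>x. u x + v x) x = pdiff j u x + pdiff j v x"
    by (simp add: inner_axis)
qed

lemma C1_fun_add:
  fixes u v :: "real^'n \<Rightarrow> real"
  assumes "C1_fun u" "C1_fun v"
  shows "C1_fun (\<lambda>x. u x + v x)"
  unfolding C1_fun_iff[of "\<lambda>x. u x + v x"] pdiff_add[OF assms]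
  using C1_fun_differentiable[OF assms(1)] C1_fun_differentiable[OF assms(2)]
    C1_fun_pdiff_continuous[OF assms(1)] C1_fun_pdiff_continuous[OF assms(2)]
  by (intro conjI allI continuous_intros differentiable_add) auto

lemma pdiff_mult:
  fixes u v :: "real^'n \<Rightarrow> real"
  assumes "C1_fun u" "C1_fun v"
  shows "pdiff j (\<lambda>x. u x * v x) = (\<lambda>x. u x * pdiff j v x + pdiff j u x * v x)"
proof
  fix x
  have "((\<lambda>x. u x * v x) has_derivative (\<lambda>h. u x * (grad v x \<bullet> h) + (grad u x \<bullet> h) * v x)) (at x)"
    by (intro has_derivative_mult has_derivative_grad C1_fun_differentiable assms)
  from pdiff_eq[OF this] show "pdiff j (\<lambda>x. u x * v x) x = u x * pdiff j v x + pdiff j u x * v x"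
    by (simp add: inner_axis)
qed

lemma C1_fun_mult:
  fixes u v :: "real^'n \<Rightarrow> real"
  assumes "C1_fun u" "C1_fun v"
  shows "C1_fun (\<lambda>x. u x * v x)"
  unfolding C1_fun_iff[of "\<lambda>x. u x * v x"] pdiff_mult[OF assms]
  using C1_fun_continuous[OF assms(1)] C1_fun_continuous[OF assms(2)]
    C1_fun_differentiable[OF assms(1)] C1_fun_differentiable[OF assms(2)]
    C1_fun_pdiff_continuous[OF assms(1)] C1_fun_pdiff_continuous[OF assms(2)]
  by (intro conjI allI continuous_intros differentiable_mult) auto

lemma pdiff_cmult:
  fixes u :: "real^'n \<Rightarrow> real"
  assumes "C1_fun u"
  shows "pdiff j (\<lambda>x. c * u x) = (\<lambda>x. c * pdiff j u x)"
  using pdiff_mult[OF C1_fun_const[of c] assms] by simp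

lemma C1_fun_uminus:
  fixes u :: "real^'n \<Rightarrow> real"
  shows "C1_fun u \<Longrightarrow> C1_fun (\<lambda>x. - u x)"
  using C1_fun_mult[OF C1_fun_const[of "-1"], of u] by simp

lemma pdiff_uminus:
  fixes u :: "real^'n \<Rightarrow> real"
  shows "C1_fun u \<Longrightarrow> pdiff j (\<lambda>x. - u x) = (\<lambda>x. - pdiff j u x)"
  using pdiff_cmult[of u j "-1"] by simp

lemma C1_fun_diff:
  fixes u v :: "real^'n \<Rightarrow> real"
  shows "C1_fun u \<Longrightarrow> C1_fun v \<Longrightarrow> C1_fun (\<lambda>x. u x - v x)"
  using C1_fun_add[of u "\<lambda>x. - v x"] by (simp add: C1_fun_uminus)

lemma pdiff_diff:
  fixes u v :: "real^'n \<Rightarrow> real"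
  shows "C1_fun u \<Longrightarrow> C1_fun v \<Longrightarrow> pdiff j (\<lambda>x. u x - v x) = (\<lambda>x. pdiff j u x - pdiff j v x)"
  using pdiff_add[of u "\<lambda>x. - v x" j] by (simp add: C1_fun_uminus pdiff_uminus)

lemma C1_fun_sum:
  fixes u :: "'i \<Rightarrow> real^'n \<Rightarrow> real"
  assumes "\<And>i. i \<in> I \<Longrightarrow> C1_fun (u i)"
  shows "C1_fun (\<lambda>x. \<Sum>i\<in>I. u i x)"
  using assms by (induction I rule: infinite_finite_induct) (auto intro: C1_fun_add)

lemma pdiff_sum:
  fixes u :: "'i \<Rightarrow> real^'n \<Rightarrow> real"
  assumes "\<And>i. i \<in> I \<Longrightarrow> C1_fun (u i)"
  shows "pdiff j (\<lambda>x. \<Sum>i\<in>I. u i x) = (\<lambda>x. \<Sum>i\<in>I. pdiff j (u i) x)"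
  using assms by (induction I rule: infinite_finite_induct) (auto simp: pdiff_add C1_fun_sum)

lemma pdiff_compose:
  fixes u :: "real^'n \<Rightarrow> real"
  assumes "C1_fun u" "\<And>x. (f has_real_derivative f' (u x)) (at (u x))"
  shows "pdiff j (\<lambda>x. f (u x)) = (\<lambda>x. f' (u x) * pdiff j u x)"
proof
  fix x
  have "((\<lambda>x. f (u x)) has_derivative (\<lambda>h. f' (u x) * (grad u x \<bullet> h))) (at x)"
    using diff_chain_at[OF has_derivative_grad[OF C1_fun_differentiable[OF assms(1)]]
       assms(2)[unfolded has_field_derivative_def]] by (simp add: comp_def)
  from pdiff_eq[OF this] show "pdiff j (\<lambda>x. f (u x)) x = f' (u x) * pdiff j u x"
    by (simp add: inner_axis)
qed

lemma C1_fun_compose: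
  fixes u :: "real^'n \<Rightarrow> real"
  assumes "C1_fun u" "\<And>x. (f has_real_derivative f' (u x)) (at (u x))" "\<And>x. isCont f' (u x)"
  shows "C1_fun (\<lambda>x. f (u x))"
  unfolding C1_fun_iff pdiff_compose[where f=f and f'=f', OF assms(1,2)]
proof (intro conjI allI continuous_on_mult)
  fix x
  show "(\<lambda>x. f (u x)) differentiable (at x)"
    using diff_chain_at[OF has_derivative_grad[OF C1_fun_differentiable[OF assms(1)]]
       assms(2)[unfolded has_field_derivative_def], of x] unfolding comp_def differentiable_def by blast
next
  have "isCont u x" for x using C1_fun_continuous[OF assms(1)] by (simp add: continuous_on_eq_continuous_at)
  then show "continuous_on UNIV (\<lambda>x. f' (u x))"
    by (intro continuous_at_imp_continuous_on ballI) (rule isCont_o2[where f=u and g=f'], auto simp: assms(3))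
qed (use assms(1) C1_fun_pdiff_continuous in auto)

text \<open>Second-order regularity through iterated partial derivatives, so that closure under
  products, sums and compositions reduces to the first-order rules.\<close>

definition C2_scalar :: "(real^'n \<Rightarrow> real) \<Rightarrow> bool" where
  "C2_scalar u \<longleftrightarrow> C1_fun u \<and> (\<forall>j. C1_fun (pdiff j u))"

lemma C2_scalarD: "C2_scalar u \<Longrightarrow> C1_fun u" "C2_scalar u \<Longrightarrow> C1_fun (pdiff j u)"
  by (auto simp: C2_scalar_def)

lemma C2_fun_imp_C2_scalar:
  fixes u :: "real^'n \<Rightarrow> real"
  assumes "C2_fun u"
  shows "C2_scalar u"
proof -
  obtain F' where F': "\<And>x. (u has_derivative blinfun_apply (F' x)) (at x)" "C1_fun F'"
    using assms unfolding C2_fun_def by blast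
  have "C1_fun u" unfolding C1_fun_def using F' C1_fun_continuous by blast
  moreover have e: "pdiff j u = (\<lambda>x. blinfun_apply (F' x) (axis j 1))" for j using pdiff_blinfun[of u F', OF F'(1)] by auto
  have "C1_fun (pdiff j u)" for j
    unfolding e by (rule C1_fun_linear_compose[OF blinfun.bounded_linear_left F'(2)])
  ultimately show ?thesis by (simp add: C2_scalar_def)
qed

lemma C2_scalar_mult:
  assumes "C2_scalar u" "C2_scalar v"
  shows "C2_scalar (\<lambda>x. u x * v x)"
  using assms unfolding C2_scalar_def
  by (auto simp: pdiff_mult intro!: C1_fun_mult C1_fun_add)

lemma C2_scalar_sum:
  assumes "\<And>i. i \<in> I \<Longrightarrow> C2_scalar (u i)"
  shows "C2_scalar (\<lambda>x. \<Sum>i\<in>I. u i x)"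
  using assms unfolding C2_scalar_def
  by (auto simp: pdiff_sum intro!: C1_fun_sum)

lemma C2_scalar_compose:
  assumes "C2_scalar u" "\<And>x. (f has_real_derivative f' (u x)) (at (u x))"
    "\<And>x. (f' has_real_derivative f'' (u x)) (at (u x))" "\<And>x. isCont f'' (u x)"
  shows "C2_scalar (\<lambda>x. f (u x))"
proof -
  have c: "isCont f' (u x)" for x using assms(3) DERIV_isCont by blast
  have u: "C1_fun u" "\<And>j. C1_fun (pdiff j u)" using C2_scalarD[OF assms(1)] .
  have "C1_fun (pdiff j (\<lambda>x. f (u x)))" for j
    unfolding pdiff_compose[where f=f and f'=f', OF u(1) assms(2)]
    by (rule C1_fun_mult[OF C1_fun_compose[where f=f' and f'=f'', OF u(1) assms(3,4)] u(2)])
  then show ?thesis unfolding C2_scalar_def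
    using C1_fun_compose[where f=f and f'=f', OF u(1) assms(2) c] by blast
qed

section \<open>Symmetry of second partial derivatives\<close>

lemma inc_quotient_MVT:
  fixes u :: "real^'n \<Rightarrow> real"
  assumes "C1_fun u" "t > 0"
  obtains s where "0 < s" "s < t" "u (x + t *\<^sub>R axis j 1) - u x = t * pdiff j u (x + s *\<^sub>R axis j 1)"
proof -
  have d: "((\<lambda>t. u (x + t *\<^sub>R axis j 1)) has_real_derivative pdiff j u (x + s *\<^sub>R axis j 1)) (at s)" for s
  proof -
    have "((\<lambda>t. u ((x + s *\<^sub>R axis j 1) + t *\<^sub>R axis j 1)) has_real_derivative pdiff j u (x + s *\<^sub>R axis j 1)) (at 0)"
      using has_derivative_along_axis[OF has_derivative_grad[OF C1_fun_differentiable[OF assms(1)]], of "x + s *\<^sub>R axis j 1" j]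
      by (simp add: inner_axis)
    then have "((\<lambda>t. u (x + (t + s) *\<^sub>R axis j 1)) has_real_derivative pdiff j u (x + s *\<^sub>R axis j 1)) (at 0)"
      by (simp add: scaleR_add_left add_ac)
    then show ?thesis using DERIV_shift[of "\<lambda>t. u (x + t *\<^sub>R axis j 1)" _ 0 s] by simp
  qed
  show thesis
    using MVT2[OF assms(2), of "\<lambda>t. u (x + t *\<^sub>R axis j 1)" "\<lambda>s. pdiff j u (x + s *\<^sub>R axis j 1)"] d that by auto
qed

lemma continuous_at_small_steps:
  fixes G :: "real^'n \<Rightarrow> real"
  assumes "continuous_on UNIV G" and "\<And>n. y n = x + a n *\<^sub>R e + b n *\<^sub>R e'" "a \<longlonglongrightarrow> 0" "b \<longlonglongrightarrow> 0"
  shows "(\<lambda>n. G (y n)) \<longlonglongrightarrow> G x"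
proof -
  have "(\<lambda>n. x + a n *\<^sub>R e + b n *\<^sub>R e') \<longlonglongrightarrow> x + 0 *\<^sub>R e + 0 *\<^sub>R e'" by (intro tendsto_intros assms)
  moreover have "y = (\<lambda>n. x + a n *\<^sub>R e + b n *\<^sub>R e')" using assms(2) by auto
  ultimately have "y \<longlonglongrightarrow> x" by simp
  moreover have "isCont G x" using assms(1) by (simp add: continuous_on_eq_continuous_at)
  ultimately show ?thesis by (simp add: isCont_tendsto_compose)
qed

text \<open>The mean value theorem is used twice: along \<open>j\<close> for the increment of
  \<open>u\<close> in direction \<open>k\<close>, then along \<open>k\<close> for the partial
  derivative \<open>pdiff j u\<close>.\<close>

lemma second_difference_MVT:
  fixes u :: "real^'n \<Rightarrow> real"
  assumes u: "C2_scalar u" and "t > 0"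
  obtains r s where "0 < r" "r < t" "0 < s" "s < t"
    "u (x + t *\<^sub>R axis j 1 + t *\<^sub>R axis k 1) - u (x + t *\<^sub>R axis j 1) - (u (x + t *\<^sub>R axis k 1) - u x)
      = t * t * pdiff k (pdiff j u) (x + r *\<^sub>R axis j 1 + s *\<^sub>R axis k 1)"
proof -
  define v where "v y = u (y + t *\<^sub>R axis k 1) - u y" for y
  have sh: "C1_fun (\<lambda>y. w (y + c))" "pdiff j (\<lambda>y. w (y + c)) = (\<lambda>y. pdiff j w (y + c))"
    if w: "C1_fun w" for w :: "real^'n \<Rightarrow> real" and c j
  proof -
    have d: "((\<lambda>y. w (y + c)) has_derivative (\<lambda>h. grad w (y + c) \<bullet> h)) (at y)" for y
    proof (rule has_derivative_compose[of "\<lambda>y. y + c" "\<lambda>h. h" y UNIV w "\<lambda>h. grad w (y + c) \<bullet> h"])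
      show "((\<lambda>y. y + c) has_derivative (\<lambda>h. h)) (at y)" by (auto intro!: derivative_eq_intros)
    qed (rule has_derivative_grad[OF C1_fun_differentiable[OF w]])
    have p: "pdiff j (\<lambda>y. w (y + c)) = (\<lambda>y. pdiff j w (y + c))" for j
      using pdiff_eq[OF d] by (auto simp: inner_axis)
    show "pdiff j (\<lambda>y. w (y + c)) = (\<lambda>y. pdiff j w (y + c))" by (rule p)
    show "C1_fun (\<lambda>y. w (y + c))" unfolding C1_fun_iff p
      using d by (auto simp: differentiable_def intro!: continuous_on_compose2[OF C1_fun_pdiff_continuous[OF w]] continuous_intros)
  qed
  have v: "C1_fun v" "pdiff j v = (\<lambda>y. pdiff j u (y + t *\<^sub>R axis k 1) - pdiff j u y)" for j
    unfolding v_def using C2_scalarD(1)[OF u] by (auto simp: sh pdiff_diff intro!: C1_fun_diff)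
  obtain r where r: "0 < r" "r < t" "v (x + t *\<^sub>R axis j 1) - v x = t * pdiff j v (x + r *\<^sub>R axis j 1)"
    using inc_quotient_MVT[OF v(1) assms(2)] by blast
  obtain s where s: "0 < s" "s < t" "pdiff j u (x + r *\<^sub>R axis j 1 + t *\<^sub>R axis k 1) - pdiff j u (x + r *\<^sub>R axis j 1)
     = t * pdiff k (pdiff j u) (x + r *\<^sub>R axis j 1 + s *\<^sub>R axis k 1)"
    using inc_quotient_MVT[OF C2_scalarD(2)[OF u] assms(2)] by blast
  show thesis by (rule that[of r s]) (use r s in \<open>auto simp: v v_def\<close>)
qed

lemma second_difference_tendsto:
  fixes u :: "real^'n \<Rightarrow> real"
  assumes u: "C2_scalar u" and t: "\<And>n. 0 < t n" "t \<longlonglongrightarrow> 0"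
  shows "(\<lambda>n. (u (x + t n *\<^sub>R axis j 1 + t n *\<^sub>R axis k 1) - u (x + t n *\<^sub>R axis j 1) - (u (x + t n *\<^sub>R axis k 1) - u x))
    / (t n * t n)) \<longlonglongrightarrow> pdiff k (pdiff j u) x"
    (is "(\<lambda>n. ?d n / _) \<longlonglongrightarrow> _")
proof -
  have "\<exists>r s. 0 < r \<and> r < t n \<and> 0 < s \<and> s < t n \<and>
    ?d n = t n * t n * pdiff k (pdiff j u) (x + r *\<^sub>R axis j 1 + s *\<^sub>R axis k 1)" for n
    using second_difference_MVT[OF u t(1)] by blast
  then obtain r s where rs: "\<And>n. 0 < r n \<and> r n < t n" "\<And>n. 0 < s n \<and> s n < t n"
    and eq: "\<And>n. ?d n = t n * t n * pdiff k (pdiff j u) (x + r n *\<^sub>R axis j 1 + s n *\<^sub>R axis k 1)"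
    by metis
  have lim: "c \<longlonglongrightarrow> 0" if "\<And>n. 0 < c n \<and> c n < t n" for c
    by (rule tendsto_sandwich[OF _ _ tendsto_const t(2)]; rule always_eventually; use that in \<open>auto intro: less_imp_le\<close>)
  have "(\<lambda>n. pdiff k (pdiff j u) (x + r n *\<^sub>R axis j 1 + s n *\<^sub>R axis k 1)) \<longlonglongrightarrow> pdiff k (pdiff j u) x"
    by (rule continuous_at_small_steps[OF C1_fun_pdiff_continuous[OF C2_scalarD(2)[OF u]] refl lim[OF rs(1)] lim[OF rs(2)]])
  moreover have "?d n / (t n * t n) = pdiff k (pdiff j u) (x + r n *\<^sub>R axis j 1 + s n *\<^sub>R axis k 1)" for n
    unfolding eq using t(1)[of n] by simp
  ultimately show ?thesis by simp
qed

text \<open>The mixed second difference is symmetric in the two directions, while its scaled limit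
  is the mixed derivative in either order.\<close>

lemma pdiff_commute:
  fixes u :: "real^'n \<Rightarrow> real"
  assumes u: "C2_scalar u"
  shows "pdiff k (pdiff j u) x = pdiff j (pdiff k u) x"
proof -
  define t :: "nat \<Rightarrow> real" where "t n = inverse (real (Suc n))" for n
  have t: "\<And>n. 0 < t n" "t \<longlonglongrightarrow> 0" unfolding t_def by (simp, rule LIMSEQ_inverse_real_of_nat)
  have "u (x + t n *\<^sub>R axis k 1 + t n *\<^sub>R axis j 1) - u (x + t n *\<^sub>R axis k 1) - (u (x + t n *\<^sub>R axis j 1) - u x)
    = u (x + t n *\<^sub>R axis j 1 + t n *\<^sub>R axis k 1) - u (x + t n *\<^sub>R axis j 1) - (u (x + t n *\<^sub>R axis k 1) - u x)" for n
    by (simp add: add_ac)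
  with second_difference_tendsto[OF u t, of x k j] second_difference_tendsto[OF u t, of x j k]
  show ?thesis by (simp only: LIMSEQ_unique)
qed

section \<open>Functions of compact support\<close>

lemma integrable_compact_support:
  fixes u :: "'a::euclidean_space \<Rightarrow> real"
  assumes "continuous_on UNIV u" "\<And>x. R \<le> norm x \<Longrightarrow> u x = 0"
  shows "integrable lborel u"
proof -
  have "integrable lborel (\<lambda>x. indicator (cball 0 R) x *\<^sub>R u x)"
    by (rule borel_integrable_compact[OF compact_cball continuous_on_subset[OF assms(1)]]) auto
  also have "(\<lambda>x. indicator (cball 0 R) x *\<^sub>R u x) = u"
    using assms(2) by (auto simp: fun_eq_iff indicator_def)
  finally show ?thesis .
qed

lemma bounded_compact_support:
  fixes u :: "'a::euclidean_space \<Rightarrow> real"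
  assumes "continuous_on UNIV u" "\<And>x. R \<le> norm x \<Longrightarrow> u x = 0"
  obtains B where "\<And>x. \<bar>u x\<bar> \<le> B"
proof -
  have "compact (u ` cball 0 R)" by (intro compact_continuous_image continuous_on_subset[OF assms(1)]) auto
  then have "bounded (u ` cball 0 R)" by (rule compact_imp_bounded)
  then obtain B where B: "\<And>x. x \<in> cball 0 R \<Longrightarrow> \<bar>u x\<bar> \<le> B"
    unfolding bounded_iff by (metis imageI real_norm_def)
  show thesis
  proof (rule that[of "max B 0"])
    fix x show "\<bar>u x\<bar> \<le> max B 0" using B[of x] assms(2)[of x] by (cases "norm x \<le> R") auto
  qed
qed

lemma pdiff_outside_support:
  fixes u :: "real^'n \<Rightarrow> real"
  assumes "\<And>x. R \<le> norm x \<Longrightarrow> u x = 0" "C1_fun u" "R \<le> norm x"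
  shows "pdiff j u x = 0"
proof -
  have o: "pdiff j u y = 0" if "R < norm y" for y
  proof -
    have "open {y::real^'n. R < norm y}" by (intro open_Collect_less continuous_intros)
    then have "eventually (\<lambda>z. u z = 0) (nhds y)"
      using that assms(1) by (auto simp: eventually_nhds intro!: exI[of _ "{y. R < norm y}"])
    then have "(u has_derivative (\<lambda>h. 0)) (at y)"
      using has_derivative_transform_eventually[of "\<lambda>_. 0" "\<lambda>_. 0" y UNIV u] assms(1)[of y] that
      by (auto simp: eventually_at_filter eventually_mono)
    from pdiff_eq[OF this] show ?thesis by simp
  qed
  show ?thesis
  \<comment> \<open>On the sphere itself \<open>u\<close> need not vanish nearby, so the derivative
    is reached as a limit from outside along the ray through \<open>x\<close>. The origin has no
    such ray, but there \<open>R\<close> is at most 0 and \<open>u\<close> is identically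
    zero.\<close>
  proof (cases "x = 0")
    case True
    then have "R \<le> 0" using assms(3) by simp
    then have "u y = 0" for y using assms(1)[of y] by (simp add: order_trans[OF _ norm_ge_zero])
    then have "u = (\<lambda>_. 0)" by auto
    then show ?thesis by simp
  next
    case False
    define y where "y n = (1 + inverse (real (Suc n))) *\<^sub>R x" for n
    have "y \<longlonglongrightarrow> (1 + 0) *\<^sub>R x" unfolding y_def by (intro tendsto_intros LIMSEQ_inverse_real_of_nat)
    then have "y \<longlonglongrightarrow> x" by simp
    then have "(\<lambda>n. pdiff j u (y n)) \<longlonglongrightarrow> pdiff j u x"
      using C1_fun_pdiff_continuous[OF assms(2)] by (simp add: continuous_on_eq_continuous_at isCont_tendsto_compose)
    moreover have "pdiff j u (y n) = 0" for n
    proof (rule o)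
      have "norm x * 1 < norm x * (1 + inverse (real (Suc n)))" using False by (intro mult_strict_left_mono) auto
      then show "R < norm (y n)" using assms(3) by (simp add: y_def mult.commute del: of_nat_Suc)
    qed
    ultimately show ?thesis using LIMSEQ_unique[OF _ tendsto_const] by simp
  qed
qed

text \<open>Translation invariance makes every difference quotient integrate to zero, and the
  quotients converge dominatedly to the partial derivative.\<close>

lemma integral_pdiff_eq_0:
  fixes u :: "real^'n \<Rightarrow> real"
  assumes u: "C1_fun u" and supp: "\<And>x. R \<le> norm x \<Longrightarrow> u x = 0"
  shows "(LBINT x. pdiff j u x) = 0"
proof -
  define t :: "nat \<Rightarrow> real" where "t n = inverse (real (Suc n))" for n
  have t: "t n > 0" "t n \<le> 1" for n by (auto simp: t_def inverse_le_1_iff)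
  have t0: "t \<longlonglongrightarrow> 0" unfolding t_def by (rule LIMSEQ_inverse_real_of_nat)
  have cu: "continuous_on UNIV u" using C1_fun_continuous[OF u] .
  have cp: "continuous_on UNIV (pdiff j u)" using C1_fun_pdiff_continuous[OF u] .
  obtain B where B: "\<And>x. \<bar>pdiff j u x\<bar> \<le> B"
    using bounded_compact_support[of "pdiff j u" R, OF cp pdiff_outside_support[of R u]] supp u by metis
  define q where "q n x = (u (x + t n *\<^sub>R axis j 1) - u x) / t n" for n x
  have iu: "integrable lborel u" by (rule integrable_compact_support[OF cu supp])
  have iq: "(LBINT x. q n x) = 0" for n
  proof -
    have 1: "integrable lborel (\<lambda>x. u (t n *\<^sub>R axis j 1 + x))" "(LBINT x. u (t n *\<^sub>R axis j 1 + x)) = (LBINT x. u x)"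
    proof -
      have m: "u \<in> borel_measurable borel" using cu by (rule borel_measurable_continuous_onI)
      have "integrable (distr lborel borel ((+) (t n *\<^sub>R axis j 1))) u"
        using iu by (simp add: lborel_distr_plus)
      then show "integrable lborel (\<lambda>x. u (t n *\<^sub>R axis j 1 + x))"
        using m by (subst (asm) integrable_distr_eq) auto
      have "(LBINT x. u x) = (\<integral>x. u x \<partial>(distr lborel borel ((+) (t n *\<^sub>R axis j 1))))"
        by (simp add: lborel_distr_plus)
      then show "(LBINT x. u (t n *\<^sub>R axis j 1 + x)) = (LBINT x. u x)"
        using m by (subst (asm) integral_distr) auto
    qed
    then show ?thesis using iu unfolding q_def by (simp add: add.commute)
  qed
  have "(\<lambda>n. \<integral>x. q n x \<partial>lborel) \<longlonglongrightarrow> (LBINT x. pdiff j u x)"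
  proof (rule integral_dominated_convergence[where w="\<lambda>x. B * indicator (cball 0 (R + 1)) x"])
    show "pdiff j u \<in> borel_measurable lborel" using cp by (simp add: borel_measurable_continuous_onI)
    show "q n \<in> borel_measurable lborel" for n unfolding q_def using t(1)[of n]
      by (auto intro!: borel_measurable_continuous_onI continuous_intros continuous_on_compose2[OF cu])
    \<comment> \<open>Shifts have length at most 1, so every quotient is supported in the ball of
      radius \<open>R + 1\<close>; by the mean value theorem it is bounded there by
      \<open>B\<close>.\<close>
    show "integrable lborel (\<lambda>x. B * indicator (cball 0 (R + 1)) x)"
      using emeasure_bounded_finite[OF bounded_cball] by (intro integrable_mult_right integrable_real_indicator) auto
    show "AE x in lborel. (\<lambda>n. q n x) \<longlonglongrightarrow> pdiff j u x"
    proof (rule AE_I2)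
      fix x
      have "((\<lambda>s. (u (x + s *\<^sub>R axis j 1) - u x) / s) \<longlongrightarrow> pdiff j u x) (at 0)"
        using has_derivative_along_axis[OF has_derivative_grad[OF C1_fun_differentiable[OF u]], of x j]
        by (simp add: DERIV_def inner_axis)
      moreover have "t n \<noteq> 0" for n using t(1)[of n] by simp
      then have "filterlim t (at 0) sequentially" by (intro filterlim_atI[OF t0]) simp
      ultimately show "(\<lambda>n. q n x) \<longlonglongrightarrow> pdiff j u x" unfolding q_def by (rule filterlim_compose)
    qed
    show "AE x in lborel. norm (q n x) \<le> B * indicator (cball 0 (R + 1)) x" for n
    proof (rule AE_I2)
      fix x
      show "norm (q n x) \<le> B * indicator (cball 0 (R + 1)) x"
      proof (cases "norm x \<le> R + 1")
        case True
        obtain s where "u (x + t n *\<^sub>R axis j 1) - u x = t n * pdiff j u (x + s *\<^sub>R axis j 1)"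
          using inc_quotient_MVT[OF u t(1)] by blast
        then have "q n x = pdiff j u (x + s *\<^sub>R axis j 1)" using t(1)[of n] by (simp add: q_def)
        then show ?thesis using B True by simp
      next
        case False
        have "norm x - norm (t n *\<^sub>R (axis j 1 :: real^'n)) \<le> norm (x + t n *\<^sub>R axis j 1)"
          using norm_diff_ineq by (metis add.commute norm_triangle_ineq2 diff_minus_eq_add norm_minus_cancel)
        moreover have "norm (t n *\<^sub>R (axis j 1 :: real^'n)) \<le> 1" using t[of n] by simp
        ultimately have "R \<le> norm (x + t n *\<^sub>R axis j 1)" using False by linarith
        then have "q n x = 0" using supp False by (simp add: q_def)
        then show ?thesis using False by simp
      qed
    qed
  qed
  then show ?thesis unfolding iq using LIMSEQ_unique[OF tendsto_const] by metis
qed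

section \<open>Symmetric matrices and strong concavity\<close>

lemma symmetric_dot_swap:
  fixes A :: "real^'n^'n::finite"
  assumes "transpose A = A"
  shows "x \<bullet> (A *v y) = y \<bullet> (A *v x)"
  using dot_lmul_matrix[of x A y] assms by (metis inner_commute vector_transpose_matrix)

text \<open>Eigenvectors of distinct eigenvalues are orthogonal, hence independent. Finiteness is
  what gives \<open>Min\<close> and \<open>Max\<close> in the eigenvalue definitions their
  meaning.\<close>

lemma finite_eigenvals_symmetric:
  fixes A :: "real^'n^'n::finite"
  assumes A: "transpose A = A"
  shows "finite (eigenvals A)"
proof -
  have "\<forall>c\<in>eigenvals A. \<exists>v. v \<noteq> 0 \<and> A *v v = c *\<^sub>R v" by (auto simp: eigenvals_def)
  then obtain v where v: "\<And>c. c \<in> eigenvals A \<Longrightarrow> v c \<noteq> 0" "\<And>c. c \<in> eigenvals A \<Longrightarrow> A *v v c = c *\<^sub>R v c"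
    by metis
  have orth: "v c \<bullet> v d = 0" if "c \<in> eigenvals A" "d \<in> eigenvals A" "c \<noteq> d" for c d
    using symmetric_dot_swap[OF A, of "v c" "v d"] v(2)[OF that(1)] v(2)[OF that(2)] that(3)
    by (auto simp: inner_commute)
  have inj: "inj_on v (eigenvals A)"
    by (rule inj_onI, rule ccontr) (use orth v(1) in \<open>force\<close>)
  have "pairwise orthogonal (v ` eigenvals A)"
    unfolding pairwise_def orthogonal_def using orth by auto
  moreover have "0 \<notin> v ` eigenvals A" using v(1) by auto
  ultimately have "independent (v ` eigenvals A)" by (rule pairwise_orthogonal_independent)
  then have "finite (v ` eigenvals A)" using independent_bound by blast
  then show ?thesis using inj finite_imageD by blast
qed

text \<open>A minimizer \<open>z\<close> of the quadratic form on the unit sphere is an eigenvector: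
  the form of \<open>A\<close> minus \<open>c\<close> is nonnegative and vanishes at
  \<open>z\<close>, so its first variation at \<open>z\<close> vanishes too.\<close>

lemma Rayleigh_minimum_eigenval:
  fixes A :: "real^'n^'n::finite"
  assumes A: "transpose A = A"
  obtains c where "c \<in> eigenvals A" "\<And>x. c * (norm x)\<^sup>2 \<le> x \<bullet> (A *v x)"
proof -
  have ne: "sphere (0::real^'n) 1 \<noteq> {}" by (metis empty_iff mem_sphere_0 norm_axis_1)
  have "continuous_on (sphere 0 1) (\<lambda>x. x \<bullet> (A *v x))"
    by (intro continuous_intros linear_continuous_on) auto
  then obtain z where z: "norm z = 1" "\<And>x. norm x = 1 \<Longrightarrow> z \<bullet> (A *v z) \<le> x \<bullet> (A *v x)"
    using continuous_attains_inf[OF compact_sphere ne] by (metis mem_sphere_0)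
  define c where "c = z \<bullet> (A *v z)"
  have ge: "c * (norm x)\<^sup>2 \<le> x \<bullet> (A *v x)" for x
  proof (cases "x = 0")
    case False
    have "c \<le> (x /\<^sub>R norm x) \<bullet> (A *v (x /\<^sub>R norm x))" unfolding c_def using False by (intro z(2)) auto
    also have "\<dots> = (x \<bullet> (A *v x)) / (norm x)\<^sup>2"
      by (simp add: matrix_vector_mult_scaleR power2_eq_square field_simps)
    finally show ?thesis using False by (simp add: pos_le_divide_eq)
  qed auto
  define r where "r = A *v z - c *\<^sub>R z"
  define b where "b = r \<bullet> (A *v r) - c * (norm r)\<^sup>2"
  have b0: "b \<ge> 0" using ge[of r] by (simp add: b_def)
  \<comment> \<open>The nonnegative form evaluated at \<open>z + s *\<^sub>R r\<close>. Its linear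
    term in \<open>s\<close> has the coefficient 2 |r|^2, because \<open>r\<close> is the residual
    of the eigenvalue equation; suitable negative \<open>s\<close> then forces
    \<open>r = 0\<close>.\<close>
  have q: "0 \<le> 2 * s * (norm r)\<^sup>2 + s\<^sup>2 * b" for s
  proof -
    have "c * (norm (z + s *\<^sub>R r))\<^sup>2 \<le> (z + s *\<^sub>R r) \<bullet> (A *v (z + s *\<^sub>R r))" by (rule ge)
    moreover have "(norm (z + s *\<^sub>R r))\<^sup>2 = 1 + 2 * s * (z \<bullet> r) + s\<^sup>2 * (norm r)\<^sup>2"
      unfolding power2_norm_eq_inner using z(1) by (simp add: inner_add power2_eq_square inner_commute norm_eq_1 algebra_simps)
    moreover have "(z + s *\<^sub>R r) \<bullet> (A *v (z + s *\<^sub>R r)) = c + 2 * s * (r \<bullet> (A *v z)) + s\<^sup>2 * (r \<bullet> (A *v r))"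
      using symmetric_dot_swap[OF A, of z r]
      by (simp add: matrix_vector_right_distrib matrix_vector_mult_scaleR inner_add power2_eq_square c_def algebra_simps)
    moreover have "r \<bullet> (A *v z) = (norm r)\<^sup>2 + c * (z \<bullet> r)"
      unfolding power2_norm_eq_inner by (simp add: r_def inner_diff algebra_simps inner_commute)
    ultimately show ?thesis by (simp add: b_def algebra_simps)
  qed
  have "r = 0"
  proof (rule ccontr)
    assume r: "r \<noteq> 0"
    show False
    proof (cases "b = 0")
      case True then show False using q[of "-1"] r by simp
    next
      case False
      then have "b > 0" using b0 by simp
      have e: "2 * (- (norm r)\<^sup>2 / b) * (norm r)\<^sup>2 + (- (norm r)\<^sup>2 / b)\<^sup>2 * b = - (((norm r)\<^sup>2)\<^sup>2 / b)"
        using \<open>b > 0\<close> by (simp add: power2_eq_square field_simps)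
      have "((norm r)\<^sup>2)\<^sup>2 / b > 0" using r \<open>b > 0\<close> by simp
      then show False using q[of "- (norm r)\<^sup>2 / b"] unfolding e by linarith
    qed
  qed
  then have "A *v z = c *\<^sub>R z" by (simp add: r_def)
  moreover have "z \<noteq> 0" using z(1) by auto
  ultimately have "c \<in> eigenvals A" by (auto simp: eigenvals_def)
  then show thesis using ge that by blast
qed

lemma lambda_min_le_Rayleigh:
  fixes A :: "real^'n^'n::finite"
  assumes "transpose A = A"
  shows "lambda_min A * (norm x)\<^sup>2 \<le> x \<bullet> (A *v x)"
proof -
  obtain c where c: "c \<in> eigenvals A" "\<And>x. c * (norm x)\<^sup>2 \<le> x \<bullet> (A *v x)"
    using Rayleigh_minimum_eigenval[OF assms] by blast
  have "lambda_min A \<le> c" unfolding lambda_min_def using c(1) finite_eigenvals_symmetric[OF assms] by (intro Min_le)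
  then have "lambda_min A * (norm x)\<^sup>2 \<le> c * (norm x)\<^sup>2" by (intro mult_right_mono) auto
  with c(2)[of x] show ?thesis by linarith
qed

lemma lambda_min_mem_eigenvals:
  fixes A :: "real^'n^'n::finite"
  assumes "transpose A = A"
  shows "lambda_min A \<in> eigenvals A"
  using Rayleigh_minimum_eigenval[OF assms] finite_eigenvals_symmetric[OF assms]
  unfolding lambda_min_def by (metis Min_in empty_iff)

lemma Rayleigh_le_lambda_max:
  fixes A :: "real^'n^'n::finite"
  assumes "transpose A = A"
  shows "x \<bullet> (A *v x) \<le> lambda_max A * (norm x)\<^sup>2"
proof -
  have mv: "(- A) *v y = - (A *v y)" for y by (metis diff_0 matrix_vector_mult_0 matrix_vector_mult_diff_rdistrib)
  have "transpose (- A) = - A" using assms by (simp add: transpose_def vec_eq_iff)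
  then obtain c where c: "c \<in> eigenvals (- A)" "\<And>x. c * (norm x)\<^sup>2 \<le> x \<bullet> ((- A) *v x)"
    using Rayleigh_minimum_eigenval by blast
  from c(1) obtain v where v: "v \<noteq> 0" "A *v v = (- c) *\<^sub>R v" unfolding eigenvals_def mv
    by (auto simp: minus_equation_iff[of "A *v _"])
  then have "- c \<in> eigenvals A" by (auto simp: eigenvals_def)
  then have "- c \<le> lambda_max A" unfolding lambda_max_def using finite_eigenvals_symmetric[OF assms] by (intro Max_ge)
  then have "- c * (norm x)\<^sup>2 \<le> lambda_max A * (norm x)\<^sup>2" by (intro mult_right_mono) auto
  with c(2)[of x] show ?thesis unfolding mv by simp
qed

lemma transpose_diffusion: "transpose (diffusion g x) = diffusion g x"
  by (simp add: diffusion_def matrix_transpose_mul)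

lemma inner_diffusion:
  "v \<bullet> (diffusion g x *v v') = (transpose (g x) *v v) \<bullet> (transpose (g x) *v v')"
  by (simp add: diffusion_def matrix_vector_mul_assoc[symmetric] dot_matrix_vector_mul[symmetric])
    (metis dot_lmul_matrix vector_transpose_matrix transpose_transpose)

lemma diffusion_elliptic:
  assumes "lam = (INF x. lambda_min (diffusion g x))"
  shows "lam * (norm v)\<^sup>2 \<le> (norm (transpose (g x) *v v))\<^sup>2"
proof -
  \<comment> \<open>An infimum of reals is a lower bound only if the family is bounded below; here 0
    is a bound, since g g^T is positive semidefinite.\<close>
  have "0 \<le> lambda_min (diffusion g y)" for y
  proof -
    obtain w where w: "w \<noteq> 0" "diffusion g y *v w = lambda_min (diffusion g y) *\<^sub>R w"
      using lambda_min_mem_eigenvals[OF transpose_diffusion, of g y] by (auto simp: eigenvals_def)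
    have "lambda_min (diffusion g y) * (norm w)\<^sup>2 = (norm (transpose (g y) *v w))\<^sup>2"
      using inner_diffusion[of w g y w] unfolding w(2) by (simp add: power2_norm_eq_inner)
    then have "0 \<le> lambda_min (diffusion g y) * (norm w)\<^sup>2" by simp
    then show ?thesis using w(1) by (simp add: zero_le_mult_iff)
  qed
  then have "lam \<le> lambda_min (diffusion g x)" unfolding assms
    by (intro cINF_lower) (auto intro!: bdd_belowI)
  then have "lam * (norm v)\<^sup>2 \<le> lambda_min (diffusion g x) * (norm v)\<^sup>2" by (intro mult_right_mono) auto
  also have "\<dots> \<le> v \<bullet> (diffusion g x *v v)" by (rule lambda_min_le_Rayleigh[OF transpose_diffusion])
  finally show ?thesis by (simp add: inner_diffusion power2_norm_eq_inner)
qed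

lemma transpose_hessian:
  "C2_scalar u \<Longrightarrow> transpose (hessian u x) = hessian u x"
  by (simp add: transpose_def hessian_def vec_eq_iff pdiff_commute)

lemma hessian_quadratic_le:
  fixes u :: "real^'n \<Rightarrow> real"
  assumes "C2_scalar u" "bdd_above (range (\<lambda>x. lambda_max (hessian u x)))"
    and "mu = - (SUP x. lambda_max (hessian u x))"
  shows "v \<bullet> (hessian u x *v v) \<le> - mu * (norm v)\<^sup>2"
proof -
  have "lambda_max (hessian u x) \<le> - mu" unfolding assms(3) using cSUP_upper[OF UNIV_I assms(2), of x] by simp
  then have "lambda_max (hessian u x) * (norm v)\<^sup>2 \<le> - mu * (norm v)\<^sup>2" by (intro mult_right_mono) auto
  then show ?thesis using Rayleigh_le_lambda_max[OF transpose_hessian[OF assms(1)], of v x] by linarith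
qed

section \<open>Strong concavity along segments\<close>

lemma DERIV_along_line:
  fixes u :: "real^'n \<Rightarrow> real"
  assumes "C1_fun u"
  shows "((\<lambda>r. u (y + r *\<^sub>R d)) has_real_derivative grad u (y + r *\<^sub>R d) \<bullet> d) (at r)"
proof -
  have "((\<lambda>r. y + r *\<^sub>R d) has_derivative (\<lambda>h. h *\<^sub>R d)) (at r)" by (auto intro!: derivative_eq_intros)
  from has_derivative_compose[OF this has_derivative_grad[OF C1_fun_differentiable[OF assms]]]
  have "((\<lambda>r. u (y + r *\<^sub>R d)) has_derivative (\<lambda>h. grad u (y + r *\<^sub>R d) \<bullet> (h *\<^sub>R d))) (at r)" .
  then show ?thesis by (simp add: has_field_derivative_def mult.commute[of _ "_ \<bullet> _"] mult_commute_abs)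
qed

lemma strongly_concave:
  fixes u :: "real^'n \<Rightarrow> real"
  assumes u: "C2_scalar u" and H: "\<And>x v. v \<bullet> (hessian u x *v v) \<le> - mu * (norm v)\<^sup>2"
    and t: "0 \<le> t" "t \<le> 1"
  shows "t * u x + (1 - t) * u y + mu * t * (1 - t) / 2 * (norm (x - y))\<^sup>2 \<le> u (t *\<^sub>R x + (1 - t) *\<^sub>R y)"
proof -
  define d where "d = x - y"
  \<comment> \<open>The added quadratic compensates the Hessian bound exactly, so \<open>f\<close>
    is concave on the line; undoing it gives the extra term with t (1 - t).\<close>
  define f where "f r = u (y + r *\<^sub>R d) + mu / 2 * (norm d)\<^sup>2 * r\<^sup>2" for r
  define f' where "f' r = grad u (y + r *\<^sub>R d) \<bullet> d + mu * (norm d)\<^sup>2 * r" for r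
  define f'' where "f'' r = d \<bullet> (hessian u (y + r *\<^sub>R d) *v d) + mu * (norm d)\<^sup>2" for r
  have 1: "(f has_real_derivative f' r) (at r)" for r
    unfolding f_def f'_def by (auto intro!: derivative_eq_intros DERIV_along_line C2_scalarD(1)[OF u])
  have "((\<lambda>r. grad u (y + r *\<^sub>R d) \<bullet> d) has_real_derivative d \<bullet> (hessian u (y + r *\<^sub>R d) *v d)) (at r)" for r
  proof -
    have "((\<lambda>r. \<Sum>k\<in>UNIV. pdiff k u (y + r *\<^sub>R d) * d $ k) has_real_derivative
      (\<Sum>k\<in>UNIV. (grad (pdiff k u) (y + r *\<^sub>R d) \<bullet> d) * d $ k)) (at r)"
      by (auto intro!: derivative_eq_intros DERIV_along_line C2_scalarD(2)[OF u])
    moreover have "(\<Sum>k\<in>UNIV. (grad (pdiff k u) (y + r *\<^sub>R d) \<bullet> d) * d $ k) = d \<bullet> (hessian u (y + r *\<^sub>R d) *v d)"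
      by (simp add: inner_vec_def matrix_vector_mult_def hessian_def pdiff_commute[OF u] mult.commute)
    moreover have "(\<lambda>r. \<Sum>k\<in>UNIV. pdiff k u (y + r *\<^sub>R d) * d $ k) = (\<lambda>r. grad u (y + r *\<^sub>R d) \<bullet> d)"
      by (simp add: inner_vec_def)
    ultimately show ?thesis by simp
  qed
  then have 2: "(f' has_real_derivative f'' r) (at r)" for r
    unfolding f'_def f''_def by (auto intro!: derivative_eq_intros)
  have 3: "f'' r \<le> 0" for r using H[of d "y + r *\<^sub>R d"] by (simp add: f''_def)
  have "concave_on UNIV f" by (rule f''_le0_imp_concave[OF _ 1 2 3]) auto
  then have "t * f 1 + (1 - t) * f 0 \<le> f (t * 1 + (1 - t) * 0)"
    using t concave_onD[of UNIV f "1 - t" 1 0] by simp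
  moreover have "y + t *\<^sub>R d = t *\<^sub>R x + (1 - t) *\<^sub>R y" by (simp add: d_def algebra_simps)
  ultimately have "t * (u x + mu / 2 * (norm d)\<^sup>2) + (1 - t) * u y \<le> u (t *\<^sub>R x + (1 - t) *\<^sub>R y) + mu / 2 * (norm d)\<^sup>2 * t\<^sup>2"
    by (simp add: f_def) (simp add: d_def)
  then show ?thesis unfolding d_def[symmetric] by (simp add: power2_eq_square algebra_simps add_divide_distrib diff_divide_distrib)
qed

section \<open>Cutoff functions\<close>

lemma DERIV_pos_part_squared: "((\<lambda>y. (max 0 y)\<^sup>2) has_real_derivative 2 * max 0 y) (at (y::real))"
proof -
  have "((\<lambda>y. y * \<bar>y\<bar>) has_real_derivative 2 * \<bar>y\<bar>) (at y)"
  proof (cases "y = 0")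
    case True
    have "((\<lambda>h::real. (h * \<bar>h\<bar>) / h) \<longlongrightarrow> 0) (at 0)"
    proof (rule Lim_transform_eventually)
      show "((\<lambda>h::real. \<bar>h\<bar>) \<longlongrightarrow> 0) (at 0)" by (intro tendsto_eq_intros) auto
      show "\<forall>\<^sub>F h::real in at 0. \<bar>h\<bar> = h * \<bar>h\<bar> / h" by (auto simp: eventually_at_filter)
    qed
    then show ?thesis using True by (simp add: DERIV_def)
  next
    case False
    have "((\<lambda>y. y * \<bar>y\<bar>) has_real_derivative 2 * \<bar>y\<bar>) (at y)"
      if "c = sgn y" "c * c = 1" for c
    proof (rule has_field_derivative_transform_within_open[of "\<lambda>y. c * y\<^sup>2" _ y "{z. 0 < c * z}"])
      show "((\<lambda>y. c * y\<^sup>2) has_real_derivative 2 * \<bar>y\<bar>) (at y)"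
        using that by (auto intro!: derivative_eq_intros simp: abs_sgn)
      show "open {z. 0 < c * z}" by (intro open_Collect_less continuous_intros)
      show "y \<in> {z. 0 < c * z}" using that False by (auto simp: sgn_if split: if_splits)
      show "c * z\<^sup>2 = z * \<bar>z\<bar>" if "z \<in> {z. 0 < c * z}" for z
        using that \<open>c = sgn y\<close> False by (auto simp: sgn_if power2_eq_square abs_if split: if_splits)
    qed
    then show ?thesis using False by (simp add: sgn_if split: if_splits)
  qed
  moreover have "((\<lambda>y. y\<^sup>2) has_real_derivative 2 * y) (at y)" by (auto intro!: derivative_eq_intros)
  ultimately have "((\<lambda>y. (y\<^sup>2 + y * \<bar>y\<bar>) / 2) has_real_derivative (2 * y + 2 * \<bar>y\<bar>) / 2) (at y)"
    by (intro DERIV_cdivide DERIV_add)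
  \<comment> \<open>This formula avoids treating the kink of the positive part: only y |y| has to be
    differentiated at 0.\<close>
  moreover have "(\<lambda>y::real. (y\<^sup>2 + y * \<bar>y\<bar>) / 2) = (\<lambda>y. (max 0 y)\<^sup>2)"
    by (auto simp: fun_eq_iff max_def power2_eq_square)
  moreover have "(2 * y + 2 * \<bar>y\<bar>) / 2 = 2 * max 0 y" by (auto simp: max_def)
  ultimately show ?thesis by simp
qed

lemma DERIV_pos_part_cubed: "((\<lambda>y. (max 0 y)^3) has_real_derivative 3 * (max 0 y)\<^sup>2) (at (y::real))"
proof -
  have "((\<lambda>y. y * (max 0 y)\<^sup>2) has_real_derivative (max 0 y)\<^sup>2 + y * (2 * max 0 y)) (at y)"
    using DERIV_mult[OF DERIV_ident DERIV_pos_part_squared[of y]] by (simp add: mult.commute)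
  moreover have "(\<lambda>y::real. y * (max 0 y)\<^sup>2) = (\<lambda>y. (max 0 y)^3)"
    by (auto simp: fun_eq_iff max_def power2_eq_square power3_eq_cube)
  moreover have "(max 0 y)\<^sup>2 + y * (2 * max 0 y) = 3 * (max 0 y)\<^sup>2"
    by (auto simp: max_def power2_eq_square)
  ultimately show ?thesis by simp
qed

definition cutoff_base :: "real \<Rightarrow> real^'n \<Rightarrow> real" where
  "cutoff_base R x = max 0 (1 - (norm x)\<^sup>2 / R\<^sup>2)"

text \<open>The third power is the least integer power of the positive part that is twice
  continuously differentiable. The function is a polynomial inside the ball of radius
  \<open>R\<close>, hence has explicit derivatives.\<close>

definition cutoff :: "real \<Rightarrow> real^'n \<Rightarrow> real" where
  "cutoff R x = (cutoff_base R x)^3"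

lemma C1_fun_coord: "C1_fun (\<lambda>x::real^'n::finite. x $ k)"
  and pdiff_coord: "pdiff j (\<lambda>x::real^'n::finite. x $ k) = (\<lambda>x. if j = k then 1 else 0)"
proof -
  have 1: "((\<lambda>x::real^'n. x $ k) has_derivative (\<lambda>h. h $ k)) (at x)" for x
    by (rule bounded_linear_imp_has_derivative[OF bounded_linear_vec_nth])
  show 2: "pdiff j (\<lambda>x::real^'n. x $ k) = (\<lambda>x. if j = k then 1 else 0)" for j
    using pdiff_eq[OF 1] by (auto simp: axis_def)
  show "C1_fun (\<lambda>x::real^'n::finite. x $ k)" unfolding C1_fun_iff 2
    using 1 by (auto simp: differentiable_def)
qed

lemma cutoff_derivs:
  assumes R: "R > 0"
  shows C2_scalar_cutoff: "C2_scalar (cutoff R :: real^'n \<Rightarrow> real)"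
    and pdiff_cutoff: "pdiff j (cutoff R :: real^'n \<Rightarrow> real) = (\<lambda>x. - 6 / R\<^sup>2 * (cutoff_base R x)\<^sup>2 * x $ j)"
    and pdiff2_cutoff: "pdiff k (pdiff j (cutoff R :: real^'n \<Rightarrow> real)) =
      (\<lambda>x. 24 / R^4 * cutoff_base R x * x $ j * x $ k - (if k = j then 6 / R\<^sup>2 * (cutoff_base R x)\<^sup>2 else 0))"
proof -
  define q :: "real^'n \<Rightarrow> real" where "q = (\<lambda>x. 1 - 1 / R\<^sup>2 * (\<Sum>i\<in>UNIV. x $ i * x $ i))"
  have nq: "1 - (norm x)\<^sup>2 / R\<^sup>2 = q x" for x
    by (simp add: q_def power2_norm_eq_inner inner_vec_def)
  have C1s: "C1_fun (\<lambda>x::real^'n. \<Sum>i\<in>UNIV. x $ i * x $ i)" by (intro C1_fun_sum C1_fun_mult C1_fun_coord)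
  have pq: "pdiff j q = (\<lambda>x. - 2 / R\<^sup>2 * x $ j)" for j
  proof -
    have "pdiff j (\<lambda>x::real^'n. \<Sum>i\<in>UNIV. x $ i * x $ i) = (\<lambda>x. \<Sum>i\<in>UNIV. x $ i * (if j = i then 1 else 0) + (if j = i then 1 else 0) * x $ i)"
      by (simp add: pdiff_sum pdiff_mult C1_fun_mult C1_fun_coord pdiff_coord)
    also have "\<dots> = (\<lambda>x. \<Sum>i\<in>UNIV. if j = i then 2 * x $ i else 0)"
      by (intro ext sum.cong) auto
    also have "\<dots> = (\<lambda>x. 2 * x $ j)" by simp
    finally have "pdiff j (\<lambda>x::real^'n. \<Sum>i\<in>UNIV. x $ i * x $ i) = (\<lambda>x. 2 * x $ j)" .
    then show ?thesis
      unfolding q_def pdiff_diff[OF C1_fun_const C1_fun_mult[OF C1_fun_const C1s]] pdiff_cmult[OF C1s] by simp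
  qed
  have C1q: "C1_fun q" unfolding q_def by (intro C1_fun_diff C1_fun_mult C1_fun_const C1s)
  have C2q: "C2_scalar q" unfolding C2_scalar_def pq by (intro conjI allI C1q C1_fun_mult C1_fun_const C1_fun_coord)
  have cb: "cutoff_base R = (\<lambda>x. max 0 (q x))" by (rule ext) (simp add: cutoff_base_def nq)
  have c: "cutoff R = (\<lambda>x. (max 0 (q x))^3)" by (rule ext) (simp add: cutoff_def cb)
  have d2: "((\<lambda>y. 3 * (max 0 y)\<^sup>2) has_real_derivative 6 * max 0 y) (at y)" for y :: real
    using DERIV_cmult[OF DERIV_pos_part_squared[of y], of 3] by simp
  have cont: "isCont (\<lambda>y. 6 * max 0 y) (y::real)" for y by (intro continuous_intros)
  show C2: "C2_scalar (cutoff R :: real^'n \<Rightarrow> real)"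
    unfolding c by (rule C2_scalar_compose[OF C2q DERIV_pos_part_cubed d2 cont])
  show p1: "pdiff j (cutoff R :: real^'n \<Rightarrow> real) = (\<lambda>x. - 6 / R\<^sup>2 * (cutoff_base R x)\<^sup>2 * x $ j)" for j
    unfolding c by (simp add: pdiff_compose[where f="\<lambda>y. (max 0 y)^3" and f'="\<lambda>y. 3 * (max 0 y)\<^sup>2", OF C1q DERIV_pos_part_cubed] cb pq mult.assoc)
  have C1b: "C1_fun (\<lambda>x. - 6 / R\<^sup>2 * (max 0 (q x))\<^sup>2)"
  proof (rule C1_fun_mult[OF C1_fun_const])
    have cont2: "isCont (\<lambda>y. 2 * max 0 y) (y::real)" for y by (intro continuous_intros)
    show "C1_fun (\<lambda>x. (max 0 (q x))\<^sup>2)"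
      by (rule C1_fun_compose[where f="\<lambda>y. (max 0 y)\<^sup>2", OF C1q DERIV_pos_part_squared cont2])
  qed
  have pb: "pdiff k (\<lambda>x. (max 0 (q x))\<^sup>2) = (\<lambda>x. 2 * max 0 (q x) * (- 2 / R\<^sup>2 * x $ k))"
    unfolding pdiff_compose[where f="\<lambda>y. (max 0 y)\<^sup>2" and f'="\<lambda>y. 2 * max 0 y", OF C1q DERIV_pos_part_squared] pq by simp
  have C1b': "C1_fun (\<lambda>x. (max 0 (q x))\<^sup>2)"
    by (rule C1_fun_compose[where f="\<lambda>y. (max 0 y)\<^sup>2" and f'="\<lambda>y. 2 * max 0 y", OF C1q DERIV_pos_part_squared]) (intro continuous_intros)
  have "pdiff k (pdiff j (cutoff R)) = pdiff k (\<lambda>x. (- 6 / R\<^sup>2 * (max 0 (q x))\<^sup>2) * x $ j)" unfolding p1 cb ..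
  also have "\<dots> = (\<lambda>x. (- 6 / R\<^sup>2 * (max 0 (q x))\<^sup>2) * (if k = j then 1 else 0) + (- 6 / R\<^sup>2 * (2 * max 0 (q x) * (- 2 / R\<^sup>2 * x $ k))) * x $ j)"
    unfolding pdiff_mult[OF C1b C1_fun_coord] pdiff_coord pdiff_cmult[OF C1b'] pb ..
  also have "\<dots> = (\<lambda>x. 24 / R^4 * cutoff_base R x * x $ j * x $ k - (if k = j then 6 / R\<^sup>2 * (cutoff_base R x)\<^sup>2 else 0))"
    using R by (auto simp: fun_eq_iff cb field_simps power2_eq_square power4_eq_xxxx)
  finally show "pdiff k (pdiff j (cutoff R :: real^'n \<Rightarrow> real)) =
      (\<lambda>x. 24 / R^4 * cutoff_base R x * x $ j * x $ k - (if k = j then 6 / R\<^sup>2 * (cutoff_base R x)\<^sup>2 else 0))" .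
qed

lemma cutoff_base_bounds: "0 \<le> cutoff_base R x" "cutoff_base R x \<le> 1"
  by (auto simp: cutoff_base_def)

lemma cutoff_bounds: "0 \<le> cutoff R x" "cutoff R x \<le> 1"
  using cutoff_base_bounds[of R x] by (auto simp: cutoff_def power_le_one)

lemma cutoff_base_eq_0: "R > 0 \<Longrightarrow> R \<le> norm x \<Longrightarrow> cutoff_base R x = 0"
  using power_mono[of R "norm x" 2] by (auto simp: cutoff_base_def max_def field_simps)

lemma cutoff_eq_0: "R > 0 \<Longrightarrow> R \<le> norm x \<Longrightarrow> cutoff R x = 0"
  by (simp add: cutoff_def cutoff_base_eq_0)

lemma inverse_Suc_tendsto: "(\<lambda>n. c / (real (Suc n)) ^ Suc k) \<longlonglongrightarrow> 0"
proof -
  have "(\<lambda>n. c * inverse (real (Suc n)) ^ Suc k) \<longlonglongrightarrow> c * 0 ^ Suc k"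
    by (intro tendsto_intros LIMSEQ_inverse_real_of_nat)
  then show ?thesis by (simp add: divide_inverse power_inverse del: of_nat_Suc)
qed

lemma cutoff_base_tendsto: "(\<lambda>n. cutoff_base (real (Suc n)) x) \<longlonglongrightarrow> 1"
proof -
  have "(\<lambda>n. max 0 (1 - (norm x)\<^sup>2 / (real (Suc n)) ^ Suc 1)) \<longlonglongrightarrow> max 0 (1 - 0)"
    by (intro tendsto_max tendsto_diff tendsto_const inverse_Suc_tendsto)
  then show ?thesis by (simp add: cutoff_base_def numeral_2_eq_2 del: of_nat_Suc)
qed

lemma cutoff_tendsto: "(\<lambda>n. cutoff (real (Suc n)) x) \<longlonglongrightarrow> 1"
  unfolding cutoff_def using tendsto_power[OF cutoff_base_tendsto, of x 3] by simp

lemma grad_cutoff: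
  assumes "R > 0"
  shows "grad (cutoff R) x = (- 6 / R\<^sup>2 * (cutoff_base R x)\<^sup>2) *\<^sub>R x"
  by (simp add: vec_eq_iff pdiff_cutoff[OF assms])

text \<open>The gradient decays like 1/R but lives where |x| is at most R. Its product with |x| is
  therefore bounded uniformly in \<open>R\<close>, which matches linear growth of a drift.\<close>

lemma norm_grad_cutoff:
  assumes "R > 0"
  shows "norm (grad (cutoff R) x) * norm x \<le> 6" "norm (grad (cutoff R) x) \<le> 6 / R"
    "norm (grad (cutoff R) x) \<le> 6 / R\<^sup>2 * norm x"
proof -
  have n: "norm (grad (cutoff R) x) = 6 / R\<^sup>2 * (cutoff_base R x)\<^sup>2 * norm x"
    by (simp add: grad_cutoff[OF assms] abs_mult)
  have b: "(cutoff_base R x)\<^sup>2 \<le> 1" using cutoff_base_bounds[of R x] by (simp add: power_le_one)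
  show le: "norm (grad (cutoff R) x) \<le> 6 / R\<^sup>2 * norm x"
    unfolding n using b by (intro mult_right_mono) (auto simp: divide_right_mono)
  show le2: "norm (grad (cutoff R) x) \<le> 6 / R"
  proof (cases "R \<le> norm x")
    case True then show ?thesis using cutoff_base_eq_0[OF assms True] assms by (simp add: n)
  next
    case False
    then have "6 / R\<^sup>2 * norm x \<le> 6 / R\<^sup>2 * R" by (intro mult_left_mono) auto
    then show ?thesis using le assms by (simp add: power2_eq_square)
  qed
  show "norm (grad (cutoff R) x) * norm x \<le> 6"
  proof (cases "R \<le> norm x")
    case True then show ?thesis using cutoff_base_eq_0[OF assms True] by (simp add: n)
  next
    case False
    then have "norm (grad (cutoff R) x) * norm x \<le> 6 / R * R"
      using assms by (intro mult_mono le2) auto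
    then show ?thesis using assms by simp
  qed
qed

lemma grad_cutoff_tendsto: "(\<lambda>n. grad (cutoff (real (Suc n))) x) \<longlonglongrightarrow> 0"
proof (rule tendsto_norm_zero_cancel, rule tendsto_sandwich[OF _ _ tendsto_const inverse_Suc_tendsto[of 6 0]])
  show "\<forall>\<^sub>F n in sequentially. norm (grad (cutoff (real (Suc n))) x) \<le> 6 / real (Suc n) ^ Suc 0"
    using norm_grad_cutoff(2)[of "real (Suc n)" x for n] by (intro always_eventually) auto
qed auto

text \<open>The weight 1 + |x|^2 matches the quadratic growth of the diffusion matrix. Both
  constants come from 24 + 6 = 30 in the explicit second derivative; inside the ball the weight is
  at most 2 R^2, since R is at least 1.\<close>

lemma pdiff2_cutoff_bounds:
  assumes R: "R \<ge> 1"
  shows "\<bar>pdiff k (pdiff j (cutoff R)) x\<bar> * (1 + (norm x)\<^sup>2) \<le> 60"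
    "\<bar>pdiff k (pdiff j (cutoff R)) x\<bar> \<le> 30 / R"
proof -
  have R0: "R > 0" using R by simp
  have main: "\<bar>pdiff k (pdiff j (cutoff R)) x\<bar> \<le> 30 / R\<^sup>2"
  proof (cases "R \<le> norm x")
    case True then show ?thesis using cutoff_base_eq_0[OF R0 True] by (simp add: pdiff2_cutoff[OF R0])
  next
    case False
    have "\<bar>x $ j * x $ k\<bar> \<le> R * R" unfolding abs_mult using False R0
      by (intro mult_mono) (auto intro: order_trans[OF component_le_norm_cart])
    then have "24 / R^4 * cutoff_base R x * \<bar>x $ j * x $ k\<bar> \<le> 24 / R^4 * 1 * (R * R)"
      using cutoff_base_bounds[of R x] R by (intro mult_mono) (auto intro: mult_nonneg_nonneg divide_nonneg_nonneg)
    also have "\<dots> = 24 / R\<^sup>2" using R by (simp add: power2_eq_square power4_eq_xxxx)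
    finally have 1: "\<bar>24 / R^4 * cutoff_base R x * x $ j * x $ k\<bar> \<le> 24 / R\<^sup>2"
      using cutoff_base_bounds[of R x] by (simp add: abs_mult mult.assoc)
    have "(cutoff_base R x)\<^sup>2 \<le> 1" using cutoff_base_bounds[of R x] by (simp add: power_le_one)
    then have "6 / R\<^sup>2 * (cutoff_base R x)\<^sup>2 \<le> 6 / R\<^sup>2 * 1" by (intro mult_left_mono) auto
    then have 2: "\<bar>if k = j then 6 / R\<^sup>2 * (cutoff_base R x)\<^sup>2 else 0\<bar> \<le> 6 / R\<^sup>2" by simp
    show ?thesis unfolding pdiff2_cutoff[OF R0] using 1 2 by linarith
  qed
  have "1 / R\<^sup>2 \<le> 1 / R" using R by (intro divide_left_mono) (auto simp: power2_eq_square)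
  then show "\<bar>pdiff k (pdiff j (cutoff R)) x\<bar> \<le> 30 / R" using main by simp
  show "\<bar>pdiff k (pdiff j (cutoff R)) x\<bar> * (1 + (norm x)\<^sup>2) \<le> 60"
  proof (cases "R \<le> norm x")
    case True then show ?thesis using cutoff_base_eq_0[OF R0 True] by (simp add: pdiff2_cutoff[OF R0])
  next
    case False
    then have "(norm x)\<^sup>2 \<le> R\<^sup>2" by (intro power_mono) auto
    moreover have "1 \<le> R\<^sup>2" using R by simp
    ultimately have "1 + (norm x)\<^sup>2 \<le> 2 * R\<^sup>2" by simp
    then have "\<bar>pdiff k (pdiff j (cutoff R)) x\<bar> * (1 + (norm x)\<^sup>2) \<le> 30 / R\<^sup>2 * (2 * R\<^sup>2)"
      by (intro mult_mono main) auto
    then show ?thesis using R by simp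
  qed
qed

lemma pdiff2_cutoff_tendsto: "(\<lambda>n. pdiff k (pdiff j (cutoff (real (Suc n)))) x) \<longlonglongrightarrow> 0"
proof (rule tendsto_rabs_zero_cancel, rule tendsto_sandwich[OF _ _ tendsto_const inverse_Suc_tendsto[of 30 0]])
  show "\<forall>\<^sub>F n in sequentially. \<bar>pdiff k (pdiff j (cutoff (real (Suc n)))) x\<bar> \<le> 30 / real (Suc n) ^ Suc 0"
    using pdiff2_cutoff_bounds(2)[of "real (Suc n)" k j x for n] by (intro always_eventually) auto
qed auto

section \<open>The logarithmic Sobolev inequality\<close>

lemma integrable_mult_bounded:
  fixes f w :: "'a \<Rightarrow> real"
  assumes "integrable M w" "f \<in> borel_measurable M" "\<And>x. \<bar>f x\<bar> \<le> B"
  shows "integrable M (\<lambda>x. f x * w x)"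
proof (rule Bochner_Integration.integrable_bound)
  show "integrable M (\<lambda>x. B * w x)" using assms(1) by simp
  show "(\<lambda>x. f x * w x) \<in> borel_measurable M" using assms(1,2) by measurable
  show "AE x in M. norm (f x * w x) \<le> norm (B * w x)"
    using assms(3) by (intro AE_I2) (auto simp: abs_mult intro!: mult_right_mono order_trans[OF assms(3)])
qed

text \<open>Pointwise, \<open>e\<^sup>\<phi> (f - \<phi> - c) \<le> e\<^sup>\<phi> (e\<^bsup>f - \<phi> - c\<^esup> - 1)\<close>; the constant \<open>c\<close> is chosen to make
  the right-hand side integrate to zero.\<close>

lemma Donsker_Varadhan:
  fixes f \<phi> w :: "'a \<Rightarrow> real"
  assumes w: "\<And>x. 0 \<le> w x"
    and i: "integrable M (\<lambda>x. f x * exp (\<phi> x) * w x)" "integrable M (\<lambda>x. \<phi> x * exp (\<phi> x) * w x)"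
      "integrable M (\<lambda>x. exp (\<phi> x) * w x)" "integrable M (\<lambda>x. exp (f x) * w x)"
    and m: "m = (\<integral>x. exp (\<phi> x) * w x \<partial>M)" "0 < m" and Z: "Z = (\<integral>x. exp (f x) * w x \<partial>M)" "0 < Z"
  shows "(\<integral>x. f x * exp (\<phi> x) * w x \<partial>M) \<le> (\<integral>x. \<phi> x * exp (\<phi> x) * w x \<partial>M) - m * ln m + m * ln Z"
proof -
  define c where "c = ln (Z / m)"
  have "(\<integral>x. f x * exp (\<phi> x) * w x \<partial>M)
    \<le> (\<integral>x. \<phi> x * exp (\<phi> x) * w x + (exp (- c) * (exp (f x) * w x) + (c - 1) * (exp (\<phi> x) * w x)) \<partial>M)"
  proof (rule integral_mono)
    fix x
    have "f x - \<phi> x - c + 1 \<le> exp (f x - \<phi> x - c)" using exp_ge_add_one_self[of "f x - \<phi> x - c"] by linarith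
    then have "(f x - \<phi> x - c + 1) * (exp (\<phi> x) * w x) \<le> exp (f x - \<phi> x - c) * (exp (\<phi> x) * w x)"
      using w by (intro mult_right_mono) auto
    also have "\<dots> = exp (- c) * (exp (f x) * w x)" by (simp add: exp_diff exp_minus exp_add field_simps)
    finally show "f x * exp (\<phi> x) * w x \<le> \<phi> x * exp (\<phi> x) * w x + (exp (- c) * (exp (f x) * w x) + (c - 1) * (exp (\<phi> x) * w x))"
      by (simp add: algebra_simps)
  qed (use i in auto)
  also have "\<dots> = (\<integral>x. \<phi> x * exp (\<phi> x) * w x \<partial>M) + (exp (- c) * Z + (c - 1) * m)"
    using i by (simp add: Z(1) m(1))
  also have "exp (- c) = m / Z" using m(2) Z(2) by (simp add: c_def exp_minus)
  also have "c = ln Z - ln m" using m(2) Z(2) by (simp add: c_def ln_div)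
  also have "(\<integral>x. \<phi> x * exp (\<phi> x) * w x \<partial>M) + (m / Z * Z + (ln Z - ln m - 1) * m)
     = (\<integral>x. \<phi> x * exp (\<phi> x) * w x \<partial>M) - m * ln m + m * ln Z"
    using Z(2) by (simp add: algebra_simps)
  finally show ?thesis .
qed

text \<open>Concavity is encoded by interpolation between two points rather than by the Hessian,
  which is the form the Prekopa-Leindler inequality consumes.\<close>

definition strongly_log_concave_pdf :: "real \<Rightarrow> (real^'n \<Rightarrow> real) \<Rightarrow> bool" where
  "strongly_log_concave_pdf mu q \<longleftrightarrow> 0 < mu \<and> continuous_on UNIV q \<and> (\<forall>x. 0 < q x) \<and> integrable lborel q \<and>
    (LBINT x. q x) = 1 \<and>
    (\<forall>x y t. 0 \<le> t \<longrightarrow> t \<le> 1 \<longrightarrow> t * ln (q x) + (1 - t) * ln (q y) + mu * t * (1 - t) / 2 * (norm (x - y))\<^sup>2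
      \<le> ln (q (t *\<^sub>R x + (1 - t) *\<^sub>R y)))"

lemma integral_pos_weight:
  fixes f q :: "'a::euclidean_space \<Rightarrow> real"
  assumes "integrable lborel (\<lambda>x. f x * q x)" "\<And>x. 0 < f x" "\<And>x. 0 < q x"
  shows "0 < (LBINT x. f x * q x)"
proof -
  have "(LBINT x. f x * q x) \<noteq> 0"
  proof
    assume "(LBINT x. f x * q x) = 0"
    then have "AE x in lborel. f x * q x = 0"
      using assms by (subst (asm) integral_nonneg_eq_0_iff_AE) (auto intro!: less_imp_le)
    moreover have "{x \<in> space lborel. f x * q x \<noteq> 0} = UNIV"
      using assms(2,3) by (auto simp: less_imp_neq[THEN not_sym])
    ultimately have "emeasure lborel (UNIV :: 'a set) = 0"
      using AE_iff_measurable[of UNIV lborel "\<lambda>x. f x * q x = 0"] by simp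
    then show False by simp
  qed
  moreover have "0 \<le> (LBINT x. f x * q x)" using assms(2,3) by (intro Bochner_Integration.integral_nonneg) (simp add: less_imp_le)
  ultimately show ?thesis by simp
qed

text \<open>The hypothesis on \<open>\<psi>\<close> is that it dominates the sup-convolution of \<open>\<phi>\<close> with a quadratic kernel, rewritten
  in terms of \<open>z = t x + (1 - t) y\<close>.\<close>

lemma Prekopa_Leindler_sup_convolution:
  fixes q :: "real^'n \<Rightarrow> real"
  assumes q: "strongly_log_concave_pdf mu q" and t: "0 < t" "t < 1"
    and [measurable]: "\<phi> \<in> borel_measurable borel" "\<psi> \<in> borel_measurable borel"
    and i: "integrable lborel (\<lambda>x. exp (\<phi> x / t) * q x)" "integrable lborel (\<lambda>x. exp (\<psi> x) * q x)"
    and sup: "\<And>x z. \<phi> x - t * mu / (2 * (1 - t)) * (norm (x - z))\<^sup>2 \<le> \<psi> z"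
  shows "t * ln (LBINT x. exp (\<phi> x / t) * q x) \<le> ln (LBINT x. exp (\<psi> x) * q x)"
proof -
  have qp: "\<And>x. 0 < q x" and qi: "integrable lborel q" and q1: "(LBINT x. q x) = 1"
    and qc: "\<And>x y. t * ln (q x) + (1 - t) * ln (q y) + mu * t * (1 - t) / 2 * (norm (x - y))\<^sup>2
      \<le> ln (q (t *\<^sub>R x + (1 - t) *\<^sub>R y))"
    using q t unfolding strongly_log_concave_pdf_def by auto
  have [measurable]: "q \<in> borel_measurable borel"
    using q unfolding strongly_log_concave_pdf_def by (simp add: borel_measurable_continuous_onI)
  define A where "A = (LBINT x. exp (\<phi> x / t) * q x)"
  define B where "B = (LBINT x. exp (\<psi> x) * q x)"
  have A: "A > 0" unfolding A_def by (rule integral_pos_weight[OF i(1) _ qp]) simp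
  have B: "B > 0" unfolding B_def by (rule integral_pos_weight[OF i(2) _ qp]) simp
  \<comment> \<open>The middle function is the density itself, of integral 1, so only the power
    \<open>t\<close> of the first integral survives.\<close>
  have "PL_rel t (\<integral>\<^sup>+x. ennreal (exp (\<phi> x / t) * q x) \<partial>lborel) (\<integral>\<^sup>+x. ennreal (q x) \<partial>lborel)
     (\<integral>\<^sup>+x. ennreal (exp (\<psi> x) * q x) \<partial>lborel)"
  proof (rule Prekopa_Leindler[OF _ _ _ t])
    fix x y
    show "PL_rel t (ennreal (exp (\<phi> x / t) * q x)) (ennreal (q y))
       (ennreal (exp (\<psi> (t *\<^sub>R x + (1 - t) *\<^sub>R y)) * q (t *\<^sub>R x + (1 - t) *\<^sub>R y)))"
      unfolding PL_rel_def
    proof (intro allI impI)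
      fix a b :: real
      assume ab: "0 < a" "0 < b" "ennreal a < ennreal (exp (\<phi> x / t) * q x)" "ennreal b < ennreal (q y)"
      define z where "z = t *\<^sub>R x + (1 - t) *\<^sub>R y"
      have a: "a < exp (\<phi> x / t) * q x" and b: "b < q y" using ab by (auto simp: ennreal_less_iff)
      have "a powr t * b powr (1 - t) \<le> (exp (\<phi> x / t) * q x) powr t * q y powr (1 - t)"
        using a b ab(1,2) t by (intro mult_mono powr_mono2) auto
      also have "\<dots> = exp (t * (\<phi> x / t + ln (q x)) + (1 - t) * ln (q y))"
        using qp[of x] qp[of y] by (simp add: powr_def ln_mult exp_add)
      also have "\<dots> \<le> exp (\<psi> z + ln (q z))"
      proof -
        \<comment> \<open>This identity turns the quadratic gain from concavity into precisely the
          cost that the sup-convolution subtracts.\<close>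
        have "x - z = (1 - t) *\<^sub>R (x - y)" by (simp add: z_def algebra_simps)
        then have n: "(norm (x - z))\<^sup>2 = (1 - t)\<^sup>2 * (norm (x - y))\<^sup>2" using t by (simp add: power_mult_distrib)
        have arith: "t * mu / (2 * u) * (u\<^sup>2 * N) = mu * t * u / 2 * N" if "u \<noteq> 0" for u N :: real
          using that by (simp add: power2_eq_square field_simps)
        have "t * mu / (2 * (1 - t)) * (norm (x - z))\<^sup>2 = mu * t * (1 - t) / 2 * (norm (x - y))\<^sup>2"
          unfolding n using arith[of "1 - t"] t by simp
        then have "\<phi> x + (t * ln (q x) + (1 - t) * ln (q y)) \<le> \<psi> z + ln (q z)"
          using sup[of x z] qc[of x y] unfolding z_def[symmetric] by linarith
        moreover have "t * (\<phi> x / t + ln (q x)) + (1 - t) * ln (q y) = \<phi> x + (t * ln (q x) + (1 - t) * ln (q y))"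
          using t by (simp add: algebra_simps)
        ultimately show ?thesis by simp
      qed
      also have "\<dots> = exp (\<psi> z) * q z" using qp[of z] by (simp add: exp_add)
      finally show "ennreal (a powr t * b powr (1 - t)) \<le> ennreal (exp (\<psi> (t *\<^sub>R x + (1 - t) *\<^sub>R y)) * q (t *\<^sub>R x + (1 - t) *\<^sub>R y))"
        unfolding z_def by (rule ennreal_leI)
    qed
  qed measurable
  moreover have "(\<integral>\<^sup>+x. ennreal (exp (\<phi> x / t) * q x) \<partial>lborel) = ennreal A"
    unfolding A_def using i(1) qp by (intro nn_integral_eq_integral) (auto simp: less_imp_le)
  moreover have "(\<integral>\<^sup>+x. ennreal (exp (\<psi> x) * q x) \<partial>lborel) = ennreal B"
    unfolding B_def using i(2) qp by (intro nn_integral_eq_integral) (auto simp: less_imp_le)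
  moreover have "(\<integral>\<^sup>+x. ennreal (q x) \<partial>lborel) = ennreal 1"
    unfolding q1[symmetric] using qi qp by (intro nn_integral_eq_integral) (auto simp: less_imp_le)
  ultimately have PL: "PL_rel t (ennreal A) (ennreal 1) (ennreal B)" by simp
  have "A powr t \<le> B"
  \<comment> \<open>\<open>PL_rel\<close> gives information about strict minorants only, so both
    integrals are first shrunk by a factor \<open>c\<close> below 1.\<close>
  proof (rule field_le_mult_one_interval)
    fix c :: real assume c: "0 < c" "c < 1"
    have "ennreal ((c * A) powr t * c powr (1 - t)) \<le> ennreal B"
      using PL c A unfolding PL_rel_def by (auto simp: ennreal_less_iff)
    then have "(c * A) powr t * c powr (1 - t) \<le> B" using B by simp
    moreover have "(c * A) powr t * c powr (1 - t) = c * A powr t"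
      using c A by (simp add: powr_mult mult.commute mult.left_commute flip: powr_add)
    ultimately show "c * A powr t \<le> B" by simp
  qed
  then have "ln (A powr t) \<le> ln B" using A by (subst ln_le_cancel_iff) (use A B in auto)
  then show ?thesis using A by (simp add: A_def B_def ln_powr)
qed

section \<open>Increments of test functions\<close>

lemma increment_le_norm_grad:
  fixes \<phi> :: "real^'n \<Rightarrow> real"
  assumes "C1_fun \<phi>"
  obtains s where "0 < s" "s < 1" "\<phi> x \<le> \<phi> z + norm (grad \<phi> (z + s *\<^sub>R (x - z))) * norm (x - z)"
proof -
  obtain s where s: "0 < s" "s < 1" "\<phi> (z + 1 *\<^sub>R (x - z)) - \<phi> (z + 0 *\<^sub>R (x - z)) = (1 - 0) * (grad \<phi> (z + s *\<^sub>R (x - z)) \<bullet> (x - z))"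
    using MVT2[of 0 1 "\<lambda>r. \<phi> (z + r *\<^sub>R (x - z))" "\<lambda>s. grad \<phi> (z + s *\<^sub>R (x - z)) \<bullet> (x - z)"] DERIV_along_line[OF assms] by auto
  then show thesis using that[of s] norm_cauchy_schwarz[of "grad \<phi> (z + s *\<^sub>R (x - z))" "x - z"] by simp
qed

text \<open>Uniform continuity of the gradient permits the slope to be evaluated at the base point
  \<open>z\<close>, at the price of \<open>e\<close>. That is needed because the sup-convolution at
  \<open>z\<close> has to be bounded by data at \<open>z\<close>.\<close>

lemma increment_bounds_compact_support:
  fixes \<phi> :: "real^'n \<Rightarrow> real"
  assumes \<phi>: "C1_fun \<phi>" "\<And>x. R \<le> norm x \<Longrightarrow> \<phi> x = 0" and e: "0 < e"
  obtains \<delta> where "0 < \<delta>" "\<And>x z. norm (x - z) \<le> \<delta> \<Longrightarrow> \<phi> x \<le> \<phi> z + (norm (grad \<phi> z) + e) * norm (x - z)"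
proof -
  have g0: "grad \<phi> x = 0" if "R \<le> norm x" for x
    by (simp add: vec_eq_iff pdiff_outside_support[OF \<phi>(2,1) that])
  have "uniformly_continuous_on (cball 0 (R + 1)) (grad \<phi>)"
    by (intro compact_uniformly_continuous continuous_on_subset[OF C1_fun_grad_continuous[OF \<phi>(1)]]) auto
  then obtain d where d: "0 < d" "\<And>x y. x \<in> cball 0 (R + 1) \<Longrightarrow> y \<in> cball 0 (R + 1) \<Longrightarrow> dist y x < d \<Longrightarrow> dist (grad \<phi> y) (grad \<phi> x) < e"
    unfolding uniformly_continuous_on_def using e by metis
  \<comment> \<open>With \<delta> at most 1, two such close points lie in the ball of radius
    \<open>R + 1\<close> unless both are outside the support, where the gradient is zero.\<close>
  define \<delta> where "\<delta> = min (d / 2) 1"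
  have \<delta>: "0 < \<delta>" "\<delta> < d" "\<delta> \<le> 1" using d(1) by (auto simp: \<delta>_def)
  have close: "norm (grad \<phi> y - grad \<phi> z) \<le> e" if "norm (y - z) \<le> \<delta>" for y z
  proof (cases "R \<le> norm y \<and> R \<le> norm z")
    case True then show ?thesis using e by (simp add: g0)
  next
    case False
    have "norm y \<le> norm z + 1" "norm z \<le> norm y + 1"
      using that \<delta>(3) norm_triangle_sub[of y z] norm_triangle_sub[of z y] by (auto simp: norm_minus_commute)
    then have "y \<in> cball 0 (R + 1)" "z \<in> cball 0 (R + 1)" using False by auto
    then show ?thesis using d(2)[of z y] that \<delta>(2) by (auto simp: dist_norm)
  qed
  show thesis
  proof (rule that[OF \<delta>(1)])
    fix x z :: "real^'n" assume le: "norm (x - z) \<le> \<delta>"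
    obtain s where s: "0 < s" "s < 1" "\<phi> x \<le> \<phi> z + norm (grad \<phi> (z + s *\<^sub>R (x - z))) * norm (x - z)"
      using increment_le_norm_grad[OF \<phi>(1)] .
    have "norm (z + s *\<^sub>R (x - z) - z) \<le> \<delta>" using s(1,2) le mult_left_le_one_le[of "norm (x - z)" s] by simp
    then have "norm (grad \<phi> (z + s *\<^sub>R (x - z)) - grad \<phi> z) \<le> e" by (rule close)
    then have "norm (grad \<phi> (z + s *\<^sub>R (x - z))) \<le> norm (grad \<phi> z) + e"
      using norm_triangle_sub[of "grad \<phi> (z + s *\<^sub>R (x - z))" "grad \<phi> z"] by linarith
    then have "norm (grad \<phi> (z + s *\<^sub>R (x - z))) * norm (x - z) \<le> (norm (grad \<phi> z) + e) * norm (x - z)"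
      by (intro mult_right_mono) auto
    then show "\<phi> x \<le> \<phi> z + (norm (grad \<phi> z) + e) * norm (x - z)" using s(3) by simp
  qed
qed

text \<open>The global slope bound handles the points \<open>x\<close> too far from \<open>z\<close>
  for the local estimate.\<close>

lemma Lipschitz_compact_support:
  fixes \<phi> :: "real^'n \<Rightarrow> real"
  assumes \<phi>: "C1_fun \<phi>" "\<And>x. R \<le> norm x \<Longrightarrow> \<phi> x = 0"
  obtains L where "0 \<le> L" "\<And>z. norm (grad \<phi> z) \<le> L" "\<And>x z. \<phi> x \<le> \<phi> z + L * norm (x - z)"
proof -
  have c: "continuous_on UNIV (\<lambda>x. norm (grad \<phi> x))" by (intro continuous_intros C1_fun_grad_continuous \<phi>(1))
  have g0: "norm (grad \<phi> x) = 0" if "R \<le> norm x" for x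
    by (simp add: vec_eq_iff pdiff_outside_support[OF \<phi>(2,1) that])
  obtain L where L: "\<And>x. \<bar>norm (grad \<phi> x)\<bar> \<le> L" using bounded_compact_support[OF c g0] by blast
  show thesis
  proof (rule that[of L])
    show "0 \<le> L" using L[of 0] abs_ge_zero order_trans by blast
    show "norm (grad \<phi> z) \<le> L" for z using L[of z] by simp
    fix x z :: "real^'n"
    obtain s where s: "0 < s" "s < 1" "\<phi> x \<le> \<phi> z + norm (grad \<phi> (z + s *\<^sub>R (x - z))) * norm (x - z)"
      using increment_le_norm_grad[OF \<phi>(1)] .
    have "norm (grad \<phi> (z + s *\<^sub>R (x - z))) * norm (x - z) \<le> L * norm (x - z)"
      using L[of "z + s *\<^sub>R (x - z)"] by (intro mult_right_mono) auto
    then show "\<phi> x \<le> \<phi> z + L * norm (x - z)" using s(3) by simp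
  qed
qed

text \<open>Completing the square; the right-hand side is the Legendre transform of the quadratic
  cost, and the source of the squared gradient in the logarithmic Sobolev inequality.\<close>

lemma quadratic_le:
  fixes k r c :: real
  assumes "c > 0"
  shows "k * r - c / 2 * r\<^sup>2 \<le> k\<^sup>2 / (2 * c)"
proof -
  have "0 \<le> (k - c * r)\<^sup>2 / (2 * c)" using assms by simp
  also have "(k - c * r)\<^sup>2 / (2 * c) = k\<^sup>2 / (2 * c) - (k * r - c / 2 * r\<^sup>2)"
    using assms by (simp add: power2_eq_square field_simps)
  finally show ?thesis by simp
qed

text \<open>With \<open>s = 1 - t\<close>, the sup-convolution is at most \<open>\<phi> + s (\<bar>\<nabla>\<phi>\<bar> + e)\<^sup>2 / (2 t mu)\<close> for small \<open>s\<close>; the claim is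
  the first-order term in \<open>s\<close> of the resulting inequality.\<close>

lemma log_Sobolev_eps:
  fixes q \<phi> :: "real^'n \<Rightarrow> real"
  assumes q: "strongly_log_concave_pdf mu q" and \<phi>: "C1_fun \<phi>" "\<And>x. R \<le> norm x \<Longrightarrow> \<phi> x = 0"
    and m: "m = (LBINT x. exp (\<phi> x) * q x)" and e: "0 < e"
  shows "2 * mu * ((LBINT x. \<phi> x * exp (\<phi> x) * q x) - m * ln m)
    \<le> (LBINT x. (norm (grad \<phi> x) + e)\<^sup>2 * exp (\<phi> x) * q x)"
proof -
  have mu: "0 < mu" and qp: "\<And>x. 0 < q x" and qi: "integrable lborel q" and qcont: "continuous_on UNIV q"
    using q unfolding strongly_log_concave_pdf_def by auto
  have q0: "\<And>x. 0 \<le> q x" using qp by (simp add: less_imp_le)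
  have [measurable]: "q \<in> borel_measurable borel" using qcont by (rule borel_measurable_continuous_onI)
  have pm[measurable]: "\<phi> \<in> borel_measurable borel" using C1_fun_continuous[OF \<phi>(1)] by (rule borel_measurable_continuous_onI)
  define G where "G x = norm (grad \<phi> x) + e" for x
  have [measurable]: "G \<in> borel_measurable borel" unfolding G_def
    by (intro borel_measurable_continuous_onI continuous_intros C1_fun_grad_continuous \<phi>(1))
  obtain L where L: "0 \<le> L" "\<And>z. norm (grad \<phi> z) \<le> L" "\<And>x z. \<phi> x \<le> \<phi> z + L * norm (x - z)"
    using Lipschitz_compact_support[OF \<phi>] by blast
  obtain \<delta> where \<delta>: "0 < \<delta>" "\<And>x z. norm (x - z) \<le> \<delta> \<Longrightarrow> \<phi> x \<le> \<phi> z + G z * norm (x - z)"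
    using increment_bounds_compact_support[OF \<phi> e] unfolding G_def by blast
  obtain P where P: "\<And>x. \<bar>\<phi> x\<bar> \<le> P" using bounded_compact_support[OF C1_fun_continuous[OF \<phi>(1)] \<phi>(2)] by blast
  have P0: "0 \<le> P" using P[of 0] by linarith
  have G: "0 \<le> G x" "G x \<le> L + e" for x using L(2)[of x] e by (auto simp: G_def)
  define C where "C = (L + e)\<^sup>2 / mu"
  have C: "0 \<le> C" using mu by (simp add: C_def)
  have int: "integrable lborel (\<lambda>x. f x * q x)" if "f \<in> borel_measurable borel" "\<And>x. \<bar>f x\<bar> \<le> D" for f D
    using integrable_mult_bounded[OF qi _ that(2)] that(1) by simp
  have expb: "\<bar>exp (c * \<phi> x)\<bar> \<le> exp (\<bar>c\<bar> * P)" for c x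
  proof -
    have "c * \<phi> x \<le> \<bar>c\<bar> * P" using mult_left_mono[OF P[of x], of "\<bar>c\<bar>"] abs_ge_self[of "c * \<phi> x"] by (simp add: abs_mult)
    then show ?thesis by simp
  qed
  have i1: "integrable lborel (\<lambda>x. exp (\<phi> x) * q x)" by (rule int[where D="exp (\<bar>1\<bar> * P)"]) (use expb[of 1] in auto)
  have i2: "integrable lborel (\<lambda>x. \<phi> x * exp (\<phi> x) * q x)"
    by (rule int[where D="P * exp (\<bar>1\<bar> * P)"]) (use expb[of 1] P P0 in \<open>auto simp: abs_mult intro!: mult_mono\<close>)
  have i3: "integrable lborel (\<lambda>x. (G x)\<^sup>2 * exp (\<phi> x) * q x)"
    by (rule int[where D="(L + e)\<^sup>2 * exp (\<bar>1\<bar> * P)"]) (use expb[of 1] G in \<open>auto simp: abs_mult intro!: mult_mono power_mono\<close>)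
  have m0: "0 < m" unfolding m by (rule integral_pos_weight[OF i1 _ qp]) simp
  define En where "En = (LBINT x. \<phi> x * exp (\<phi> x) * q x) - m * ln m"
  define X where "X = (LBINT x. (G x)\<^sup>2 * exp (\<phi> x) * q x)"
  \<comment> \<open>The three bounds ensure in turn that t is at least 1/2, that s C is at most 1
    (for the quadratic bound on the exponential), and that the quadratic cost beats the Lipschitz
    growth beyond distance \<delta>.\<close>
  define s0 where "s0 = min (1 / 2) (min (1 / (C + 1)) (\<delta> * mu / (4 * (L + 1))))"
  have s0: "0 < s0" using C \<delta> mu L(1) by (simp add: s0_def)
  have main: "En \<le> X / (2 * (1 - s) * mu) + s * (C\<^sup>2 * m)" if s: "0 < s" "s < s0" for s
  proof -
    define t where "t = 1 - s"
    have s': "s \<le> 1 / 2" "s \<le> 1 / (C + 1)" "s \<le> \<delta> * mu / (4 * (L + 1))" using s by (auto simp: s0_def)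
    have t: "0 < t" "t < 1" "1 / 2 \<le> t" using s s' by (auto simp: t_def)
    have st: "1 - t = s" by (simp add: t_def)
    have sC: "s * C \<le> 1"
    proof -
      have "s * C \<le> 1 / (C + 1) * C" using s'(2) C by (intro mult_right_mono)
      also have "\<dots> \<le> 1" using C by (simp add: field_simps)
      finally show ?thesis .
    qed
    have s\<delta>: "2 * L * s \<le> t * mu * \<delta>"
    proof -
      have "s * (4 * (L + 1)) \<le> \<delta> * mu" using s'(3) L(1) by (simp add: pos_le_divide_eq)
      moreover have "(1 / 2) * (mu * \<delta>) \<le> t * (mu * \<delta>)" using t(3) mu \<delta>(1) by (intro mult_right_mono) auto
      moreover have "0 \<le> s * 4" using s by simp
      ultimately show ?thesis by (simp add: algebra_simps)
    qed
    define E where "E x = (G x)\<^sup>2 / (2 * t * mu)" for x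
    have E: "0 \<le> E x" "E x \<le> C" for x
    proof -
      show "0 \<le> E x" using t mu by (simp add: E_def)
      have "(G x)\<^sup>2 \<le> (L + e)\<^sup>2" using G by (intro power_mono)
      moreover have "mu \<le> 2 * t * mu" using t(3) mu by (simp add: mult_le_cancel_right1)
      ultimately show "E x \<le> C" unfolding E_def C_def using mu t by (intro frac_le) auto
    qed
    have [measurable]: "E \<in> borel_measurable borel" unfolding E_def by measurable
    have iE: "integrable lborel (\<lambda>x. exp (\<phi> x + s * E x) * q x)"
    proof (rule int[where D="exp (P + s * C)"])
      show "\<bar>exp (\<phi> x + s * E x)\<bar> \<le> exp (P + s * C)" for x
        using P[of x] E(2)[of x] s(1) by (auto intro!: add_mono mult_left_mono)
    qed measurable
    have it: "integrable lborel (\<lambda>x. exp (\<phi> x / t) * q x)"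
      by (rule int[where D="exp (\<bar>1 / t\<bar> * P)"]) (use expb[of "1/t"] in auto)
    have "t * ln (LBINT x. exp (\<phi> x / t) * q x) \<le> ln (LBINT x. exp (\<phi> x + s * E x) * q x)"
    proof (rule Prekopa_Leindler_sup_convolution[OF q t(1,2) _ _ it iE])
      fix x z :: "real^'n"
      define r where "r = norm (x - z)"
      have r0: "0 \<le> r" by (simp add: r_def)
      define c where "c = t * mu / s"
      have c: "c > 0" using t mu s by (simp add: c_def)
      have eq: "t * mu / (2 * (1 - t)) = c / 2" using s by (simp add: c_def st)
      have sE: "s * E z = (G z)\<^sup>2 / (2 * c)" using s t mu by (simp add: E_def c_def field_simps)
      show "\<phi> x - t * mu / (2 * (1 - t)) * (norm (x - z))\<^sup>2 \<le> \<phi> z + s * E z"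
      proof (cases "r \<le> \<delta>")
        case True
        then have "\<phi> x \<le> \<phi> z + G z * r" using \<delta>(2) by (simp add: r_def)
        with quadratic_le[OF c, of "G z" r] show ?thesis unfolding eq sE r_def[symmetric] by linarith
      next
        case False
        \<comment> \<open>Far from \<open>z\<close> the quadratic cost alone outweighs the largest
          possible increment of \<phi>.\<close>
        have "L \<le> c / 2 * r"
        proof -
          have "t * mu * \<delta> \<le> t * mu * r" using False t mu by (intro mult_left_mono) auto
          then have "2 * L * s \<le> t * mu * r" using s\<delta> by linarith
          then show ?thesis using s by (simp add: c_def field_simps)
        qed
        then have "L * r \<le> c / 2 * r * r" using r0 by (intro mult_right_mono)
        then have "L * r - c / 2 * r\<^sup>2 \<le> 0" by (simp add: power2_eq_square)
        moreover have "\<phi> x \<le> \<phi> z + L * r" using L(3) by (simp add: r_def)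
        moreover have "0 \<le> s * E z" using s E by simp
        ultimately show ?thesis unfolding eq r_def[symmetric] by linarith
      qed
    qed measurable
    moreover define Z where "Z = (LBINT x. exp (\<phi> x / t) * q x)"
    moreover define B where "B = (LBINT x. exp (\<phi> x + s * E x) * q x)"
    ultimately have ZB: "t * ln Z \<le> ln B" by simp
    have Z0: "0 < Z" unfolding Z_def by (rule integral_pos_weight[OF it _ qp]) simp
    have B0: "0 < B" unfolding B_def by (rule integral_pos_weight[OF iE _ qp]) simp
    have i2': "integrable lborel (\<lambda>x. \<phi> x / t * exp (\<phi> x) * q x)"
      using integrable_mult_right[OF i2, of "1/t"] by (simp add: mult.assoc)
    \<comment> \<open>The variational formula with \<phi> / t as competitor to \<phi> brings in
      \<open>ln Z\<close>, which the Prekopa-Leindler bound controls by \<open>ln B\<close>. It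
      replaces differentiating the norm of exp \<phi> in \<open>t\<close>.\<close>
    have "(LBINT x. \<phi> x / t * exp (\<phi> x) * q x) \<le> (LBINT x. \<phi> x * exp (\<phi> x) * q x) - m * ln m + m * ln Z"
      by (rule Donsker_Varadhan[OF q0 i2' i2 i1 it m m0 Z_def Z0])
    also have "(LBINT x. \<phi> x / t * exp (\<phi> x) * q x) = (LBINT x. \<phi> x * exp (\<phi> x) * q x) / t"
      using integral_mult_right_zero[of lborel "1/t" "\<lambda>x. \<phi> x * exp (\<phi> x) * q x"] by (simp add: mult.assoc)
    finally have "(En + m * ln m) / t \<le> En + m * ln Z" by (simp add: En_def)
    then have "(En + m * ln m) \<le> t * (En + m * ln Z)" using t(1) by (simp add: pos_divide_le_eq mult.commute)
    also have "\<dots> = t * En + m * (t * ln Z)" by (simp add: algebra_simps)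
    also have "\<dots> \<le> t * En + m * ln B" using ZB m0 by (intro add_left_mono mult_left_mono) auto
    \<comment> \<open>Moving \<open>t * En\<close> to the left leaves the small factor 1 - t = s, so
      both sides are now of first order in \<open>s\<close>.\<close>
    finally have "s * En \<le> m * (ln B - ln m)" by (simp add: t_def algebra_simps)
    also have "ln B - ln m = ln (B / m)" using B0 m0 by (simp add: ln_div)
    also have "\<dots> \<le> B / m - 1" using B0 m0 by (intro ln_le_minus_one) simp
    finally have sE1: "s * En \<le> B - m" using m0 by (simp add: algebra_simps)
    have iEe: "integrable lborel (\<lambda>x. E x * exp (\<phi> x) * q x)"
      using integrable_mult_right[OF i3, of "1 / (2 * t * mu)"] by (simp add: E_def mult.assoc)
    have "B \<le> (LBINT x. ((1 + s\<^sup>2 * C\<^sup>2) * (exp (\<phi> x) * q x) + s * (E x * exp (\<phi> x) * q x)))"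
      unfolding B_def
    proof (rule integral_mono)
      fix x
      have "s * E x \<le> s * C" using s E by (intro mult_left_mono) auto
      then have "s * E x \<le> 1" using sC by simp
      \<comment> \<open>The second-order error is bounded uniformly in \<open>x\<close> by s^2 C^2;
        after division by \<open>s\<close> it still vanishes in the limit.\<close>
      then have "exp (s * E x) \<le> 1 + s * E x + (s * E x)\<^sup>2" using s E sC by (intro exp_bound) auto
      also have "(s * E x)\<^sup>2 \<le> s\<^sup>2 * C\<^sup>2" unfolding power_mult_distrib using E by (intro mult_left_mono power_mono) auto
      finally have "exp (s * E x) * (exp (\<phi> x) * q x) \<le> (1 + s * E x + s\<^sup>2 * C\<^sup>2) * (exp (\<phi> x) * q x)"
        using q0 by (intro mult_right_mono) auto
      then show "exp (\<phi> x + s * E x) * q x \<le> (1 + s\<^sup>2 * C\<^sup>2) * (exp (\<phi> x) * q x) + s * (E x * exp (\<phi> x) * q x)"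
        by (simp add: exp_add algebra_simps)
    qed (use iE i1 iEe in auto)
    also have "\<dots> = (1 + s\<^sup>2 * C\<^sup>2) * m + s * (LBINT x. E x * exp (\<phi> x) * q x)"
      using i1 iEe by (simp add: m)
    also have "(LBINT x. E x * exp (\<phi> x) * q x) = X / (2 * t * mu)"
      using integral_mult_right_zero[of lborel "1 / (2 * t * mu)" "\<lambda>x. (G x)\<^sup>2 * exp (\<phi> x) * q x"]
      by (simp add: E_def X_def mult.assoc)
    finally have "s * En \<le> s * (X / (2 * t * mu) + s * (C\<^sup>2 * m))" using sE1
      by (simp add: algebra_simps power2_eq_square)
    then show ?thesis using s(1) by (simp add: t_def)
  qed
  have "En \<le> X / (2 * (1 - 0) * mu) + 0 * (C\<^sup>2 * m)"
  proof (rule tendsto_lowerbound)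
    show "((\<lambda>s. X / (2 * (1 - s) * mu) + s * (C\<^sup>2 * m)) \<longlongrightarrow> X / (2 * (1 - 0) * mu) + 0 * (C\<^sup>2 * m)) (at_right 0)"
      using mu by (intro tendsto_intros) auto
    show "\<forall>\<^sub>F s in at_right 0. En \<le> X / (2 * (1 - s) * mu) + s * (C\<^sup>2 * m)"
      using s0 main by (auto simp: eventually_at_right_field)
  qed simp
  then show ?thesis using mu by (simp add: En_def X_def G_def field_simps)
qed

lemma log_Sobolev_compact_support:
  fixes q \<phi> :: "real^'n \<Rightarrow> real"
  assumes q: "strongly_log_concave_pdf mu q" and \<phi>: "C1_fun \<phi>" "\<And>x. R \<le> norm x \<Longrightarrow> \<phi> x = 0"
    and m: "m = (LBINT x. exp (\<phi> x) * q x)"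
  shows "2 * mu * ((LBINT x. \<phi> x * exp (\<phi> x) * q x) - m * ln m)
    \<le> (LBINT x. (norm (grad \<phi> x))\<^sup>2 * exp (\<phi> x) * q x)"
proof -
  let ?I = "(LBINT x. \<phi> x * exp (\<phi> x) * q x)"
  have qi: "integrable lborel q" and qcont: "continuous_on UNIV q"
    using q unfolding strongly_log_concave_pdf_def by auto
  have [measurable]: "q \<in> borel_measurable borel" using qcont by (rule borel_measurable_continuous_onI)
  have pm[measurable]: "\<phi> \<in> borel_measurable borel" using C1_fun_continuous[OF \<phi>(1)] by (rule borel_measurable_continuous_onI)
  define G where "G x = norm (grad \<phi> x)" for x
  have [measurable]: "G \<in> borel_measurable borel" unfolding G_def
    by (intro borel_measurable_continuous_onI continuous_intros C1_fun_grad_continuous \<phi>(1))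
  obtain L where L: "0 \<le> L" "\<And>z. norm (grad \<phi> z) \<le> L" "\<And>x z. \<phi> x \<le> \<phi> z + L * norm (x - z)"
    using Lipschitz_compact_support[OF \<phi>] by blast
  obtain P where P: "\<And>x. \<bar>\<phi> x\<bar> \<le> P" using bounded_compact_support[OF C1_fun_continuous[OF \<phi>(1)] \<phi>(2)] by blast
  have G: "0 \<le> G x" "G x \<le> L" for x using L(2)[of x] by (auto simp: G_def)
  have ep: "exp (\<phi> x) \<le> exp P" for x using P[of x] by simp
  have int: "integrable lborel (\<lambda>x. f x * q x)" if "f \<in> borel_measurable borel" "\<And>x. \<bar>f x\<bar> \<le> D" for f D
    using integrable_mult_bounded[OF qi _ that(2)] that(1) by simp
  have i: "integrable lborel (\<lambda>x. exp (\<phi> x) * q x)" "integrable lborel (\<lambda>x. (G x)\<^sup>2 * exp (\<phi> x) * q x)"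
     "integrable lborel (\<lambda>x. G x * exp (\<phi> x) * q x)"
    by (rule int[where D="exp P"] int[where D="L\<^sup>2 * exp P"] int[where D="L * exp P"];
      use G ep L(1) in \<open>auto simp: abs_mult intro!: mult_mono power_mono\<close>)+
  have le: "2 * mu * (?I - m * ln m)
     \<le> (LBINT x. (G x)\<^sup>2 * exp (\<phi> x) * q x) + 2 * e * (LBINT x. G x * exp (\<phi> x) * q x) + e\<^sup>2 * m"
    if "0 < e" for e
  proof -
    have "2 * mu * (?I - m * ln m)
     \<le> (LBINT x. (G x + e)\<^sup>2 * exp (\<phi> x) * q x)"
      unfolding G_def by (rule log_Sobolev_eps[OF q \<phi> m that])
    also have "(\<lambda>x. (G x + e)\<^sup>2 * exp (\<phi> x) * q x) = (\<lambda>x. (G x)\<^sup>2 * exp (\<phi> x) * q x + 2 * e * (G x * exp (\<phi> x) * q x) + e\<^sup>2 * (exp (\<phi> x) * q x))"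
      by (auto simp: fun_eq_iff power2_eq_square algebra_simps)
    finally show ?thesis using i by (simp add: m)
  qed
  have "2 * mu * (?I - m * ln m)
     \<le> (LBINT x. (G x)\<^sup>2 * exp (\<phi> x) * q x) + 2 * 0 * (LBINT x. G x * exp (\<phi> x) * q x) + 0\<^sup>2 * m"
  proof (rule tendsto_lowerbound)
    show "((\<lambda>e. (LBINT x. (G x)\<^sup>2 * exp (\<phi> x) * q x) + 2 * e * (LBINT x. G x * exp (\<phi> x) * q x) + e\<^sup>2 * m) \<longlongrightarrow>
      (LBINT x. (G x)\<^sup>2 * exp (\<phi> x) * q x) + 2 * 0 * (LBINT x. G x * exp (\<phi> x) * q x) + 0\<^sup>2 * m) (at_right 0)"
      by (intro tendsto_intros)
  qed (use le in \<open>auto simp: eventually_at_right_field intro!: exI[of _ 1]\<close>)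
  then show ?thesis by (simp add: G_def)
qed

text \<open>Compact support is removed by multiplying \<phi> with cutoff functions. Boundedness of
  \<phi> controls the gradient falling on the cutoff, and integrability of the squared gradient
  supplies the dominating function.\<close>

theorem log_Sobolev:
  fixes q \<phi> :: "real^'n \<Rightarrow> real"
  assumes q: "strongly_log_concave_pdf mu q" and \<phi>: "C1_fun \<phi>" and P: "\<And>x. \<bar>\<phi> x\<bar> \<le> P"
    and gi: "integrable lborel (\<lambda>x. (norm (grad \<phi> x))\<^sup>2 * q x)"
    and m: "m = (LBINT x. exp (\<phi> x) * q x)"
  shows "2 * mu * ((LBINT x. \<phi> x * exp (\<phi> x) * q x) - m * ln m)
    \<le> (LBINT x. (norm (grad \<phi> x))\<^sup>2 * exp (\<phi> x) * q x)"
proof -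
  have qp: "\<And>x. 0 < q x" and qi: "integrable lborel q" and qcont: "continuous_on UNIV q"
    using q unfolding strongly_log_concave_pdf_def by auto
  have q0: "\<And>x. 0 \<le> q x" using qp by (simp add: less_imp_le)
  have [measurable]: "q \<in> borel_measurable borel" using qcont by (rule borel_measurable_continuous_onI)
  have pm[measurable]: "\<phi> \<in> borel_measurable borel" using C1_fun_continuous[OF \<phi>(1)] by (rule borel_measurable_continuous_onI)
  have gm[measurable]: "grad \<phi> \<in> borel_measurable borel" using C1_fun_grad_continuous[OF \<phi>(1)] by (rule borel_measurable_continuous_onI)
  have P0: "0 \<le> P" using P[of 0] abs_ge_zero order_trans by blast
  define c :: "nat \<Rightarrow> real^'n \<Rightarrow> real" where "c n = cutoff (real (Suc n))" for n
  have c: "C1_fun (c n)" "\<And>x. 0 \<le> c n x" "\<And>x. c n x \<le> 1" "\<And>x. real (Suc n) \<le> norm x \<Longrightarrow> c n x = 0"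
     "\<And>x. norm (grad (c n) x) \<le> 6" for n
  proof -
    have R: "real (Suc n) > 0" by simp
    show "C1_fun (c n)" unfolding c_def using C2_scalarD(1)[OF C2_scalar_cutoff[OF R]] .
    show "0 \<le> c n x" "c n x \<le> 1" for x unfolding c_def by (rule cutoff_bounds)+
    show "c n x = 0" if "real (Suc n) \<le> norm x" for x unfolding c_def by (rule cutoff_eq_0[OF R that])
    have "6 / real (Suc n) \<le> 6" by (simp add: field_simps)
    then show "norm (grad (c n) x) \<le> 6" for x
      unfolding c_def using norm_grad_cutoff(2)[OF R, of x] by linarith
  qed
  have clim: "(\<lambda>n. c n x) \<longlonglongrightarrow> 1" "(\<lambda>n. grad (c n) x) \<longlonglongrightarrow> 0" for x
    unfolding c_def by (rule cutoff_tendsto grad_cutoff_tendsto)+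
  define \<psi> where "\<psi> n x = c n x * \<phi> x" for n x
  have \<psi>: "C1_fun (\<psi> n)" "\<And>x. real (Suc n) \<le> norm x \<Longrightarrow> \<psi> n x = 0" "\<And>x. \<bar>\<psi> n x\<bar> \<le> P" for n
  proof -
    show "C1_fun (\<psi> n)" unfolding \<psi>_def by (intro C1_fun_mult c \<phi>)
    show "\<psi> n x = 0" if "real (Suc n) \<le> norm x" for x using c(4)[OF that] by (simp add: \<psi>_def)
    show "\<bar>\<psi> n x\<bar> \<le> P" for x
      using mult_mono[of "c n x" 1 "\<bar>\<phi> x\<bar>" P] c(2,3)[of n x] P[of x] by (simp add: \<psi>_def abs_mult)
  qed
  have g\<psi>: "grad (\<psi> n) x = c n x *\<^sub>R grad \<phi> x + \<phi> x *\<^sub>R grad (c n) x" for n x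
    unfolding \<psi>_def by (simp add: vec_eq_iff pdiff_mult[OF c(1) \<phi>] mult.commute[of "\<phi> x"])
  have \<psi>m[measurable]: "\<psi> n \<in> borel_measurable borel" for n
    using C1_fun_continuous[OF \<psi>(1)] by (rule borel_measurable_continuous_onI)
  have g\<psi>m[measurable]: "grad (\<psi> n) \<in> borel_measurable borel" for n
    using C1_fun_grad_continuous[OF \<psi>(1)] by (rule borel_measurable_continuous_onI)
  have \<psi>lim: "(\<lambda>n. \<psi> n x) \<longlonglongrightarrow> \<phi> x" for x
    using tendsto_mult[OF clim(1)[of x] tendsto_const[of "\<phi> x"]] by (simp add: \<psi>_def)
  have g\<psi>lim: "(\<lambda>n. grad (\<psi> n) x) \<longlonglongrightarrow> grad \<phi> x" for x
  proof -
    have "(\<lambda>n. c n x *\<^sub>R grad \<phi> x + \<phi> x *\<^sub>R grad (c n) x) \<longlonglongrightarrow> 1 *\<^sub>R grad \<phi> x + \<phi> x *\<^sub>R 0"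
      by (intro tendsto_intros clim)
    then show ?thesis by (simp add: g\<psi>)
  qed
  \<comment> \<open>The cutoff gradient is at most 6 and |\<phi>| at most \<open>P\<close>, and (s +
    6 P)^2 is at most 2 s^2 + 72 P^2.\<close>
  have g\<psi>b: "(norm (grad (\<psi> n) x))\<^sup>2 \<le> 2 * (norm (grad \<phi> x))\<^sup>2 + 72 * P\<^sup>2" for n x
  proof -
    have "norm (grad (\<psi> n) x) \<le> norm (grad \<phi> x) + 6 * P"
    proof -
      have "norm (c n x *\<^sub>R grad \<phi> x) \<le> 1 * norm (grad \<phi> x)"
        unfolding norm_scaleR using c(2,3)[of n x] by (intro mult_right_mono) auto
      moreover have "norm (\<phi> x *\<^sub>R grad (c n) x) \<le> P * 6"
        unfolding norm_scaleR using c(5)[of n x] P[of x] P0 by (intro mult_mono) auto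
      ultimately show ?thesis unfolding g\<psi>
        using norm_triangle_ineq[of "c n x *\<^sub>R grad \<phi> x" "\<phi> x *\<^sub>R grad (c n) x"] by simp
    qed
    then have "(norm (grad (\<psi> n) x))\<^sup>2 \<le> (norm (grad \<phi> x) + 6 * P)\<^sup>2" by (intro power_mono) auto
    also have "\<dots> \<le> 2 * (norm (grad \<phi> x))\<^sup>2 + 72 * P\<^sup>2"
      using zero_le_power2[of "norm (grad \<phi> x) - 6 * P"] by (simp add: power2_eq_square algebra_simps)
    finally show ?thesis .
  qed
  have e\<psi>: "exp (\<psi> n x) \<le> exp P" for n x using \<psi>(3)[of n x] by (simp add: abs_le_iff)
  have L1: "(\<lambda>n. \<integral>x. exp (\<psi> n x) * q x \<partial>lborel) \<longlonglongrightarrow> m" unfolding m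
  proof (rule integral_dominated_convergence[where w="\<lambda>x. exp P * q x"])
    show "AE x in lborel. (\<lambda>n. exp (\<psi> n x) * q x) \<longlonglongrightarrow> exp (\<phi> x) * q x"
      by (intro AE_I2 tendsto_intros \<psi>lim)
    show "AE x in lborel. norm (exp (\<psi> n x) * q x) \<le> exp P * q x" for n
      using e\<psi> q0 by (intro AE_I2) (auto simp: abs_mult intro!: mult_right_mono)
  qed (use qi in auto)
  have L2: "(\<lambda>n. \<integral>x. \<psi> n x * exp (\<psi> n x) * q x \<partial>lborel) \<longlonglongrightarrow> (LBINT x. \<phi> x * exp (\<phi> x) * q x)"
  proof (rule integral_dominated_convergence[where w="\<lambda>x. P * exp P * q x"])
    show "AE x in lborel. (\<lambda>n. \<psi> n x * exp (\<psi> n x) * q x) \<longlonglongrightarrow> \<phi> x * exp (\<phi> x) * q x"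
      by (intro AE_I2 tendsto_intros \<psi>lim)
    show "AE x in lborel. norm (\<psi> n x * exp (\<psi> n x) * q x) \<le> P * exp P * q x" for n
      using e\<psi> q0 \<psi>(3) P0 by (intro AE_I2) (auto simp: abs_mult intro!: mult_right_mono mult_mono)
  qed (use qi in auto)
  have L3: "(\<lambda>n. \<integral>x. (norm (grad (\<psi> n) x))\<^sup>2 * exp (\<psi> n x) * q x \<partial>lborel) \<longlonglongrightarrow> (LBINT x. (norm (grad \<phi> x))\<^sup>2 * exp (\<phi> x) * q x)"
  proof (rule integral_dominated_convergence[where w="\<lambda>x. exp P * (2 * ((norm (grad \<phi> x))\<^sup>2 * q x) + 72 * P\<^sup>2 * q x)"])
    show "AE x in lborel. (\<lambda>n. (norm (grad (\<psi> n) x))\<^sup>2 * exp (\<psi> n x) * q x) \<longlonglongrightarrow> (norm (grad \<phi> x))\<^sup>2 * exp (\<phi> x) * q x"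
      by (intro AE_I2 tendsto_intros \<psi>lim g\<psi>lim)
    show "AE x in lborel. norm ((norm (grad (\<psi> n) x))\<^sup>2 * exp (\<psi> n x) * q x) \<le> exp P * (2 * ((norm (grad \<phi> x))\<^sup>2 * q x) + 72 * P\<^sup>2 * q x)" for n
    proof (intro AE_I2)
      fix x
      have "(norm (grad (\<psi> n) x))\<^sup>2 * exp (\<psi> n x) * q x \<le> (2 * (norm (grad \<phi> x))\<^sup>2 + 72 * P\<^sup>2) * exp P * q x"
        using e\<psi> q0 g\<psi>b by (intro mult_right_mono mult_mono) auto
      then show "norm ((norm (grad (\<psi> n) x))\<^sup>2 * exp (\<psi> n x) * q x) \<le> exp P * (2 * ((norm (grad \<phi> x))\<^sup>2 * q x) + 72 * P\<^sup>2 * q x)"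
        using q0[of x] by (simp add: abs_mult algebra_simps)
    qed
  qed (use qi gi in auto)
  have "integrable lborel (\<lambda>x. exp (\<phi> x) * q x)"
  proof (rule integrable_mult_bounded[OF qi])
    show "\<bar>exp (\<phi> x)\<bar> \<le> exp P" for x using P[of x] by simp
  qed measurable
  then have m0: "0 < m" unfolding m by (rule integral_pos_weight[OF _ _ qp]) simp
  show ?thesis
  proof (rule LIMSEQ_le)
    show "(\<lambda>n. 2 * mu * ((LBINT x. \<psi> n x * exp (\<psi> n x) * q x) - (LBINT x. exp (\<psi> n x) * q x) * ln (LBINT x. exp (\<psi> n x) * q x)))
      \<longlonglongrightarrow> 2 * mu * ((LBINT x. \<phi> x * exp (\<phi> x) * q x) - m * ln m)"
      using m0 by (intro tendsto_intros L1 L2) auto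
    show "\<exists>N. \<forall>n\<ge>N. 2 * mu * ((LBINT x. \<psi> n x * exp (\<psi> n x) * q x) - (LBINT x. exp (\<psi> n x) * q x) * ln (LBINT x. exp (\<psi> n x) * q x))
      \<le> (LBINT x. (norm (grad (\<psi> n) x))\<^sup>2 * exp (\<psi> n x) * q x)"
      using log_Sobolev_compact_support[OF q \<psi>(1,2) refl] by blast
  qed (rule L3)
qed

section \<open>The cumulant-generating function\<close>

text \<open>A single point of positivity suffices, because a nonempty open set is not negligible.
  This is how non-constancy of |h| enters the integrals.\<close>

lemma integral_pos_continuous:
  fixes f :: "'a::euclidean_space \<Rightarrow> real"
  assumes "continuous_on UNIV f" "integrable lborel f" "\<And>x. 0 \<le> f x" "0 < f z"
  shows "0 < (LBINT x. f x)"
proof -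
  define U where "U = {x. 0 < f x}"
  have U: "open U" unfolding U_def using assms(1) by (intro open_Collect_less continuous_on_const)
  have "(LBINT x. f x) \<noteq> 0"
  proof
    assume "(LBINT x. f x) = 0"
    then have "AE x in lborel. f x = 0"
      using assms by (subst (asm) integral_nonneg_eq_0_iff_AE) auto
    moreover have "{x \<in> space lborel. f x \<noteq> 0} = U" using assms(3) by (auto simp: U_def less_le)
    ultimately have "emeasure lborel U = 0"
      using AE_iff_measurable[of U lborel "\<lambda>x. f x = 0"] U by (simp add: borel_open)
    then have "U \<in> null_sets lebesgue" using U by (intro null_setsI) (auto simp: borel_open)
    then have "negligible U" by (simp add: negligible_iff_null_sets)
    then show False using open_not_negligible[OF U] assms(4) by (auto simp: U_def)
  qed
  moreover have "0 \<le> (LBINT x. f x)" using assms(3) by (intro Bochner_Integration.integral_nonneg) simp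
  ultimately show ?thesis by simp
qed

section \<open>Differentiation of exponential moments\<close>

lemma exp_remainder_bound: "\<bar>exp x - 1 - x\<bar> \<le> x\<^sup>2 * exp \<bar>x\<bar>" for x :: real
proof -
  obtain t where t: "\<bar>t\<bar> \<le> \<bar>x\<bar>" "exp x = (\<Sum>m<2. x ^ m / fact m) + exp t / fact 2 * x\<^sup>2"
    using Maclaurin_exp_le[of x 2] by blast
  then have "exp x - 1 - x = exp t / 2 * x\<^sup>2" by (simp add: numeral_2_eq_2)
  then have "\<bar>exp x - 1 - x\<bar> = exp t / 2 * x\<^sup>2" using exp_ge_add_one_self[of x] by linarith
  also have "\<dots> \<le> exp \<bar>x\<bar> * x\<^sup>2"
  proof (rule mult_right_mono)
    have "exp t \<le> exp \<bar>x\<bar>" using t(1) by simp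
    then show "exp t / 2 \<le> exp \<bar>x\<bar>" using exp_gt_zero[of t] by linarith
  qed simp
  finally show ?thesis by (simp add: mult.commute)
qed

lemma exp_gt_one_plus_self: "1 + x < exp x" if "x \<noteq> 0" for x :: real
proof (cases "0 < 1 + x / 2")
  case True
  have "0 < (x / 2)\<^sup>2" using that by simp
  moreover have "(1 + x / 2)\<^sup>2 = 1 + x + (x / 2)\<^sup>2" by (simp add: power2_eq_square algebra_simps)
  ultimately have "1 + x < (1 + x / 2)\<^sup>2" by linarith
  also have "\<dots> \<le> (exp (x / 2))\<^sup>2" using True exp_ge_add_one_self[of "x / 2"] by (intro power_mono) auto
  also have "\<dots> = exp x" by (simp add: power2_eq_square flip: exp_add)
  finally show ?thesis .
next
  case False
  then show ?thesis using exp_gt_zero[of x] by linarith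
qed

text \<open>A margin \<open>d\<close> below the integrable exponent \<open>b\<close> pays for powers
  of \<open>Y\<close>: they are dominated by multiples of exp (d Y).\<close>

lemma exp_moments:
  fixes q Y :: "'a::euclidean_space \<Rightarrow> real"
  assumes [measurable]: "q \<in> borel_measurable borel" "Y \<in> borel_measurable borel"
    and q: "\<And>x. 0 \<le> q x" and Y: "\<And>x. 0 \<le> Y x"
    and b: "integrable lborel (\<lambda>x. exp (b * Y x) * q x)" "\<theta> < b"
  shows "integrable lborel (\<lambda>x. exp (\<theta> * Y x) * q x)"
    and "integrable lborel (\<lambda>x. Y x * exp (\<theta> * Y x) * q x)"
    and "integrable lborel (\<lambda>x. (Y x)\<^sup>2 * exp (\<theta> * Y x) * q x)"
proof -
  define d where "d = b - \<theta>"
  have d: "d > 0" using b by (simp add: d_def)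
  have e: "exp (\<theta> * Y x) * exp (d * Y x) = exp (b * Y x)" for x by (simp add: d_def flip: exp_add) (simp add: algebra_simps)
  have k: "0 \<le> d * Y x" for x using d Y by simp
  have e0: "1 \<le> exp (d * Y x)" for x using k[of x] by simp
  have e1: "Y x \<le> (1 / d) * exp (d * Y x)" for x
  proof -
    have "d * Y x \<le> exp (d * Y x)" using exp_ge_add_one_self[of "d * Y x"] by linarith
    then show ?thesis using d by (simp add: pos_le_divide_eq mult.commute)
  qed
  have e2: "(Y x)\<^sup>2 \<le> (2 / d\<^sup>2) * exp (d * Y x)" for x
    using exp_lower_Taylor_quadratic[OF k[of x]] d k[of x] by (simp add: pos_le_divide_eq power_mult_distrib mult.commute)
  have dom: "integrable lborel (\<lambda>x. f x * exp (\<theta> * Y x) * q x)"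
    if [measurable]: "f \<in> borel_measurable borel" and f: "\<And>x. 0 \<le> f x" "\<And>x. f x \<le> C * exp (d * Y x)" for f C
  proof (rule Bochner_Integration.integrable_bound)
    show "integrable lborel (\<lambda>x. C * (exp (b * Y x) * q x))" using b by simp
    show "AE x in lborel. norm (f x * exp (\<theta> * Y x) * q x) \<le> norm (C * (exp (b * Y x) * q x))"
    proof (rule AE_I2)
      fix x
      have "f x * (exp (\<theta> * Y x) * q x) \<le> C * exp (d * Y x) * (exp (\<theta> * Y x) * q x)"
        using f q by (intro mult_right_mono) auto
      then have "f x * exp (\<theta> * Y x) * q x \<le> C * (exp (b * Y x) * q x)" unfolding e[symmetric] by (simp add: mult_ac)
      then show "norm (f x * exp (\<theta> * Y x) * q x) \<le> norm (C * (exp (b * Y x) * q x))"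
        using f(1)[of x] q[of x] by simp
    qed
  qed measurable
  show "integrable lborel (\<lambda>x. exp (\<theta> * Y x) * q x)" using dom[of "\<lambda>_. 1" 1] e0 by simp
  show "integrable lborel (\<lambda>x. Y x * exp (\<theta> * Y x) * q x)" by (rule dom[OF _ Y e1]) measurable
  show "integrable lborel (\<lambda>x. (Y x)\<^sup>2 * exp (\<theta> * Y x) * q x)" by (rule dom[OF _ _ e2]) auto
qed

lemma DERIV_mgf:
  fixes q Y :: "'a::euclidean_space \<Rightarrow> real"
  assumes m: "q \<in> borel_measurable borel" "Y \<in> borel_measurable borel"
    and q: "\<And>x. 0 \<le> q x" and Y: "\<And>x. 0 \<le> Y x"
    and b: "integrable lborel (\<lambda>x. exp (b * Y x) * q x)" "\<theta> < b"
  shows "((\<lambda>\<theta>. \<integral>x. exp (\<theta> * Y x) * q x \<partial>lborel) has_real_derivative (LBINT x. Y x * exp (\<theta> * Y x) * q x)) (at \<theta>)"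
proof -
  \<comment> \<open>Half of the margin is used for the increment of \<theta>; the other half keeps
    the second moment at \<theta> + d finite.\<close>
  define d where "d = (b - \<theta>) / 2"
  have d: "d > 0" "\<theta> + d < b" using b(2) by (auto simp: d_def field_simps)
  define C where "C = (LBINT x. (Y x)\<^sup>2 * exp ((\<theta> + d) * Y x) * q x)"
  define M where "M \<theta> = (LBINT x. exp (\<theta> * Y x) * q x)" for \<theta>
  define M' where "M' = (LBINT x. Y x * exp (\<theta> * Y x) * q x)"
  note i = exp_moments[OF m q Y b(1)]
  have main: "\<bar>(M (\<theta> + \<eta>) - M \<theta>) / \<eta> - M'\<bar> \<le> C * \<bar>\<eta>\<bar>" if \<eta>: "\<eta> \<noteq> 0" "\<bar>\<eta>\<bar> < d" for \<eta>
  proof -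
    let ?r = "\<lambda>x. exp ((\<theta> + \<eta>) * Y x) * q x - exp (\<theta> * Y x) * q x - \<eta> * (Y x * exp (\<theta> * Y x) * q x)"
    have lt: "\<theta> + \<eta> < b" using \<eta> d by linarith
    have I: "integrable lborel (\<lambda>x. ?r x)"
      by (intro Bochner_Integration.integrable_diff integrable_mult_right i lt b)
    have eq: "M (\<theta> + \<eta>) - M \<theta> - \<eta> * M' = (LBINT x. ?r x)"
      using i(1)[OF lt] i(1,2)[OF b(2)] by (simp add: M_def M'_def)
    have "\<bar>M (\<theta> + \<eta>) - M \<theta> - \<eta> * M'\<bar> \<le> (LBINT x. \<eta>\<^sup>2 * ((Y x)\<^sup>2 * exp ((\<theta> + d) * Y x) * q x))"
      unfolding eq
    proof (rule integral_abs_bound_integral[OF I])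
      fix x
      have "?r x
        = (exp (\<eta> * Y x) - 1 - \<eta> * Y x) * (exp (\<theta> * Y x) * q x)"
      proof -
        have e: "exp ((\<theta> + \<eta>) * Y x) = exp (\<eta> * Y x) * exp (\<theta> * Y x)"
          by (simp add: distrib_right flip: exp_add)
        show ?thesis unfolding e by (simp add: algebra_simps)
      qed
      then have "\<bar>?r x\<bar>
        = \<bar>exp (\<eta> * Y x) - 1 - \<eta> * Y x\<bar> * (exp (\<theta> * Y x) * q x)"
        using q[of x] by (simp add: abs_mult)
      also have "\<dots> \<le> ((\<eta> * Y x)\<^sup>2 * exp (d * Y x)) * (exp (\<theta> * Y x) * q x)"
      proof (rule mult_right_mono)
        have "\<bar>\<eta> * Y x\<bar> \<le> d * Y x" using \<eta> Y[of x] by (auto simp: abs_mult intro!: mult_right_mono)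
        then have "(\<eta> * Y x)\<^sup>2 * exp \<bar>\<eta> * Y x\<bar> \<le> (\<eta> * Y x)\<^sup>2 * exp (d * Y x)" by (intro mult_left_mono) auto
        then show "\<bar>exp (\<eta> * Y x) - 1 - \<eta> * Y x\<bar> \<le> (\<eta> * Y x)\<^sup>2 * exp (d * Y x)"
          using exp_remainder_bound[of "\<eta> * Y x"] by linarith
      qed (use q in auto)
      also have "\<dots> = \<eta>\<^sup>2 * ((Y x)\<^sup>2 * exp ((\<theta> + d) * Y x) * q x)"
      proof -
        have e: "exp ((\<theta> + d) * Y x) = exp (d * Y x) * exp (\<theta> * Y x)"
          by (simp add: distrib_right flip: exp_add)
        show ?thesis unfolding e by (simp add: power_mult_distrib mult_ac)
      qed
      finally show "\<bar>?r x\<bar>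
        \<le> \<eta>\<^sup>2 * ((Y x)\<^sup>2 * exp ((\<theta> + d) * Y x) * q x)" .
    qed (use I i(3)[OF d(2)] in auto)
    also have "\<dots> = \<eta>\<^sup>2 * C" by (simp add: C_def)
    finally have "\<bar>M (\<theta> + \<eta>) - M \<theta> - \<eta> * M'\<bar> \<le> \<eta>\<^sup>2 * C" .
    then have "\<bar>M (\<theta> + \<eta>) - M \<theta> - \<eta> * M'\<bar> / \<bar>\<eta>\<bar> \<le> \<eta>\<^sup>2 * C / \<bar>\<eta>\<bar>" by (intro divide_right_mono) auto
    also have "\<eta>\<^sup>2 * C / \<bar>\<eta>\<bar> = C * \<bar>\<eta>\<bar>" using \<eta> by (simp add: power2_eq_square abs_if)
    also have "\<bar>M (\<theta> + \<eta>) - M \<theta> - \<eta> * M'\<bar> / \<bar>\<eta>\<bar> = \<bar>(M (\<theta> + \<eta>) - M \<theta>) / \<eta> - M'\<bar>"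
      using \<eta> by (simp add: abs_divide[symmetric] diff_divide_distrib)
    finally show ?thesis .
  qed
  have "((\<lambda>\<eta>. (M (\<theta> + \<eta>) - M \<theta>) / \<eta> - M') \<longlongrightarrow> 0) (at 0)"
  proof (rule Lim_null_comparison)
    show "\<forall>\<^sub>F \<eta> in at 0. norm ((M (\<theta> + \<eta>) - M \<theta>) / \<eta> - M') \<le> C * \<bar>\<eta>\<bar>"
      using main d by (auto simp: eventually_at dist_real_def intro!: exI[of _ d])
    show "((\<lambda>\<eta>. C * \<bar>\<eta>\<bar>) \<longlongrightarrow> 0) (at 0)" by (intro tendsto_eq_intros) auto
  qed
  then have "((\<lambda>\<eta>. (M (\<theta> + \<eta>) - M \<theta>) / \<eta>) \<longlongrightarrow> M') (at 0)" by (simp add: LIM_zero_iff)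
  then show ?thesis unfolding DERIV_def M_def M'_def .
qed

section \<open>Strict convexity and the root equation\<close>

locale exponential_moments =
  fixes q :: "real^'n \<Rightarrow> real" and h :: "real^'n \<Rightarrow> real^'m::finite"
  assumes q_cont: "continuous_on UNIV q" and q_pos: "\<And>x. 0 < q x"
    and q_int: "integrable lborel q" and q_one: "(LBINT x. q x) = 1"
    and h_cont: "continuous_on UNIV h" and h_nonconst: "\<not> (\<exists>c. \<forall>x. norm (h x) = c)"
begin

abbreviation Y :: "real^'n \<Rightarrow> real" where "Y x \<equiv> (norm (h x))\<^sup>2"

lemma q_meas [measurable]: "q \<in> borel_measurable borel" using q_cont by (rule borel_measurable_continuous_onI)
lemma Y_cont: "continuous_on UNIV Y" by (intro continuous_intros h_cont)
lemma Y_meas [measurable]: "Y \<in> borel_measurable borel" using Y_cont by (rule borel_measurable_continuous_onI)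
lemma q_nonneg: "0 \<le> q x" using q_pos[of x] by simp

lemma Y_nonconst: obtains x where "Y x \<noteq> c"
proof -
  have "\<not> (\<forall>x. norm (h x) = sqrt c)" using h_nonconst by blast
  then obtain x where "norm (h x) \<noteq> sqrt c" by blast
  then have "Y x \<noteq> c" by (metis norm_ge_zero real_sqrt_unique)
  then show thesis by (rule that)
qed

lemma below_theta_star:
  assumes "ereal \<theta> < theta_star q h"
  obtains b where "\<theta> < b" "integrable lborel (\<lambda>x. exp (b * Y x) * q x)"
proof -
  obtain b where "0 \<le> b" "integrable lborel (\<lambda>x. exp (b * Y x) * q x)" "ereal \<theta> < ereal b"
    using assms unfolding theta_star_def less_SUP_iff by blast
  then show thesis using that by auto
qed

definition mgf :: "real \<Rightarrow> real" where "mgf \<theta> = (LBINT x. exp (\<theta> * Y x) * q x)"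
definition mgf' :: "real \<Rightarrow> real" where "mgf' \<theta> = (LBINT x. Y x * exp (\<theta> * Y x) * q x)"

lemma Psi_eq: "Psi q h \<theta> = ln (mgf \<theta>)"
  by (simp add: Psi_def expect_def mgf_def)

lemma moments:
  assumes "ereal \<theta> < theta_star q h"
  shows "integrable lborel (\<lambda>x. exp (\<theta> * Y x) * q x)" "integrable lborel (\<lambda>x. Y x * exp (\<theta> * Y x) * q x)"
    "0 < mgf \<theta>" "(mgf has_real_derivative mgf' \<theta>) (at \<theta>)" "deriv (Psi q h) \<theta> = mgf' \<theta> / mgf \<theta>" "0 < mgf' \<theta>"
proof -
  obtain b where b: "\<theta> < b" "integrable lborel (\<lambda>x. exp (b * Y x) * q x)" using below_theta_star[OF assms] .
  note em = exp_moments[OF q_meas Y_meas q_nonneg zero_le_power2 b(2,1)]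
  show i: "integrable lborel (\<lambda>x. exp (\<theta> * Y x) * q x)" by (rule em(1))
  show i2: "integrable lborel (\<lambda>x. Y x * exp (\<theta> * Y x) * q x)" by (rule em(2))
  show p: "0 < mgf \<theta>" unfolding mgf_def by (rule integral_pos_weight[OF i _ q_pos]) simp
  show d: "(mgf has_real_derivative mgf' \<theta>) (at \<theta>)"
    using DERIV_mgf[OF q_meas Y_meas q_nonneg zero_le_power2 b(2,1)] unfolding mgf'_def mgf_def[abs_def] .
  have "((\<lambda>\<theta>. ln (mgf \<theta>)) has_real_derivative mgf' \<theta> / mgf \<theta>) (at \<theta>)"
    using DERIV_chain2[OF DERIV_ln_divide[OF p] d] by simp
  then show "deriv (Psi q h) \<theta> = mgf' \<theta> / mgf \<theta>" unfolding Psi_eq[abs_def] by (rule DERIV_imp_deriv)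
  obtain z where z: "Y z \<noteq> 0" using Y_nonconst .
  show "0 < mgf' \<theta>" unfolding mgf'_def
  proof (rule integral_pos_continuous[OF _ i2])
    show "continuous_on UNIV (\<lambda>x. Y x * exp (\<theta> * Y x) * q x)" by (intro continuous_intros h_cont q_cont)
    show "0 \<le> Y x * exp (\<theta> * Y x) * q x" for x using q_nonneg[of x] by simp
    show "0 < Y z * exp (\<theta> * Y z) * q z" using z q_pos[of z] by simp
  qed
qed

text \<open>The strict inequality 1 + x < exp x, for x = (a - c) Y - k, is integrated against exp (c
  Y) q. Equality everywhere would force |h| to be constant.\<close>

lemma Psi_above_tangent:
  assumes "ereal a < theta_star q h" "ereal c < theta_star q h" "a \<noteq> c"
  shows "Psi q h c + (a - c) * deriv (Psi q h) c < Psi q h a"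
proof -
  \<comment> \<open>The increment of the tangent. It is the mean of (a - c) Y under the normalized
    density proportional to exp (c Y) q, so the linear terms integrate to zero.\<close>
  define k where "k = (a - c) * deriv (Psi q h) c"
  have k: "k * mgf c = (a - c) * mgf' c" using moments(3,5)[OF assms(2)] by (simp add: k_def)
  define F where "F x = (exp ((a - c) * Y x - k) - 1 - ((a - c) * Y x - k)) * (exp (c * Y x) * q x)" for x
  have F: "F x = exp (- k) * (exp (a * Y x) * q x) + ((k - 1) * (exp (c * Y x) * q x) - (a - c) * (Y x * exp (c * Y x) * q x))" for x
  proof -
    have e: "exp ((a - c) * Y x - k) * (exp (c * Y x) * q x) = exp (- k) * (exp (a * Y x) * q x)"
      by (simp add: mult.assoc[symmetric] left_diff_distrib flip: exp_add)
    show ?thesis unfolding F_def left_diff_distrib[of _ _ "exp (c * Y x) * q x"] e by (simp add: algebra_simps)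
  qed
  have iF: "integrable lborel F" unfolding F[abs_def] using moments(1,2)[OF assms(1)] moments(1,2)[OF assms(2)] by simp
  obtain z where "Y z \<noteq> k / (a - c)" using Y_nonconst .
  then have z: "(a - c) * Y z - k \<noteq> 0" using assms(3) by (simp add: field_simps)
  have "0 < (LBINT x. F x)"
  proof (rule integral_pos_continuous[OF _ iF])
    show "continuous_on UNIV F" unfolding F_def by (intro continuous_intros h_cont q_cont)
    show "0 \<le> F x" for x
    proof -
      have "0 \<le> exp ((a - c) * Y x - k) - 1 - ((a - c) * Y x - k)"
        using exp_ge_add_one_self[of "(a - c) * Y x - k"] by linarith
      then show ?thesis unfolding F_def using q_nonneg[of x] by simp
    qed
    have "1 + ((a - c) * Y z - k) < exp ((a - c) * Y z - k)" using z by (rule exp_gt_one_plus_self)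
    then have "0 < exp ((a - c) * Y z - k) - 1 - ((a - c) * Y z - k)" by linarith
    then show "0 < F z" unfolding F_def using q_pos[of z] by simp
  qed
  also have "(LBINT x. F x) = exp (- k) * mgf a + ((k - 1) * mgf c - (a - c) * mgf' c)"
    unfolding F[abs_def] using moments(1,2)[OF assms(1)] moments(1,2)[OF assms(2)] by (simp add: mgf_def mgf'_def)
  finally have "mgf c < exp (- k) * mgf a" using k by (simp add: algebra_simps)
  then have "ln (mgf c) < ln (exp (- k) * mgf a)" using moments(3)[OF assms(1)] moments(3)[OF assms(2)] by simp
  also have "\<dots> = - k + ln (mgf a)" using moments(3)[OF assms(1)] by (simp add: ln_mult)
  finally show ?thesis by (simp add: Psi_eq k_def)
qed

text \<open>For positive arguments \<Psi> lies above its tangent at 0, which has positive slope, so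
  \<Psi> is positive there; as \<Psi>' is positive too, the root equation gives the sign of \<theta>
  - 2 K. At \<theta> = 0 the equation would read 0 = -2 K \<Psi>'(0).\<close>

lemma root_gt:
  assumes "0 < K" "is_root q h K \<theta>"
  shows "2 * K < \<theta>" "ereal \<theta> < theta_star q h" "Psi q h \<theta> = (\<theta> - 2 * K) * deriv (Psi q h) \<theta>"
proof -
  have r: "0 \<le> \<theta>" and l: "ereal \<theta> < theta_star q h" and e: "Psi q h \<theta> = (\<theta> - 2 * K) * deriv (Psi q h) \<theta>"
    using assms(2) by (auto simp: is_root_def nu_gain_def nu_def algebra_simps)
  have dp: "0 < deriv (Psi q h) \<theta>" using moments(3,5,6)[OF l] by simp
  have l0: "ereal 0 < theta_star q h" if "0 < \<theta>"
    by (rule order_less_trans[OF _ l]) (use that in simp)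
  have P0: "Psi q h 0 = 0" by (simp add: Psi_eq mgf_def q_one)
  show "2 * K < \<theta>"
  proof (cases "\<theta> = 0")
    case True
    then show ?thesis using e P0 dp assms(1) by simp
  next
    case False
    then have t: "0 < \<theta>" using r by simp
    have "0 < \<theta> * deriv (Psi q h) 0"
      using moments(3,5,6)[OF l0[OF t]] t by simp
    also have "\<dots> < Psi q h \<theta>" using Psi_above_tangent[OF l l0[OF t] False] P0 by simp
    finally have "0 < (\<theta> - 2 * K) * deriv (Psi q h) \<theta>" using e by simp
    then show ?thesis using dp by (simp add: zero_less_mult_iff)
  qed
  show "ereal \<theta> < theta_star q h" "Psi q h \<theta> = (\<theta> - 2 * K) * deriv (Psi q h) \<theta>" by (fact l e)+
qed

text \<open>At a root, the tangent line of \<open>\<Psi>\<close> vanishes at \<open>2 K\<close>, which lies to the left of the root; by strict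
  convexity this happens for at most one tangent line.\<close>

lemma root_unique:
  assumes "0 < K" "is_root q h K a" "is_root q h K c"
  shows "a = c"
proof -
  have False if ac: "a < c" "is_root q h K a" "is_root q h K c" for a c
  proof -
    note A = root_gt[OF assms(1) ac(2)] and C = root_gt[OF assms(1) ac(3)]
    have 1: "Psi q h c + (a - c) * deriv (Psi q h) c < Psi q h a"
      by (rule Psi_above_tangent[OF A(2) C(2)]) (use ac in simp)
    have 2: "Psi q h a + (c - a) * deriv (Psi q h) a < Psi q h c"
      by (rule Psi_above_tangent[OF C(2) A(2)]) (use ac in simp)
    have "(a - 2 * K) * deriv (Psi q h) c < (a - 2 * K) * deriv (Psi q h) a"
      using 1 A(3) C(3) by (simp add: algebra_simps)
    then have "deriv (Psi q h) c < deriv (Psi q h) a" using A(1) by simp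
    moreover have "(c - a) * deriv (Psi q h) a < (c - a) * deriv (Psi q h) c"
      using 1 2 by (simp add: algebra_simps)
    then have "deriv (Psi q h) a < deriv (Psi q h) c" using ac(1) by simp
    ultimately show False by simp
  qed
  then show ?thesis using assms by (metis linorder_neqE_linordered_idom)
qed

end

section \<open>The energy estimate\<close>

text \<open>Integrability of the limit is part of the conclusion; this supplies finiteness of the
  energy and of the entropy, neither of which is assumed.\<close>

lemma Fatou_integral:
  fixes f :: "nat \<Rightarrow> 'a \<Rightarrow> real"
  assumes i: "\<And>n. integrable M (f n)" and f: "\<And>n x. 0 \<le> f n x" and lim: "\<And>x. (\<lambda>n. f n x) \<longlonglongrightarrow> g x"
    and le: "\<And>n. (\<integral>x. f n x \<partial>M) \<le> c n" and c: "c \<longlonglongrightarrow> l"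
  shows "integrable M g" "(\<integral>x. g x \<partial>M) \<le> l"
proof -
  have [measurable]: "f n \<in> borel_measurable M" for n using i by auto
  have [measurable]: "g \<in> borel_measurable M" by (rule borel_measurable_LIMSEQ_real[OF lim]) measurable
  have g: "0 \<le> g x" for x using lim[of x] f by (intro LIMSEQ_le_const) auto
  have c0: "0 \<le> c n" for n using Bochner_Integration.integral_nonneg[of M "f n"] f le[of n] by (meson order_trans)
  have l0: "0 \<le> l" using c c0 by (intro LIMSEQ_le_const) auto
  have "(\<integral>\<^sup>+x. ennreal (g x) \<partial>M) = (\<integral>\<^sup>+x. liminf (\<lambda>n. ennreal (f n x)) \<partial>M)"
  proof (intro nn_integral_cong)
    fix x
    have "(\<lambda>n. ennreal (f n x)) \<longlonglongrightarrow> ennreal (g x)" using lim by (rule tendsto_ennrealI)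
    then show "ennreal (g x) = liminf (\<lambda>n. ennreal (f n x))" by (simp add: lim_imp_Liminf)
  qed
  also have "\<dots> \<le> liminf (\<lambda>n. \<integral>\<^sup>+x. ennreal (f n x) \<partial>M)" by (rule nn_integral_liminf) measurable
  also have "\<dots> \<le> liminf (\<lambda>n. ennreal (c n))"
  proof (intro Liminf_mono always_eventually allI)
    fix n
    have "(\<integral>\<^sup>+x. ennreal (f n x) \<partial>M) = ennreal (\<integral>x. f n x \<partial>M)" using i f by (intro nn_integral_eq_integral) auto
    then show "(\<integral>\<^sup>+x. ennreal (f n x) \<partial>M) \<le> ennreal (c n)" using le by (simp add: ennreal_leI)
  qed
  also have "\<dots> = ennreal l" using tendsto_ennrealI[OF c] by (simp add: lim_imp_Liminf)
  finally have le: "(\<integral>\<^sup>+x. ennreal (g x) \<partial>M) \<le> ennreal l" .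
  show gi: "integrable M g" using g le by (intro integrableI_nonneg) (auto intro: le_less_trans)
  have "ennreal (\<integral>x. g x \<partial>M) \<le> ennreal l" using nn_integral_eq_integral[OF gi] g le by simp
  then show "(\<integral>x. g x \<partial>M) \<le> l" using l0 by simp
qed

text \<open>The test function is \<open>\<Phi> v\<close> with \<open>\<Phi> = ln_trunc a\<close>, the logarithm of \<open>trunc a\<close>. The functions
  \<open>F = ln_trunc_prim a\<close> and \<open>G = ln_trunc_conj a\<close> satisfy \<open>F' = \<Phi>\<close> and \<open>G' v = v \<Phi>' v\<close>.
  The two inequalities \<open>v\<^sup>2 \<Phi>' v \<le> trunc a v\<close> and \<open>(\<Phi>' v)\<^sup>2 trunc a v \<le> \<Phi>' v\<close> are what makes the truncation exact.\<close>

definition trunc :: "real \<Rightarrow> real \<Rightarrow> real" where "trunc a v = (v + a) / (1 + a * v)"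
definition ln_trunc :: "real \<Rightarrow> real \<Rightarrow> real" where "ln_trunc a v = ln (v + a) - ln (1 + a * v)"
definition ln_trunc' :: "real \<Rightarrow> real \<Rightarrow> real" where "ln_trunc' a v = (1 - a\<^sup>2) / ((v + a) * (1 + a * v))"
definition ln_trunc_prim :: "real \<Rightarrow> real \<Rightarrow> real" where
  "ln_trunc_prim a v = (v + a) * ln (v + a) - (v + 1 / a) * ln (1 + a * v)"
definition ln_trunc_conj :: "real \<Rightarrow> real \<Rightarrow> real" where
  "ln_trunc_conj a v = v * ln_trunc a v - ln_trunc_prim a v"

context
  fixes a v :: real
  assumes a: "0 < a" "a < 1" and v: "0 < v"
begin

lemma trunc_pos: "0 < v + a" "0 < 1 + a * v"
  using a v by (auto intro: add_pos_pos)

text \<open>The bounds by \<open>a\<close> and \<open>1 / a\<close> serve for fixed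
  \<open>a\<close>; the bound by \<open>v + 1\<close> is uniform in \<open>a\<close> and yields the
  dominating function in the final limit.\<close>

lemma trunc_bounds: "a \<le> trunc a v" "trunc a v \<le> 1 / a" "trunc a v \<le> v + 1" "0 < trunc a v"
proof -
  have a2: "a * a \<le> 1" using a mult_le_one[of a a] by simp
  have "a * (1 + a * v) \<le> v + a" using mult_right_mono[OF a2, of v] v by (simp add: algebra_simps)
  then show "a \<le> trunc a v" unfolding trunc_def using trunc_pos by (simp add: pos_le_divide_eq)
  have "a * (v + a) \<le> 1 + a * v" using a2 by (simp add: algebra_simps)
  then show "trunc a v \<le> 1 / a" unfolding trunc_def using trunc_pos a by (simp add: divide_simps mult.commute)
  have "0 \<le> a * v" "0 \<le> a * (v * v)" using a v by auto
  moreover have "(v + 1) * (1 + a * v) = v + 1 + a * v + a * (v * v)" by (simp add: algebra_simps)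
  ultimately have "v + a \<le> (v + 1) * (1 + a * v)" using a by linarith
  then show "trunc a v \<le> v + 1" unfolding trunc_def using trunc_pos by (simp add: pos_divide_le_eq)
  show "0 < trunc a v" unfolding trunc_def using trunc_pos by simp
qed

lemma exp_ln_trunc: "exp (ln_trunc a v) = trunc a v"
  using trunc_pos by (simp add: ln_trunc_def exp_diff trunc_def)

lemma ln_trunc_bound: "\<bar>ln_trunc a v\<bar> \<le> ln (1 / a)"
proof -
  have e: "ln_trunc a v = ln (trunc a v)" using exp_ln_trunc by (metis ln_exp)
  have "ln a \<le> ln (trunc a v)" "ln (trunc a v) \<le> ln (1 / a)"
    using trunc_bounds a by simp_all
  then show ?thesis unfolding e using a by (simp add: ln_div abs_le_iff)
qed

lemma ln_trunc'_eq: "ln_trunc' a v = 1 / (v + a) - a / (1 + a * v)"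
  unfolding ln_trunc'_def using trunc_pos by (simp add: divide_simps power2_eq_square algebra_simps)

lemma ln_trunc'_pos: "0 < ln_trunc' a v"
proof -
  have "a\<^sup>2 < 1" using a by (simp add: power_less_one_iff)
  then show ?thesis unfolding ln_trunc'_def using trunc_pos by simp
qed

lemma DERIV_ln_trunc: "(ln_trunc a has_real_derivative ln_trunc' a v) (at v)"
  unfolding ln_trunc_def[abs_def] ln_trunc'_eq using trunc_pos
  by (auto intro!: derivative_eq_intros)

lemma DERIV_ln_trunc_prim: "(ln_trunc_prim a has_real_derivative ln_trunc a v) (at v)"
proof -
  have e: "a / (1 + a * v) * (v + 1 / a) = 1" "1 / (v + a) * (v + a) = 1"
    using trunc_pos a by (simp_all add: divide_simps)
  have d1: "((\<lambda>v. ln (v + a)) has_real_derivative 1 / (v + a)) (at v)"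
    and d2: "((\<lambda>v. ln (1 + a * v)) has_real_derivative a / (1 + a * v)) (at v)"
    and d3: "((\<lambda>v. v + c) has_real_derivative 1) (at v)" for c
    using trunc_pos by (auto intro!: derivative_eq_intros)
  have "((\<lambda>v. (v + a) * ln (v + a) - (v + 1 / a) * ln (1 + a * v)) has_real_derivative
      1 * ln (v + a) + 1 / (v + a) * (v + a) - (1 * ln (1 + a * v) + a / (1 + a * v) * (v + 1 / a))) (at v)"
    by (intro DERIV_diff DERIV_mult d1 d2 d3)
  then show ?thesis unfolding ln_trunc_prim_def[abs_def] ln_trunc_def e by simp
qed

lemma DERIV_ln_trunc_conj: "(ln_trunc_conj a has_real_derivative v * ln_trunc' a v) (at v)"
  unfolding ln_trunc_conj_def[abs_def]
  using DERIV_diff[OF DERIV_mult[OF DERIV_ident DERIV_ln_trunc] DERIV_ln_trunc_prim] by (simp add: mult.commute)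

lemma isCont_ln_trunc': "isCont (ln_trunc' a) v"
  unfolding ln_trunc'_def[abs_def] using trunc_pos by (intro continuous_intros) auto

lemma isCont_ln_trunc: "isCont (ln_trunc a) v"
  using DERIV_ln_trunc by (rule DERIV_isCont)

text \<open>Linear growth in v is the point: multiplied by the nominal density it becomes a multiple
  of the sum of both densities, which is integrable.\<close>

lemma ln_trunc_prim_bound: "\<bar>ln_trunc_prim a v\<bar> \<le> (ln (1 / a) + 1) * (1 + v)"
proof -
  have "ln_trunc_prim a v = (v + a) * ln_trunc a v - (1 / a - a) * ln (1 + a * v)"
    unfolding ln_trunc_prim_def ln_trunc_def by (simp add: algebra_simps)
  moreover have "\<bar>(v + a) * ln_trunc a v\<bar> \<le> (1 + v) * ln (1 / a)"
    unfolding abs_mult using ln_trunc_bound a v by (intro mult_mono) auto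
  moreover have "\<bar>(1 / a - a) * ln (1 + a * v)\<bar> \<le> (1 / a) * (a * v)"
  proof -
    have "a * a \<le> 1" using a mult_le_one[of a a] by simp
    then have "a \<le> 1 / a" using a by (simp add: pos_le_divide_eq)
    moreover have "0 \<le> ln (1 + a * v)" using a v by simp
    moreover have "ln (1 + a * v) \<le> a * v" using a v by (intro ln_add_one_self_le_self) simp
    ultimately show ?thesis unfolding abs_mult using a by (intro mult_mono) auto
  qed
  ultimately have "\<bar>ln_trunc_prim a v\<bar> \<le> (1 + v) * ln (1 / a) + v" using a by simp
  then show ?thesis using v by (simp add: algebra_simps)
qed

text \<open>For the plain logarithm this is the identity v^2 / v = v. It puts the truncated density
  in front of |h|^2 on the right of the energy estimate.\<close>

lemma ln_trunc'_mult_square_le: "ln_trunc' a v * v\<^sup>2 \<le> trunc a v"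
proof -
  have "(1 - a\<^sup>2) * v\<^sup>2 \<le> 1 * (v + a)\<^sup>2"
    using a v by (intro mult_mono power_mono) (auto simp: power_le_one)
  then have "(1 - a\<^sup>2) * v\<^sup>2 / ((v + a) * (1 + a * v)) \<le> (v + a)\<^sup>2 / ((v + a) * (1 + a * v))"
    using trunc_pos by (intro divide_right_mono) auto
  also have "\<dots> = trunc a v" using trunc_pos by (simp add: trunc_def power2_eq_square)
  finally show ?thesis by (simp add: ln_trunc'_def)
qed

text \<open>For the plain logarithm this is the identity v / v^2 = 1 / v. It compares the Fisher
  information of the truncated density with the quadratic form of the energy estimate.\<close>

lemma ln_trunc'_square_le: "(ln_trunc' a v)\<^sup>2 * trunc a v \<le> ln_trunc' a v"
proof -
  have "ln_trunc' a v * trunc a v = (1 - a\<^sup>2) / (1 + a * v)\<^sup>2"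
    unfolding ln_trunc'_def trunc_def using trunc_pos by (simp add: power2_eq_square)
  also have "\<dots> \<le> 1 / 1" using a v by (intro frac_le) (auto simp: power_le_one one_le_power)
  finally have "ln_trunc' a v * (ln_trunc' a v * trunc a v) \<le> ln_trunc' a v * 1"
    using ln_trunc'_pos by (intro mult_left_mono) auto
  then show ?thesis by (simp add: power2_eq_square mult.assoc)
qed

end

text \<open>The probability current with reversed sign; the stationary equation says that it is free
  of divergence.\<close>

definition flux :: "(real^'n \<Rightarrow> real^'m^'n::finite) \<Rightarrow> (real^'n \<Rightarrow> real^'n) \<Rightarrow> (real^'n \<Rightarrow> real) \<Rightarrow> 'n \<Rightarrow> real^'n \<Rightarrow> real" where
  "flux g b r j x = 1/2 * (\<Sum>k\<in>UNIV. pdiff k (\<lambda>y. r y * diffusion g y $ j $ k) x) - r x * b x $ j"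

section \<open>Growth of the coefficients\<close>

lemma linear_growth:
  fixes F :: "real^'n \<Rightarrow> 'b::real_normed_vector"
  assumes "\<exists>L. L-lipschitz_on UNIV F"
  obtains C where "0 \<le> C" "\<And>x. norm (F x) \<le> C * (1 + norm x)"
proof -
  obtain L where L: "L-lipschitz_on UNIV F" using assms by blast
  have L0: "0 \<le> L" using L by (rule lipschitz_on_nonneg)
  show thesis
  proof (rule that[of "L + norm (F 0)"])
    fix x
    have "norm (F x - F 0) \<le> L * norm x" using lipschitz_onD[OF L, of x 0] by (simp add: dist_norm)
    then have "norm (F x) \<le> L * norm x + norm (F 0)" using norm_triangle_sub[of "F x" "F 0"] by linarith
    moreover have "0 \<le> norm (F 0) * norm x" by simp
    moreover have "(L + norm (F 0)) * (1 + norm x) = L + norm (F 0) + L * norm x + norm (F 0) * norm x"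
      by (simp add: algebra_simps)
    ultimately show "norm (F x) \<le> (L + norm (F 0)) * (1 + norm x)" using L0 by linarith
  qed (use L0 in simp)
qed

lemma inner_grad_cutoff_bounded:
  fixes F :: "real^'n \<Rightarrow> real^'n"
  assumes "\<exists>L. L-lipschitz_on UNIV F"
  obtains C where "0 \<le> C" "\<And>n x. \<bar>F x \<bullet> grad (cutoff (real (Suc n))) x\<bar> \<le> C"
proof -
  obtain C where C: "0 \<le> C" "\<And>x. norm (F x) \<le> C * (1 + norm x)" using linear_growth[OF assms] by blast
  show thesis
  proof (rule that[of "12 * C"])
    fix n and x :: "real^'n"
    define G where "G = norm (grad (cutoff (real (Suc n))) x)"
    have R: "0 < real (Suc n)" by simp
    have "6 / real (Suc n) \<le> 6" by (simp add: field_simps)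
    then have G: "G \<le> 6" "G * norm x \<le> 6" unfolding G_def using norm_grad_cutoff[OF R, of x] by linarith+
    have "\<bar>F x \<bullet> grad (cutoff (real (Suc n))) x\<bar> \<le> norm (F x) * G" unfolding G_def by (rule Cauchy_Schwarz_ineq2)
    also have "\<dots> \<le> C * (1 + norm x) * G" using C by (intro mult_right_mono) (auto simp: G_def)
    also have "\<dots> = C * (G + G * norm x)" by (simp add: algebra_simps)
    also have "\<dots> \<le> C * (6 + 6)" using C(1) G by (intro mult_left_mono add_mono) auto
    finally show "\<bar>F x \<bullet> grad (cutoff (real (Suc n))) x\<bar> \<le> 12 * C" by simp
  qed (use C in simp)
qed

lemma steady_integral:
  assumes "steady_pdf b g r"
  shows "integrable lborel r" "(LBINT x. r x) = 1"
proof -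
  have r: "\<And>x. 0 \<le> r x" "(\<integral>\<^sup>+x. ennreal (r x) \<partial>lborel) = 1" and C2: "C2_fun r"
    using assms by (auto simp: steady_pdf_def C2_pdf_def)
  have [measurable]: "r \<in> borel_measurable borel"
    by (intro borel_measurable_continuous_onI C1_fun_continuous C2_scalarD(1) C2_fun_imp_C2_scalar C2)
  show i: "integrable lborel r" using r by (intro integrableI_nonneg) auto
  have "ennreal (LBINT x. r x) = 1" using nn_integral_eq_integral[OF i] r by simp
  then show "(LBINT x. r x) = 1" by simp
qed

section \<open>The two currents and the density ratio\<close>

locale steady_pair =
  fixes f :: "real^'n \<Rightarrow> real^'n" and g :: "real^'n \<Rightarrow> real^'m::finite^'n" and h :: "real^'n \<Rightarrow> real^'m"
    and p q :: "real^'n \<Rightarrow> real"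
  assumes f: "C1_fun f" and g: "C2_fun g" and h: "C1_fun h"
    and f_Lip: "\<exists>L. L-lipschitz_on UNIV f" and g_Lip: "\<exists>L. L-lipschitz_on UNIV g"
    and fh_Lip: "\<exists>L. L-lipschitz_on UNIV (\<lambda>x. f x + g x *v h x)"
    and p: "steady_pdf (\<lambda>x. f x + g x *v h x) g p" and p_pos: "\<And>x. 0 < p x"
    and q: "steady_pdf f g q" and q_pos: "\<And>x. 0 < q x"
begin

abbreviation fh :: "real^'n \<Rightarrow> real^'n" where "fh \<equiv> \<lambda>x. f x + g x *v h x"

abbreviation D :: "real^'n \<Rightarrow> real^'n^'n" where "D \<equiv> diffusion g"
abbreviation J :: "'n \<Rightarrow> real^'n \<Rightarrow> real" where "J \<equiv> flux g fh p"
abbreviation Js :: "'n \<Rightarrow> real^'n \<Rightarrow> real" where "Js \<equiv> flux g f q"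

lemma p_C2: "C2_scalar p" and q_C2: "C2_scalar q"
  using p q by (auto simp: steady_pdf_def C2_pdf_def intro: C2_fun_imp_C2_scalar)

lemma g_C2: "C2_scalar (\<lambda>x. g x $ j $ l)"
proof (rule C2_fun_imp_C2_scalar)
  have "bounded_linear (\<lambda>M :: real^'m^'n. M $ j $ l)"
    using bounded_linear_compose[OF bounded_linear_vec_nth bounded_linear_vec_nth] .
  then show "C2_fun (\<lambda>x. g x $ j $ l)" by (rule C2_fun_linear_compose[OF _ g])
qed

lemma f_C1: "C1_fun (\<lambda>x. f x $ j)"
  by (rule C1_fun_linear_compose[OF bounded_linear_vec_nth f])

lemma h_C1: "C1_fun (\<lambda>x. h x $ j)"
  by (rule C1_fun_linear_compose[OF bounded_linear_vec_nth h])

lemma fh_C1: "C1_fun (\<lambda>x. fh x $ j)"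
  by (simp add: matrix_vector_mult_def)
    (intro C1_fun_add C1_fun_sum C1_fun_mult f_C1 h_C1 C2_scalarD(1)[OF g_C2])

lemma diffusion_nth: "D x $ j $ k = (\<Sum>l\<in>UNIV. g x $ j $ l * g x $ k $ l)"
  by (simp add: diffusion_def matrix_matrix_mult_def transpose_def)

lemma diffusion_sym: "D x $ j $ k = D x $ k $ j"
  by (simp add: diffusion_nth mult.commute)

lemma D_C2: "C2_scalar (\<lambda>x. D x $ j $ k)"
  unfolding diffusion_nth by (intro C2_scalar_sum C2_scalar_mult g_C2)

lemma flux_C1:
  assumes "C2_scalar r" "\<And>j. C1_fun (\<lambda>x. b x $ j)"
  shows "C1_fun (flux g b r j)"
  unfolding flux_def[abs_def]
  by (intro C1_fun_diff C1_fun_mult C1_fun_const C1_fun_sum C2_scalarD(2) C2_scalar_mult assms D_C2 C2_scalarD(1)[OF assms(1)])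

lemma flux_divergence:
  assumes r: "steady_pdf b g r" and C2: "C2_scalar r" and b: "\<And>j. C1_fun (\<lambda>x. b x $ j)"
  shows "(\<Sum>j\<in>UNIV. pdiff j (flux g b r j) x) = 0"
proof -
  have "pdiff j (flux g b r j) x = 1/2 * (\<Sum>k\<in>UNIV. pdiff j (pdiff k (\<lambda>y. r y * D y $ j $ k)) x) - pdiff j (\<lambda>y. r y * b y $ j) x" for j
  proof -
    have c: "C1_fun (pdiff k (\<lambda>y. r y * D y $ j $ k))" for k
      by (intro C2_scalarD(2) C2_scalar_mult C2 D_C2)
    have c1: "C1_fun (\<lambda>x. \<Sum>k\<in>UNIV. pdiff k (\<lambda>y. r y * D y $ j $ k) x)" by (intro C1_fun_sum c)
    have c2: "C1_fun (\<lambda>y. r y * b y $ j)" by (intro C1_fun_mult b C2_scalarD(1)[OF C2])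
    show ?thesis unfolding flux_def[abs_def] pdiff_diff[OF C1_fun_mult[OF C1_fun_const c1] c2] pdiff_cmult[OF c1]
      by (simp add: pdiff_sum[OF c])
  qed
  then show ?thesis using r by (simp add: steady_pdf_def div2_def divergence_def sum_subtractf sum_distrib_left)
qed

definition v :: "real^'n \<Rightarrow> real" where "v x = p x / q x"

lemma v_pos: "0 < v x" using p_pos[of x] q_pos[of x] by (simp add: v_def)
lemma p_eq: "p x = v x * q x" using q_pos[of x] by (simp add: v_def)

lemma v_C1: "C1_fun v"
proof -
  have "C1_fun (\<lambda>x. inverse (q x))"
  proof (rule C1_fun_compose[where f'="\<lambda>y. - (inverse y ^ Suc (Suc 0))", OF C2_scalarD(1)[OF q_C2]])
    show "(inverse has_real_derivative - (inverse (q x) ^ Suc (Suc 0))) (at (q x))" for x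
      using q_pos[of x] by (intro DERIV_inverse) simp
    show "isCont (\<lambda>y. - (inverse y ^ Suc (Suc 0))) (q x)" for x using q_pos[of x] by (intro continuous_intros) simp
  qed
  from C1_fun_mult[OF C2_scalarD(1)[OF p_C2] this] show ?thesis by (simp add: v_def[abs_def] divide_inverse)
qed

text \<open>The product rule for p = v q splits the perturbed current into a gradient of
  \<open>v\<close>, the nominal current transported by \<open>v\<close>, and the noise drift. Only
  the middle term contains derivatives of \<open>q\<close>.\<close>

lemma flux_p: "J j x = 1/2 * q x * (\<Sum>k\<in>UNIV. D x $ j $ k * pdiff k v x)
    + v x * Js j x - p x * (g x *v h x) $ j"
proof -
  have "pdiff k (\<lambda>y. p y * D y $ j $ k) x = v x * pdiff k (\<lambda>y. q y * D y $ j $ k) x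
      + q x * (D x $ j $ k * pdiff k v x)" for k
  proof -
    have "C1_fun (\<lambda>y. q y * D y $ j $ k)" by (intro C1_fun_mult C2_scalarD(1) q_C2 D_C2)
    from pdiff_mult[OF v_C1 this, of k] show ?thesis by (simp add: p_eq mult.assoc fun_eq_iff mult_ac)
  qed
  then show ?thesis unfolding flux_def by (simp add: sum.distrib sum_distrib_left[symmetric] p_eq algebra_simps)
qed

text \<open>The noise-weighted gradient: its squared norm is the diffusion quadratic form of grad v,
  and its product with \<open>h\<close> is the work of the noise drift.\<close>

definition w :: "real^'n \<Rightarrow> real^'m" where "w x = transpose (g x) *v grad v x"

lemma w_norm: "(norm (w x))\<^sup>2 = (\<Sum>j\<in>UNIV. pdiff j v x * (\<Sum>k\<in>UNIV. D x $ j $ k * pdiff k v x))"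
proof -
  have "(norm (w x))\<^sup>2 = grad v x \<bullet> (D x *v grad v x)"
    by (simp add: w_def power2_norm_eq_inner inner_diffusion)
  then show ?thesis by (simp add: inner_vec_def matrix_vector_mult_def)
qed

lemma w_inner_h: "w x \<bullet> h x = (\<Sum>j\<in>UNIV. pdiff j v x * (g x *v h x) $ j)"
proof -
  have "w x \<bullet> h x = grad v x \<bullet> (g x *v h x)"
    unfolding w_def by (metis dot_lmul_matrix transpose_matrix_vector transpose_transpose)
  then show ?thesis by (simp add: inner_vec_def)
qed

lemma w_cont: "continuous_on UNIV w"
  unfolding w_def matrix_vector_mult_def transpose_def
  by (intro continuous_on_vec_lambda continuous_on_sum continuous_on_mult)
    (auto intro!: C1_fun_continuous C2_scalarD(1) g_C2 C1_fun_pdiff_continuous v_C1)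

end

context steady_pair
begin

text \<open>The generator of the nominal diffusion, applied below to cutoff functions.\<close>

definition drift_op :: "(real^'n \<Rightarrow> real) \<Rightarrow> real^'n \<Rightarrow> real" where
  "drift_op c x = 1/2 * (\<Sum>j\<in>UNIV. \<Sum>k\<in>UNIV. D x $ j $ k * pdiff j (pdiff k c) x) + (\<Sum>j\<in>UNIV. f x $ j * pdiff j c x)"

text \<open>The divergence of this field is the difference of the two equations, tested with \<open>c \<Phi> v\<close> and \<open>c G v\<close>
  respectively; the last summand moves the remaining derivatives onto the cutoff function \<open>c\<close>, so that only
  zero-order terms in \<open>v\<close> survive outside the quadratic form.\<close>

definition test_field :: "real \<Rightarrow> (real^'n \<Rightarrow> real) \<Rightarrow> 'n \<Rightarrow> real^'n \<Rightarrow> real" where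
  "test_field a c j x = c x * (ln_trunc a (v x) * J j x - ln_trunc_conj a (v x) * Js j x)
     - 1/2 * (ln_trunc_prim a (v x) * (\<Sum>k\<in>UNIV. (q x * D x $ j $ k) * pdiff k c x))"

context
  fixes a :: real
  assumes a: "0 < a" "a < 1"
begin

lemma C1_ln_trunc_v: "C1_fun (\<lambda>x. ln_trunc a (v x))"
  by (rule C1_fun_compose[where f="ln_trunc a" and f'="ln_trunc' a", OF v_C1])
    (auto intro: DERIV_ln_trunc isCont_ln_trunc' a v_pos)

lemma C1_ln_trunc_prim_v: "C1_fun (\<lambda>x. ln_trunc_prim a (v x))"
  by (rule C1_fun_compose[where f="ln_trunc_prim a" and f'="ln_trunc a", OF v_C1])
    (auto intro: DERIV_ln_trunc_prim isCont_ln_trunc a v_pos)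

lemma C1_ln_trunc_conj_v: "C1_fun (\<lambda>x. ln_trunc_conj a (v x))"
  by (rule C1_fun_compose[where f="ln_trunc_conj a" and f'="\<lambda>v. v * ln_trunc' a v", OF v_C1])
    (auto intro!: DERIV_ln_trunc_conj isCont_ln_trunc' continuous_intros a v_pos)

lemma pdiff_ln_trunc_v: "pdiff j (\<lambda>x. ln_trunc a (v x)) = (\<lambda>x. ln_trunc' a (v x) * pdiff j v x)"
  by (rule pdiff_compose[where f="ln_trunc a" and f'="ln_trunc' a", OF v_C1]) (rule DERIV_ln_trunc[OF a v_pos])

lemma pdiff_ln_trunc_prim_v: "pdiff j (\<lambda>x. ln_trunc_prim a (v x)) = (\<lambda>x. ln_trunc a (v x) * pdiff j v x)"
  by (rule pdiff_compose[where f="ln_trunc_prim a" and f'="ln_trunc a", OF v_C1]) (rule DERIV_ln_trunc_prim[OF a v_pos])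

lemma pdiff_ln_trunc_conj_v: "pdiff j (\<lambda>x. ln_trunc_conj a (v x)) = (\<lambda>x. v x * ln_trunc' a (v x) * pdiff j v x)"
  by (rule pdiff_compose[where f="ln_trunc_conj a" and f'="\<lambda>v. v * ln_trunc' a v", OF v_C1]) (rule DERIV_ln_trunc_conj[OF a v_pos])

lemmas flux_p_C1 = flux_C1[OF p_C2 fh_C1]
lemmas flux_q_C1 = flux_C1[OF q_C2 f_C1]

lemma qD_C1: "C1_fun (\<lambda>x. q x * D x $ j $ k)"
  by (intro C1_fun_mult C2_scalarD(1) q_C2 D_C2)

lemma test_field_C1:
  assumes c: "C2_scalar c"
  shows "C1_fun (test_field a c j)"
  unfolding test_field_def[abs_def]
  by (intro C1_fun_diff C1_fun_mult C1_fun_const C1_fun_sum qD_C1 C1_ln_trunc_v C1_ln_trunc_prim_v C1_ln_trunc_conj_v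
    flux_p_C1 flux_q_C1 C2_scalarD[OF c])

lemma pdiff_test_field:
  assumes c: "C2_scalar c"
  shows "pdiff j (test_field a c j) x =
    pdiff j c x * (ln_trunc a (v x) * J j x - ln_trunc_conj a (v x) * Js j x)
    + c x * (ln_trunc' a (v x) * (pdiff j v x * J j x) - v x * ln_trunc' a (v x) * (pdiff j v x * Js j x))
    + c x * (ln_trunc a (v x) * pdiff j (J j) x - ln_trunc_conj a (v x) * pdiff j (Js j) x)
    - 1/2 * (ln_trunc a (v x) * (q x * (pdiff j v x * (\<Sum>k\<in>UNIV. D x $ j $ k * pdiff k c x))))
    - 1/2 * (ln_trunc_prim a (v x) * (\<Sum>k\<in>UNIV. pdiff j (\<lambda>x. q x * D x $ j $ k) x * pdiff k c x))
    - 1/2 * (ln_trunc_prim a (v x) * (q x * (\<Sum>k\<in>UNIV. D x $ j $ k * pdiff j (pdiff k c) x)))"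
proof -
  note C1 = qD_C1 C1_ln_trunc_v C1_ln_trunc_prim_v C1_ln_trunc_conj_v flux_p_C1 flux_q_C1 C2_scalarD[OF c]
  have s: "C1_fun (\<lambda>x. \<Sum>k\<in>UNIV. (q x * D x $ j $ k) * pdiff k c x)" by (intro C1_fun_sum C1_fun_mult C1)
  have b: "C1_fun (\<lambda>x. ln_trunc a (v x) * J j x - ln_trunc_conj a (v x) * Js j x)"
    by (intro C1_fun_diff C1_fun_mult C1)
  have ps: "pdiff j (\<lambda>x. \<Sum>k\<in>UNIV. (q x * D x $ j $ k) * pdiff k c x) x =
    q x * (\<Sum>k\<in>UNIV. D x $ j $ k * pdiff j (pdiff k c) x) + (\<Sum>k\<in>UNIV. pdiff j (\<lambda>x. q x * D x $ j $ k) x * pdiff k c x)"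
    unfolding pdiff_sum[OF C1_fun_mult[OF qD_C1 C2_scalarD(2)[OF c]]] pdiff_mult[OF qD_C1 C2_scalarD(2)[OF c]]
    by (simp add: sum.distrib sum_distrib_left mult.assoc)
  have pb: "pdiff j (\<lambda>x. ln_trunc a (v x) * J j x - ln_trunc_conj a (v x) * Js j x) x =
    ln_trunc a (v x) * pdiff j (J j) x + ln_trunc' a (v x) * pdiff j v x * J j x
    - (ln_trunc_conj a (v x) * pdiff j (Js j) x + v x * ln_trunc' a (v x) * pdiff j v x * Js j x)"
    unfolding pdiff_diff[OF C1_fun_mult[OF C1_ln_trunc_v flux_p_C1] C1_fun_mult[OF C1_ln_trunc_conj_v flux_q_C1]]
      pdiff_mult[OF C1_ln_trunc_v flux_p_C1] pdiff_mult[OF C1_ln_trunc_conj_v flux_q_C1] pdiff_ln_trunc_v pdiff_ln_trunc_conj_v ..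
  have sq: "(\<Sum>k\<in>UNIV. (q x * D x $ j $ k) * pdiff k c x) = q x * (\<Sum>k\<in>UNIV. D x $ j $ k * pdiff k c x)"
    by (simp add: sum_distrib_left mult.assoc)
  have "pdiff j (test_field a c j) x =
      c x * (ln_trunc a (v x) * pdiff j (J j) x + ln_trunc' a (v x) * pdiff j v x * J j x
    - (ln_trunc_conj a (v x) * pdiff j (Js j) x + v x * ln_trunc' a (v x) * pdiff j v x * Js j x))
     + pdiff j c x * (ln_trunc a (v x) * J j x - ln_trunc_conj a (v x) * Js j x)
     - 1/2 * (ln_trunc_prim a (v x) * (q x * (\<Sum>k\<in>UNIV. D x $ j $ k * pdiff j (pdiff k c) x) + (\<Sum>k\<in>UNIV. pdiff j (\<lambda>x. q x * D x $ j $ k) x * pdiff k c x))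
       + ln_trunc a (v x) * pdiff j v x * (q x * (\<Sum>k\<in>UNIV. D x $ j $ k * pdiff k c x)))"
    unfolding test_field_def[abs_def]
      pdiff_diff[OF C1_fun_mult[OF C2_scalarD(1)[OF c] b] C1_fun_mult[OF C1_fun_const C1_fun_mult[OF C1_ln_trunc_prim_v s]]]
      pdiff_cmult[OF C1_fun_mult[OF C1_ln_trunc_prim_v s]] pdiff_mult[OF C1_ln_trunc_prim_v s] pdiff_mult[OF C2_scalarD(1)[OF c] b]
      pb ps pdiff_ln_trunc_prim_v sq ..
  then show ?thesis by (simp add: algebra_simps add_divide_distrib)
qed

text \<open>By symmetry of \<open>D\<close>, the column divergences of \<open>q D\<close> are twice
  the nominal current plus twice \<open>q f\<close>. The former cancels later; the latter completes
  the generator acting on \<open>c\<close>.\<close>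

lemma flux_q_divergence_D:
  "(\<Sum>j\<in>UNIV. \<Sum>k\<in>UNIV. pdiff j (\<lambda>x. q x * D x $ j $ k) x * pdiff k c x)
    = 2 * (\<Sum>k\<in>UNIV. pdiff k c x * Js k x) + 2 * (q x * (\<Sum>k\<in>UNIV. f x $ k * pdiff k c x))"
proof -
  have "(\<Sum>j\<in>UNIV. \<Sum>k\<in>UNIV. pdiff j (\<lambda>x. q x * D x $ j $ k) x * pdiff k c x)
    = (\<Sum>k\<in>UNIV. \<Sum>j\<in>UNIV. pdiff j (\<lambda>x. q x * D x $ j $ k) x * pdiff k c x)"
    by (rule sum.swap)
  also have "\<dots> = (\<Sum>k\<in>UNIV. pdiff k c x * (\<Sum>j\<in>UNIV. pdiff j (\<lambda>x. q x * D x $ k $ j) x))"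
    by (intro sum.cong refl) (simp add: sum_distrib_left mult.commute diffusion_sym)
  also have "\<dots> = (\<Sum>k\<in>UNIV. pdiff k c x * (2 * Js k x + 2 * (q x * f x $ k)))"
    by (simp add: flux_def)
  finally show ?thesis by (simp add: sum.distrib sum_distrib_left algebra_simps)
qed

text \<open>Three cancellations, in the notation of the proof: \<open>a1\<close> because the
  derivative of \<open>ln_trunc_conj\<close> is v times that of \<open>ln_trunc\<close>;
  \<open>a2\<close> because v \<Phi> is the sum of \<open>ln_trunc_conj\<close> and
  \<open>ln_trunc_prim\<close>; \<open>a4\<close>, the mixed gradients of \<open>v\<close> and
  \<open>c\<close>, through the last summand of the field. No derivative of \<open>q\<close>
  remains.\<close>

lemma divergence_test_field:
  assumes c: "C2_scalar c"
  shows "(\<Sum>j\<in>UNIV. pdiff j (test_field a c j) x) =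
    c x * ln_trunc' a (v x) * (1/2 * q x * (norm (w x))\<^sup>2 - p x * (w x \<bullet> h x))
    - ln_trunc_prim a (v x) * q x * drift_op c x
    - p x * ln_trunc a (v x) * (\<Sum>j\<in>UNIV. pdiff j c x * (g x *v h x) $ j)"
proof -
  define B where "B j = (g x *v h x) $ j" for j
  define S where "S j = Js j x" for j
  define E where "E j = (\<Sum>k\<in>UNIV. D x $ j $ k * pdiff k v x)" for j
  define H where "H j = (\<Sum>k\<in>UNIV. D x $ j $ k * pdiff k c x)" for j
  define a1 where "a1 = (\<Sum>j\<in>UNIV. pdiff j v x * S j)"
  define a2 where "a2 = (\<Sum>j\<in>UNIV. pdiff j c x * S j)"
  define a4 where "a4 = (\<Sum>j\<in>UNIV. pdiff j c x * E j)"
  define a6 where "a6 = (\<Sum>j\<in>UNIV. pdiff j c x * B j)"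
  define a7 where "a7 = (\<Sum>j\<in>UNIV. f x $ j * pdiff j c x)"
  define a8 where "a8 = (\<Sum>j\<in>UNIV. \<Sum>k\<in>UNIV. D x $ j $ k * pdiff j (pdiff k c) x)"
  have a3: "(\<Sum>j\<in>UNIV. pdiff j v x * E j) = (norm (w x))\<^sup>2" by (simp add: w_norm E_def)
  have a5: "(\<Sum>j\<in>UNIV. pdiff j v x * B j) = w x \<bullet> h x" by (simp add: w_inner_h B_def)
  have a4': "(\<Sum>j\<in>UNIV. pdiff j v x * H j) = a4"
  proof -
    have "(\<Sum>j\<in>UNIV. pdiff j v x * H j) = (\<Sum>j\<in>UNIV. \<Sum>k\<in>UNIV. pdiff j v x * (D x $ j $ k * pdiff k c x))"
      by (simp add: H_def sum_distrib_left)
    also have "\<dots> = (\<Sum>k\<in>UNIV. \<Sum>j\<in>UNIV. pdiff j v x * (D x $ j $ k * pdiff k c x))"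
      by (rule sum.swap)
    also have "\<dots> = a4" unfolding a4_def E_def sum_distrib_left
      by (intro sum.cong refl) (simp add: diffusion_sym mult_ac)
    finally show ?thesis .
  qed
  have flux: "J j x = 1/2 * q x * E j + v x * S j - p x * B j" for j
    by (simp add: flux_p E_def S_def B_def)
  have J1: "(\<Sum>j\<in>UNIV. pdiff j v x * J j x) = 1/2 * q x * (norm (w x))\<^sup>2 + v x * a1 - p x * (w x \<bullet> h x)"
    unfolding a3[symmetric] a5[symmetric] a1_def flux sum_distrib_left sum.distrib[symmetric] sum_subtractf[symmetric]
    by (intro sum.cong refl) (simp add: algebra_simps)
  have J2: "(\<Sum>j\<in>UNIV. pdiff j c x * J j x) = 1/2 * q x * a4 + v x * a2 - p x * a6"
    unfolding a4_def a2_def a6_def flux sum_distrib_left sum.distrib[symmetric] sum_subtractf[symmetric]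
    by (intro sum.cong refl) (simp add: algebra_simps)
  have dp: "(\<Sum>j\<in>UNIV. pdiff j (J j) x) = 0" by (rule flux_divergence[OF p p_C2 fh_C1])
  have dq: "(\<Sum>j\<in>UNIV. pdiff j (Js j) x) = 0" by (rule flux_divergence[OF q q_C2 f_C1])
  have "(\<Sum>j\<in>UNIV. pdiff j (test_field a c j) x) =
    (ln_trunc a (v x) * (\<Sum>j\<in>UNIV. pdiff j c x * J j x) - ln_trunc_conj a (v x) * a2)
    + c x * (ln_trunc' a (v x) * (\<Sum>j\<in>UNIV. pdiff j v x * J j x) - v x * ln_trunc' a (v x) * a1)
    + c x * (ln_trunc a (v x) * (\<Sum>j\<in>UNIV. pdiff j (J j) x) - ln_trunc_conj a (v x) * (\<Sum>j\<in>UNIV. pdiff j (Js j) x))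
    - 1/2 * (ln_trunc a (v x) * (q x * (\<Sum>j\<in>UNIV. pdiff j v x * H j)))
    - 1/2 * (ln_trunc_prim a (v x) * (\<Sum>j\<in>UNIV. \<Sum>k\<in>UNIV. pdiff j (\<lambda>x. q x * D x $ j $ k) x * pdiff k c x))
    - 1/2 * (ln_trunc_prim a (v x) * (q x * a8))"
    unfolding pdiff_test_field[OF c] a2_def a1_def a8_def S_def H_def sum_distrib_left sum.distrib[symmetric] sum_subtractf[symmetric]
    by (intro sum.cong refl) (simp add: sum_distrib_left algebra_simps)
  also have "\<dots> = (ln_trunc a (v x) * (1/2 * q x * a4 + v x * a2 - p x * a6) - ln_trunc_conj a (v x) * a2)
    + c x * (ln_trunc' a (v x) * (1/2 * q x * (norm (w x))\<^sup>2 + v x * a1 - p x * (w x \<bullet> h x)) - v x * ln_trunc' a (v x) * a1)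
    - 1/2 * (ln_trunc a (v x) * (q x * a4))
    - 1/2 * (ln_trunc_prim a (v x) * (2 * a2 + 2 * (q x * a7)))
    - 1/2 * (ln_trunc_prim a (v x) * (q x * a8))"
    unfolding J1 J2 dp dq a4' flux_q_divergence_D a2_def[symmetric, unfolded S_def] a7_def[symmetric] by simp
  also have "\<dots> = c x * ln_trunc' a (v x) * (1/2 * q x * (norm (w x))\<^sup>2 - p x * (w x \<bullet> h x))
    - ln_trunc_prim a (v x) * q x * (1/2 * a8 + a7) - p x * ln_trunc a (v x) * a6"
    unfolding ln_trunc_conj_def by (simp add: algebra_simps)
  finally show ?thesis unfolding a6_def a7_def a8_def B_def drift_op_def .
qed

lemma divergence_test_field_ge:
  assumes c: "C2_scalar c" and c0: "0 \<le> c x" "c x \<le> 1"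
  shows "1/4 * (c x * (ln_trunc' a (v x) * (norm (w x))\<^sup>2 * q x)) - trunc a (v x) * (norm (h x))\<^sup>2 * q x
    - (ln_trunc_prim a (v x) * q x * drift_op c x + p x * ln_trunc a (v x) * (grad c x \<bullet> (g x *v h x)))
    \<le> (\<Sum>j\<in>UNIV. pdiff j (test_field a c j) x)"
proof -
  define k where "k = ln_trunc' a (v x)"
  have k: "0 < k" unfolding k_def by (rule ln_trunc'_pos[OF a v_pos])
  have q0: "0 < q x" by (rule q_pos)
  \<comment> \<open>Half of the coefficient 1/2 of the quadratic form is given up to absorb the
    noise drift; the remaining 1/4 becomes the factor 4 of the energy estimate.\<close>
  have "v x * (w x \<bullet> h x) \<le> 1/4 * (norm (w x))\<^sup>2 + (v x)\<^sup>2 * (norm (h x))\<^sup>2"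
  proof -
    have "w x \<bullet> h x \<le> norm (w x) * norm (h x)" by (rule norm_cauchy_schwarz)
    then have "v x * (w x \<bullet> h x) \<le> v x * (norm (w x) * norm (h x))" using v_pos[of x] by (intro mult_left_mono) auto
    also have "\<dots> \<le> 1/4 * (norm (w x))\<^sup>2 + (v x)\<^sup>2 * (norm (h x))\<^sup>2"
      using zero_le_power2[of "norm (w x) / 2 - v x * norm (h x)"] by (simp add: power2_eq_square algebra_simps)
    finally show ?thesis .
  qed
  then have le1: "c x * k * q x * (v x * (w x \<bullet> h x)) \<le> c x * k * q x * (1/4 * (norm (w x))\<^sup>2 + (v x)\<^sup>2 * (norm (h x))\<^sup>2)"
    using c0 k q0 by (intro mult_left_mono) auto
  have le2: "c x * (k * (v x)\<^sup>2) * ((norm (h x))\<^sup>2 * q x) \<le> 1 * trunc a (v x) * ((norm (h x))\<^sup>2 * q x)"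
  proof (rule mult_right_mono)
    have kv: "0 \<le> k * (v x)\<^sup>2" "k * (v x)\<^sup>2 \<le> trunc a (v x)"
      using k ln_trunc'_mult_square_le[OF a v_pos, of x] by (simp_all add: k_def)
    then have "c x * (k * (v x)\<^sup>2) \<le> 1 * (k * (v x)\<^sup>2)" using c0 by (intro mult_right_mono)
    then show "c x * (k * (v x)\<^sup>2) \<le> 1 * trunc a (v x)" using kv by linarith
  qed (use q0 in simp)
  have main: "c x * k * (p x * (w x \<bullet> h x)) \<le> 1/4 * (c x * (k * (norm (w x))\<^sup>2 * q x)) + trunc a (v x) * (norm (h x))\<^sup>2 * q x"
  proof -
    have "c x * k * (p x * (w x \<bullet> h x)) = c x * k * q x * (v x * (w x \<bullet> h x))" by (simp add: p_eq)
    moreover have "c x * k * q x * (1/4 * (norm (w x))\<^sup>2 + (v x)\<^sup>2 * (norm (h x))\<^sup>2)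
      = 1/4 * (c x * (k * (norm (w x))\<^sup>2 * q x)) + c x * (k * (v x)\<^sup>2) * ((norm (h x))\<^sup>2 * q x)"
      by (simp add: distrib_left)
    ultimately show ?thesis using le1 le2 by linarith
  qed
  have g: "(\<Sum>j\<in>UNIV. pdiff j c x * (g x *v h x) $ j) = grad c x \<bullet> (g x *v h x)" by (simp add: inner_vec_def)
  have "c x * k * (1/2 * q x * (norm (w x))\<^sup>2 - p x * (w x \<bullet> h x))
    = 1/2 * (c x * (k * (norm (w x))\<^sup>2 * q x)) - c x * k * (p x * (w x \<bullet> h x))" by (simp add: right_diff_distrib)
  then show ?thesis unfolding divergence_test_field[OF c] g k_def[symmetric] using main by linarith
qed

end

section \<open>Boundary terms and removal of the cutoff\<close>

lemma drift_op_eq: "drift_op c x = 1/2 * (\<Sum>j\<in>UNIV. \<Sum>k\<in>UNIV. D x $ j $ k * pdiff j (pdiff k c) x) + f x \<bullet> grad c x"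
  by (simp add: drift_op_def inner_vec_def)

lemma drift_op_cutoff_bounded:
  obtains C where "0 \<le> C" "\<And>n x. \<bar>drift_op (cutoff (real (Suc n))) x\<bar> \<le> C"
proof -
  obtain Cf where Cf: "0 \<le> Cf" "\<And>n x. \<bar>f x \<bullet> grad (cutoff (real (Suc n))) x\<bar> \<le> Cf"
    using inner_grad_cutoff_bounded[OF f_Lip] by blast
  obtain Cg where Cg: "0 \<le> Cg" "\<And>x. norm (g x) \<le> Cg * (1 + norm x)" using linear_growth[OF g_Lip] by blast
  \<comment> \<open>Linear growth of \<open>g\<close> gives quadratic growth of \<open>D\<close>,
    which the weighted bound on the second derivatives of the cutoff compensates.\<close>
  have D: "\<bar>D x $ j $ k\<bar> \<le> 2 * Cg\<^sup>2 * (1 + (norm x)\<^sup>2)" for x j k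
  proof -
    have "D x $ j $ k = g x $ j \<bullet> g x $ k" by (simp add: diffusion_nth inner_vec_def)
    then have "\<bar>D x $ j $ k\<bar> \<le> norm (g x $ j) * norm (g x $ k)" by (simp add: Cauchy_Schwarz_ineq2)
    also have "\<dots> \<le> norm (g x) * norm (g x)" by (intro mult_mono Finite_Cartesian_Product.norm_nth_le) auto
    also have "\<dots> \<le> (Cg * (1 + norm x)) * (Cg * (1 + norm x))" using Cg by (intro mult_mono) auto
    also have "\<dots> = Cg\<^sup>2 * (1 + norm x)\<^sup>2" by (simp add: power2_eq_square)
    also have "\<dots> \<le> Cg\<^sup>2 * (2 * (1 + (norm x)\<^sup>2))"
      using zero_le_power2[of "1 - norm x"] by (intro mult_left_mono) (auto simp: power2_eq_square algebra_simps)
    finally show ?thesis by (simp only: mult_ac)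
  qed
  define N where "N = real (card (UNIV :: 'n set))"
  show thesis
  proof (rule that[of "N * (N * (2 * Cg\<^sup>2 * 60)) + Cf"])
    show "0 \<le> N * (N * (2 * Cg\<^sup>2 * 60)) + Cf" using Cf(1) by (simp add: N_def)
    fix n and x :: "real^'n"
    let ?c = "cutoff (real (Suc n)) :: real^'n \<Rightarrow> real"
    have R: "1 \<le> real (Suc n)" by simp
    have "\<bar>D x $ j $ k * pdiff j (pdiff k ?c) x\<bar> \<le> 2 * Cg\<^sup>2 * 60" for j k
    proof -
      have "\<bar>D x $ j $ k * pdiff j (pdiff k ?c) x\<bar> \<le> 2 * Cg\<^sup>2 * (1 + (norm x)\<^sup>2) * \<bar>pdiff j (pdiff k ?c) x\<bar>"
        unfolding abs_mult by (intro mult_right_mono D) auto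
      also have "\<dots> = 2 * Cg\<^sup>2 * (\<bar>pdiff j (pdiff k ?c) x\<bar> * (1 + (norm x)\<^sup>2))" by simp
      also have "\<dots> \<le> 2 * Cg\<^sup>2 * 60" using pdiff2_cutoff_bounds(1)[OF R] by (intro mult_left_mono) auto
      finally show ?thesis .
    qed
    then have row: "\<bar>\<Sum>k\<in>UNIV. D x $ j $ k * pdiff j (pdiff k ?c) x\<bar> \<le> (\<Sum>k\<in>(UNIV::'n set). 2 * Cg\<^sup>2 * 60)" for j
      by (intro order_trans[OF sum_abs] sum_mono)
    have "\<bar>\<Sum>j\<in>UNIV. \<Sum>k\<in>UNIV. D x $ j $ k * pdiff j (pdiff k ?c) x\<bar> \<le> (\<Sum>j\<in>(UNIV::'n set). \<Sum>k\<in>(UNIV::'n set). 2 * Cg\<^sup>2 * 60)"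
      by (rule order_trans[OF sum_abs sum_mono], rule row)
    then have "\<bar>\<Sum>j\<in>UNIV. \<Sum>k\<in>UNIV. D x $ j $ k * pdiff j (pdiff k ?c) x\<bar> \<le> N * (N * (2 * Cg\<^sup>2 * 60))"
      by (simp add: N_def)
    then show "\<bar>drift_op ?c x\<bar> \<le> N * (N * (2 * Cg\<^sup>2 * 60)) + Cf"
      unfolding drift_op_eq using Cf(2)[of x n] by linarith
  qed
qed

lemma drift_op_cutoff_tendsto: "(\<lambda>n. drift_op (cutoff (real (Suc n))) x) \<longlonglongrightarrow> 0"
proof -
  have "(\<lambda>n. drift_op (cutoff (real (Suc n))) x) \<longlonglongrightarrow>
    1/2 * (\<Sum>j\<in>UNIV. \<Sum>k\<in>UNIV. D x $ j $ k * 0) + f x \<bullet> 0"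
    unfolding drift_op_eq by (intro tendsto_intros pdiff2_cutoff_tendsto grad_cutoff_tendsto)
  then show ?thesis by simp
qed

text \<open>As a product of two Lipschitz maps, g h could grow quadratically. It is, however, the
  difference of the perturbed and the nominal drift, both Lipschitz, and so grows linearly.\<close>

lemma gh_inner_cutoff_bounded:
  obtains C where "0 \<le> C" "\<And>n x. \<bar>grad (cutoff (real (Suc n))) x \<bullet> (g x *v h x)\<bar> \<le> C"
proof -
  obtain C1 where C1: "0 \<le> C1" "\<And>n x. \<bar>f x \<bullet> grad (cutoff (real (Suc n))) x\<bar> \<le> C1"
    using inner_grad_cutoff_bounded[OF f_Lip] by blast
  obtain C2 where C2: "0 \<le> C2" "\<And>n x. \<bar>fh x \<bullet> grad (cutoff (real (Suc n))) x\<bar> \<le> C2"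
    using inner_grad_cutoff_bounded[OF fh_Lip] by blast
  show thesis
  proof (rule that[of "C1 + C2"])
    fix n and x :: "real^'n"
    have "grad (cutoff (real (Suc n))) x \<bullet> (g x *v h x) = fh x \<bullet> grad (cutoff (real (Suc n))) x - f x \<bullet> grad (cutoff (real (Suc n))) x"
      by (subst inner_commute) (simp add: inner_left_distrib)
    then show "\<bar>grad (cutoff (real (Suc n))) x \<bullet> (g x *v h x)\<bar> \<le> C1 + C2" using C1(2)[of x n] C2(2)[of x n] by linarith
  qed (use C1 C2 in simp)
qed

lemma pq_cont: "continuous_on UNIV p" "continuous_on UNIV q"
  using C1_fun_continuous C2_scalarD(1) p_C2 q_C2 by blast+

lemmas p_int = steady_integral[OF p] and q_int = steady_integral[OF q]

lemma h_cont: "continuous_on UNIV h" by (rule C1_fun_continuous[OF h])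

lemma v_cont: "continuous_on UNIV v" by (rule C1_fun_continuous[OF v_C1])

lemma gh_cont: "continuous_on UNIV (\<lambda>x. g x *v h x)"
  unfolding matrix_vector_mult_def
  by (intro continuous_on_vec_lambda continuous_on_sum continuous_on_mult)
    (auto intro!: C1_fun_continuous C2_scalarD(1) g_C2 h_C1)

lemma drift_op_cont:
  assumes "C2_scalar c" shows "continuous_on UNIV (drift_op c)"
  unfolding drift_op_def[abs_def]
  by (intro continuous_on_add continuous_on_mult continuous_on_sum continuous_on_const)
    (auto intro!: C1_fun_continuous C2_scalarD(1) D_C2 f_C1 C1_fun_pdiff_continuous C2_scalarD(2)[OF assms] C2_scalarD(1)[OF assms])

theorem energy_estimate:
  assumes a: "0 < a" "a < 1" and hi: "integrable lborel (\<lambda>x. (norm (h x))\<^sup>2 * q x)"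
  shows "integrable lborel (\<lambda>x. ln_trunc' a (v x) * (norm (w x))\<^sup>2 * q x)"
    and "(LBINT x. ln_trunc' a (v x) * (norm (w x))\<^sup>2 * q x) \<le> 4 * (LBINT x. trunc a (v x) * (norm (h x))\<^sup>2 * q x)"
proof -
  define c :: "nat \<Rightarrow> real^'n \<Rightarrow> real" where "c n = cutoff (real (Suc n))" for n
  have R: "0 < real (Suc n)" for n by simp
  have c2: "C2_scalar (c n)" for n unfolding c_def by (rule C2_scalar_cutoff[OF R])
  have c0: "0 \<le> c n x" "c n x \<le> 1" for n x unfolding c_def by (rule cutoff_bounds)+
  have csupp: "c n x = 0" if "real (Suc n) \<le> norm x" for n x unfolding c_def by (rule cutoff_eq_0[OF R that])
  have pcsupp: "pdiff j (c n) x = 0" if "real (Suc n) \<le> norm x" for n x j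
    by (rule pdiff_outside_support[OF csupp C2_scalarD(1)[OF c2] that])
  have pcsupp2: "pdiff j (pdiff k (c n)) x = 0" if "real (Suc n) \<le> norm x" for n x j k
    by (rule pdiff_outside_support[OF pcsupp C2_scalarD(2)[OF c2] that])
  have dsupp: "drift_op (c n) x = 0" "grad (c n) x = 0" if "real (Suc n) \<le> norm x" for n x
    using pcsupp[OF that] pcsupp2[OF that] by (simp_all add: drift_op_def vec_eq_iff)
  define e where "e x = ln_trunc' a (v x) * (norm (w x))\<^sup>2 * q x" for x
  have e0: "0 \<le> e x" for x unfolding e_def using ln_trunc'_pos[OF a v_pos, of x] q_pos[of x] by simp
  define T where "T x = trunc a (v x) * (norm (h x))\<^sup>2 * q x" for x
  define r where "r n x = ln_trunc_prim a (v x) * q x * drift_op (c n) x + p x * ln_trunc a (v x) * (grad (c n) x \<bullet> (g x *v h x))" for n x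
  have cont_lt: "continuous_on UNIV (\<lambda>x. ln_trunc a (v x))" "continuous_on UNIV (\<lambda>x. ln_trunc_prim a (v x))"
    by (rule C1_fun_continuous[OF C1_ln_trunc_v[OF a]] C1_fun_continuous[OF C1_ln_trunc_prim_v[OF a]])+
  have den: "v x + a \<noteq> 0" "1 + a * v x \<noteq> 0" for x using trunc_pos[OF a v_pos, of x] by auto
  have cont_l': "continuous_on UNIV (\<lambda>x. ln_trunc' a (v x))" "continuous_on UNIV (\<lambda>x. trunc a (v x))"
    unfolding ln_trunc'_def trunc_def using den by (auto intro!: continuous_intros v_cont)
  have e_cont: "continuous_on UNIV e" unfolding e_def by (intro continuous_intros cont_l' w_cont pq_cont)
  have cc: "continuous_on UNIV (c n)" for n by (rule C1_fun_continuous[OF C2_scalarD(1)[OF c2]])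
  have gc: "continuous_on UNIV (grad (c n))" for n by (rule C1_fun_grad_continuous[OF C2_scalarD(1)[OF c2]])
  have r_cont: "continuous_on UNIV (r n)" for n
    unfolding r_def by (intro continuous_intros cont_lt pq_cont drift_op_cont c2 gc gh_cont)
  have ie: "integrable lborel (\<lambda>x. c n x * e x)" for n
    by (rule integrable_compact_support[of _ "real (Suc n)"]) (auto intro!: continuous_intros cc e_cont simp: csupp)
  have ir: "integrable lborel (r n)" for n
    by (rule integrable_compact_support[OF r_cont, of "real (Suc n)"]) (simp add: r_def dsupp)
  have iT: "integrable lborel T"
  proof -
    have m: "(\<lambda>x. trunc a (v x)) \<in> borel_measurable lborel" using borel_measurable_continuous_onI[OF cont_l'(2)] by simp
    have "integrable lborel (\<lambda>x. trunc a (v x) * ((norm (h x))\<^sup>2 * q x))"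
      by (rule integrable_mult_bounded[OF hi m, of "1 / a"]) (use trunc_bounds(2,4)[OF a v_pos] in \<open>simp add: abs_of_pos\<close>)
    then show ?thesis unfolding T_def[abs_def] by (simp add: mult.assoc)
  qed
  \<comment> \<open>The divergence of the compactly supported test field integrates to zero, so its
    pointwise lower bound has a nonpositive integral.\<close>
  have le: "(LBINT x. c n x * e x) \<le> 4 * ((LBINT x. T x) + (LBINT x. r n x))" for n
  proof -
    have C1t: "C1_fun (test_field a (c n) j)" for j by (rule test_field_C1[OF a c2])
    have supp: "test_field a (c n) j x = 0" if "real (Suc n) \<le> norm x" for j x
      using csupp[OF that] pcsupp[OF that] by (simp add: test_field_def)
    have ip: "integrable lborel (pdiff j (test_field a (c n) j))" for j
      by (rule integrable_compact_support[OF C1_fun_pdiff_continuous[OF C1t] pdiff_outside_support[OF supp C1t]])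
    have "(LBINT x. (1/4 * (c n x * e x) - T x - r n x)) \<le> (LBINT x. ((\<Sum>j\<in>UNIV. pdiff j (test_field a (c n) j) x)))"
    proof (rule integral_mono)
      show "1/4 * (c n x * e x) - T x - r n x \<le> (\<Sum>j\<in>UNIV. pdiff j (test_field a (c n) j) x)" for x
        using divergence_test_field_ge[OF a c2 c0] by (simp add: e_def T_def r_def)
    qed (use ie iT ir ip in auto)
    also have "\<dots> = (\<Sum>j\<in>UNIV. \<integral>x. pdiff j (test_field a (c n) j) x \<partial>lborel)" using ip by (intro Bochner_Integration.integral_sum) auto
    also have "\<dots> = 0" using integral_pdiff_eq_0[OF C1t supp] by simp
    finally show ?thesis using ie iT ir by simp
  qed
  have lim: "(\<lambda>n. \<integral>x. r n x \<partial>lborel) \<longlonglongrightarrow> (\<integral>x. 0 \<partial>(lborel :: (real^'n) measure))"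
  proof -
    obtain C1 where C1: "0 \<le> C1" "\<And>n x. \<bar>drift_op (cutoff (real (Suc n))) x\<bar> \<le> C1" using drift_op_cutoff_bounded by blast
    obtain C2 where C2: "0 \<le> C2" "\<And>n x. \<bar>grad (cutoff (real (Suc n))) x \<bullet> (g x *v h x)\<bar> \<le> C2" using gh_inner_cutoff_bounded by blast
    define l where "l = ln (1 / a)"
    have l: "0 \<le> l" using a by (simp add: l_def)
    show ?thesis
    \<comment> \<open>For fixed \<open>a\<close> the remainder is dominated by multiples of
      \<open>p\<close> and \<open>q\<close>, while the derivatives of the cutoff tend to zero
      pointwise.\<close>
    proof (rule integral_dominated_convergence[where w="\<lambda>x. (l + 1) * C1 * (q x + p x) + l * C2 * p x"])
      show "r n \<in> borel_measurable lborel" for n using borel_measurable_continuous_onI[OF r_cont] by simp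
      show "integrable lborel (\<lambda>x. (l + 1) * C1 * (q x + p x) + l * C2 * p x)" using p_int(1) q_int(1) by simp
      show "AE x in lborel. (\<lambda>n. r n x) \<longlonglongrightarrow> 0"
      proof (rule AE_I2)
        fix x
        have "(\<lambda>n. r n x) \<longlonglongrightarrow> ln_trunc_prim a (v x) * q x * 0 + p x * ln_trunc a (v x) * (0 \<bullet> (g x *v h x))"
          unfolding r_def c_def by (intro tendsto_intros drift_op_cutoff_tendsto grad_cutoff_tendsto)
        then show "(\<lambda>n. r n x) \<longlonglongrightarrow> 0" by simp
      qed
      show "AE x in lborel. norm (r n x) \<le> (l + 1) * C1 * (q x + p x) + l * C2 * p x" for n
      proof (rule AE_I2)
        fix x
        have "\<bar>ln_trunc_prim a (v x) * q x * drift_op (c n) x\<bar> \<le> (l + 1) * (1 + v x) * q x * C1"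
          unfolding abs_mult using ln_trunc_prim_bound[OF a v_pos, of x] C1 v_pos[of x] q_pos[of x] l
          by (intro mult_mono) (auto simp: l_def c_def)
        also have "\<dots> = (l + 1) * C1 * (q x + p x)" by (simp add: p_eq algebra_simps)
        finally have 1: "\<bar>ln_trunc_prim a (v x) * q x * drift_op (c n) x\<bar> \<le> (l + 1) * C1 * (q x + p x)" .
        have "\<bar>p x * ln_trunc a (v x) * (grad (c n) x \<bullet> (g x *v h x))\<bar> \<le> p x * l * C2"
          unfolding abs_mult using ln_trunc_bound[OF a v_pos, of x] C2 p_pos[of x] l
          by (intro mult_mono) (auto simp: l_def c_def)
        also have "\<dots> = l * C2 * p x" by simp
        finally show "norm (r n x) \<le> (l + 1) * C1 * (q x + p x) + l * C2 * p x"
          using 1 unfolding r_def real_norm_def by linarith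
      qed
    qed simp
  qed
  have lim': "(\<lambda>n. 4 * ((LBINT x. T x) + (LBINT x. r n x))) \<longlonglongrightarrow> 4 * ((LBINT x. T x) + 0)"
    using lim by (intro tendsto_intros) simp
  have elim: "(\<lambda>n. c n x * e x) \<longlonglongrightarrow> e x" for x
    using tendsto_mult[OF cutoff_tendsto[of x] tendsto_const[of "e x"]] by (simp add: c_def)
  have ce0: "0 \<le> c n x * e x" for n x using c0 e0 by simp
  show "integrable lborel (\<lambda>x. ln_trunc' a (v x) * (norm (w x))\<^sup>2 * q x)"
    using Fatou_integral(1)[OF ie ce0 elim le lim'] by (simp add: e_def[abs_def])
  show "(LBINT x. ln_trunc' a (v x) * (norm (w x))\<^sup>2 * q x) \<le> 4 * (LBINT x. trunc a (v x) * (norm (h x))\<^sup>2 * q x)"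
    using Fatou_integral(2)[OF ie ce0 elim le lim'] by (simp add: e_def[abs_def] T_def[abs_def])
qed

end

section \<open>The bound for the relative entropy\<close>

text \<open>Adding 1 - t makes the entropy integrand nonnegative, as Fatou requires, without
  changing its integral when both densities have mass one.\<close>

lemma mult_ln_ge: "0 \<le> t * ln t - t + 1" if "0 < t" for t :: real
proof -
  have "ln (1 / t) \<le> 1 / t - 1" using that by (intro ln_le_minus_one) simp
  then have "1 - 1 / t \<le> ln t" using that by (simp add: ln_div)
  then have "t * (1 - 1 / t) \<le> t * ln t" using that by (intro mult_left_mono) auto
  then show ?thesis using that by (simp add: right_diff_distrib)
qed

context steady_pair
begin

lemma entropy_trunc_bound:
  assumes a: "0 < a" "a < 1" and slc: "strongly_log_concave_pdf mu q" and lam: "0 < lam"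
    and ell: "\<And>x z. lam * (norm z)\<^sup>2 \<le> (norm (transpose (g x) *v z))\<^sup>2"
    and K: "K = 1 / (lam * mu)"
    and hi: "integrable lborel (\<lambda>x. (norm (h x))\<^sup>2 * q x)" "integrable lborel (\<lambda>x. exp (\<theta> * (norm (h x))\<^sup>2) * q x)"
    and Z: "Z = (LBINT x. exp (\<theta> * (norm (h x))\<^sup>2) * q x)"
    and \<theta>: "2 * K < \<theta>" "ln Z = (\<theta> - 2 * K) * d"
    and m: "m = (LBINT x. trunc a (v x) * q x)"
  shows "integrable lborel (\<lambda>x. ln_trunc a (v x) * trunc a (v x) * q x)"
    "integrable lborel (\<lambda>x. trunc a (v x) * q x)" "0 < m"
    "(LBINT x. ln_trunc a (v x) * trunc a (v x) * q x) \<le> m * ln m + 2 * K * d * m"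
proof -
  have mu: "0 < mu" using slc by (simp add: strongly_log_concave_pdf_def)
  have K0: "0 < K" using K lam mu by simp
  have q0: "0 \<le> q x" for x using q_pos[of x] by simp
  define \<phi> where "\<phi> x = ln_trunc a (v x)" for x
  have e: "exp (\<phi> x) = trunc a (v x)" for x unfolding \<phi>_def by (rule exp_ln_trunc[OF a v_pos])
  have \<phi>: "C1_fun \<phi>" unfolding \<phi>_def[abs_def] by (rule C1_ln_trunc_v[OF a])
  have \<phi>b: "\<bar>\<phi> x\<bar> \<le> ln (1 / a)" for x unfolding \<phi>_def by (rule ln_trunc_bound[OF a v_pos])
  have eb: "0 < exp (\<phi> x)" "a \<le> exp (\<phi> x)" "exp (\<phi> x) \<le> 1 / a" for x
    unfolding e using trunc_bounds[OF a v_pos, of x] by auto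
  have gr: "grad \<phi> x = ln_trunc' a (v x) *\<^sub>R grad v x" for x
    by (simp add: vec_eq_iff \<phi>_def[abs_def] pdiff_ln_trunc_v[OF a])
  have [measurable]: "\<phi> \<in> borel_measurable borel" "grad \<phi> \<in> borel_measurable borel" "q \<in> borel_measurable borel"
    using C1_fun_continuous[OF \<phi>] C1_fun_grad_continuous[OF \<phi>] pq_cont(2) by (auto intro: borel_measurable_continuous_onI)
  define e' where "e' x = ln_trunc' a (v x) * (norm (w x))\<^sup>2 * q x" for x
  have ee: "integrable lborel e'" "(LBINT x. e' x) \<le> 4 * (LBINT x. (norm (h x))\<^sup>2 * exp (\<phi> x) * q x)"
    using energy_estimate[OF a hi(1)] unfolding e'_def[abs_def] e by (simp_all add: mult.commute[of "trunc a _"])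
  \<comment> \<open>Here ellipticity exchanges the Euclidean gradient for \<open>w\<close>, at the
    cost of 1 / lam.\<close>
  have ge: "(norm (grad \<phi> x))\<^sup>2 * exp (\<phi> x) * q x \<le> 1 / lam * e' x" for x
  proof -
    have l: "0 < ln_trunc' a (v x)" by (rule ln_trunc'_pos[OF a v_pos])
    have "(norm (grad \<phi> x))\<^sup>2 * exp (\<phi> x) = ((ln_trunc' a (v x))\<^sup>2 * trunc a (v x)) * (norm (grad v x))\<^sup>2"
      unfolding gr e by (simp add: power_mult_distrib)
    also have "\<dots> \<le> ln_trunc' a (v x) * (norm (grad v x))\<^sup>2"
      by (intro mult_right_mono ln_trunc'_square_le[OF a v_pos]) simp
    also have "\<dots> \<le> ln_trunc' a (v x) * (1 / lam * (norm (w x))\<^sup>2)"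
      using l ell[of "grad v x" x] lam by (intro mult_left_mono) (auto simp: w_def field_simps)
    finally have "(norm (grad \<phi> x))\<^sup>2 * exp (\<phi> x) * q x \<le> ln_trunc' a (v x) * (1 / lam * (norm (w x))\<^sup>2) * q x"
      using q0 by (rule mult_right_mono)
    then show ?thesis by (simp add: e'_def mult_ac)
  qed
  have ig: "integrable lborel (\<lambda>x. (norm (grad \<phi> x))\<^sup>2 * exp (\<phi> x) * q x)"
  proof (rule Bochner_Integration.integrable_bound[of _ "\<lambda>x. 1 / lam * e' x"])
    show "AE x in lborel. norm ((norm (grad \<phi> x))\<^sup>2 * exp (\<phi> x) * q x) \<le> norm (1 / lam * e' x)"
    proof (rule AE_I2)
      fix x
      have "norm ((norm (grad \<phi> x))\<^sup>2 * exp (\<phi> x) * q x) = (norm (grad \<phi> x))\<^sup>2 * exp (\<phi> x) * q x" using q0 by simp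
      also have "\<dots> \<le> norm (1 / lam * e' x)" using ge[of x] abs_ge_self[of "1 / lam * e' x"] by (simp only: real_norm_def)
      finally show "norm ((norm (grad \<phi> x))\<^sup>2 * exp (\<phi> x) * q x) \<le> norm (1 / lam * e' x)" .
    qed
  qed (use ee in auto)
  have gi: "integrable lborel (\<lambda>x. (norm (grad \<phi> x))\<^sup>2 * q x)"
  proof (rule Bochner_Integration.integrable_bound[of _ "\<lambda>x. 1 / a * ((norm (grad \<phi> x))\<^sup>2 * exp (\<phi> x) * q x)"])
    show "AE x in lborel. norm ((norm (grad \<phi> x))\<^sup>2 * q x) \<le> norm (1 / a * ((norm (grad \<phi> x))\<^sup>2 * exp (\<phi> x) * q x))"
    proof (rule AE_I2)
      fix x
      have "a * ((norm (grad \<phi> x))\<^sup>2 * q x) \<le> exp (\<phi> x) * ((norm (grad \<phi> x))\<^sup>2 * q x)"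
        using eb q0 by (intro mult_right_mono) auto
      then have "(norm (grad \<phi> x))\<^sup>2 * q x \<le> 1 / a * ((norm (grad \<phi> x))\<^sup>2 * exp (\<phi> x) * q x)"
        using a by (simp add: pos_le_divide_eq mult_ac)
      then show "norm ((norm (grad \<phi> x))\<^sup>2 * q x) \<le> norm (1 / a * ((norm (grad \<phi> x))\<^sup>2 * exp (\<phi> x) * q x))"
        using q0[of x] a(1) by (auto intro: order_trans[OF _ abs_ge_self])
    qed
  qed (use ig in auto)
  have i1: "integrable lborel (\<lambda>x. exp (\<phi> x) * q x)"
    by (rule integrable_mult_bounded[OF q_int(1), of _ "1/a"]) (use eb in auto)
  have i2: "integrable lborel (\<lambda>x. \<phi> x * (exp (\<phi> x) * q x))"
    by (rule integrable_mult_bounded[OF i1 _ \<phi>b]) measurable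
  have i2': "integrable lborel (\<lambda>x. \<phi> x * exp (\<phi> x) * q x)" using i2 by (simp add: mult.assoc)
  have ih: "integrable lborel (\<lambda>x. exp (\<phi> x) * ((norm (h x))\<^sup>2 * q x))"
    by (rule integrable_mult_bounded[OF hi(1), of _ "1/a"]) (use eb in auto)
  have ih': "integrable lborel (\<lambda>x. \<theta> * (norm (h x))\<^sup>2 * exp (\<phi> x) * q x)"
    using integrable_mult_right[OF ih, of \<theta>] by (simp add: mult_ac)
  have m': "m = (LBINT x. exp (\<phi> x) * q x)" unfolding m e ..
  have m0: "0 < m" unfolding m' by (rule integral_pos_weight[OF i1 _ q_pos]) simp
  have Z0: "0 < Z" unfolding Z by (rule integral_pos_weight[OF hi(2) _ q_pos]) simp
  define X where "X = (LBINT x. (norm (h x))\<^sup>2 * exp (\<phi> x) * q x)"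
  define En where "En = (LBINT x. \<phi> x * exp (\<phi> x) * q x) - m * ln m"
  have "2 * mu * En \<le> (LBINT x. (norm (grad \<phi> x))\<^sup>2 * exp (\<phi> x) * q x)"
    unfolding En_def by (rule log_Sobolev[OF slc \<phi> \<phi>b gi m'])
  also have "\<dots> \<le> (LBINT x. 1 / lam * e' x)"
    by (intro integral_mono ig ge integrable_mult_right ee)
  also have "\<dots> \<le> 1 / lam * (4 * X)"
    using ee(2) lam by (simp add: X_def divide_right_mono)
  finally have "2 * mu * En \<le> 1 / lam * (4 * X)" .
  then have E1: "En \<le> 2 * K * X" unfolding K using mu lam by (simp add: field_simps)
  have "(LBINT x. \<theta> * (norm (h x))\<^sup>2 * exp (\<phi> x) * q x) \<le> En + m * ln Z"
    unfolding En_def by (rule Donsker_Varadhan[OF q0 ih' i2' i1 hi(2) m' m0 Z Z0])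
  also have "(LBINT x. \<theta> * (norm (h x))\<^sup>2 * exp (\<phi> x) * q x) = \<theta> * X"
    using integral_mult_right_zero[of lborel \<theta> "\<lambda>x. (norm (h x))\<^sup>2 * exp (\<phi> x) * q x"] by (simp add: X_def mult.assoc)
  finally have E2: "\<theta> * X \<le> En + m * ln Z" .
  \<comment> \<open>The two estimates bound the entropy and the mean of |h|^2 by each other.
    Eliminating the latter leaves the entropy with the coefficient \<theta> - 2 K, whose positivity
    closes the argument.\<close>
  have "\<theta> * En \<le> 2 * K * (\<theta> * X)"
    using mult_left_mono[OF E1, of \<theta>] \<theta>(1) K0 by (simp add: mult_ac)
  also have "\<dots> \<le> 2 * K * (En + m * ln Z)" using E2 K0 by (intro mult_left_mono) auto
  finally have "(\<theta> - 2 * K) * En \<le> (\<theta> - 2 * K) * (2 * K * d * m)" unfolding \<theta>(2) by (simp add: algebra_simps)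
  then have "En \<le> 2 * K * d * m" using \<theta>(1) by simp
  then show "(LBINT x. ln_trunc a (v x) * trunc a (v x) * q x) \<le> m * ln m + 2 * K * d * m"
    unfolding En_def e unfolding \<phi>_def by linarith
  show "integrable lborel (\<lambda>x. ln_trunc a (v x) * trunc a (v x) * q x)" using i2' unfolding e unfolding \<phi>_def .
  show "integrable lborel (\<lambda>x. trunc a (v x) * q x)" using i1 by (simp add: e)
  show "0 < m" by (rule m0)
qed

theorem relative_entropy_bound:
  assumes slc: "strongly_log_concave_pdf mu q" and lam: "0 < lam"
    and ell: "\<And>x z. lam * (norm z)\<^sup>2 \<le> (norm (transpose (g x) *v z))\<^sup>2"
    and K: "K = 1 / (lam * mu)"
    and hi: "integrable lborel (\<lambda>x. (norm (h x))\<^sup>2 * q x)" "integrable lborel (\<lambda>x. exp (\<theta> * (norm (h x))\<^sup>2) * q x)"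
    and \<theta>: "2 * K < \<theta>" "ln (LBINT x. exp (\<theta> * (norm (h x))\<^sup>2) * q x) = (\<theta> - 2 * K) * d"
  shows "integrable lborel (\<lambda>x. p x * ln (p x / q x))" "(LBINT x. p x * ln (p x / q x)) \<le> 2 * K * d"
proof -
  \<comment> \<open>Two successors, so that the parameter is strictly below 1 already for n =
    0.\<close>
  define a where "a n = inverse (real (Suc (Suc n)))" for n
  have a: "0 < a n" "a n < 1" for n by (auto simp: a_def field_simps)
  have a0: "a \<longlonglongrightarrow> 0" unfolding a_def using LIMSEQ_Suc[OF LIMSEQ_inverse_real_of_nat] .
  define m where "m n = (LBINT x. trunc (a n) (v x) * q x)" for n
  note B = entropy_trunc_bound[OF a slc lam ell K hi refl \<theta> m_def]
  define T where "T n x = trunc (a n) (v x)" for n x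
  have T0: "0 < T n x" for n x unfolding T_def by (rule trunc_bounds(4)[OF a v_pos])
  have lT: "ln_trunc (a n) (v x) = ln (T n x)" for n x
    unfolding T_def using exp_ln_trunc[OF a v_pos] by (metis ln_exp)
  have Tlim: "(\<lambda>n. T n x) \<longlonglongrightarrow> v x" for x
  proof -
    have "(\<lambda>n. (v x + a n) / (1 + a n * v x)) \<longlonglongrightarrow> (v x + 0) / (1 + 0 * v x)" by (intro tendsto_intros a0) auto
    then show ?thesis by (simp add: T_def trunc_def)
  qed
  have iT: "integrable lborel (\<lambda>x. T n x * q x)" and iTl: "integrable lborel (\<lambda>x. ln (T n x) * T n x * q x)" for n
    using B(1,2)[of n] by (simp_all add: T_def[symmetric] lT)
  have mlim: "m \<longlonglongrightarrow> 1"
  proof -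
    have "(\<lambda>n. \<integral>x. T n x * q x \<partial>lborel) \<longlonglongrightarrow> (LBINT x. v x * q x)"
    proof (rule integral_dominated_convergence[where w="\<lambda>x. p x + q x"])
      show "(\<lambda>x. v x * q x) \<in> borel_measurable lborel" using p_int(1) by (simp add: p_eq[symmetric])
      show "(\<lambda>x. T n x * q x) \<in> borel_measurable lborel" for n using iT by auto
      show "integrable lborel (\<lambda>x. p x + q x)" using p_int(1) q_int(1) by simp
      show "AE x in lborel. (\<lambda>n. T n x * q x) \<longlonglongrightarrow> v x * q x" by (intro AE_I2 tendsto_intros Tlim)
      show "AE x in lborel. norm (T n x * q x) \<le> p x + q x" for n
      proof (rule AE_I2)
        fix x
        have "T n x * q x \<le> (v x + 1) * q x"
          unfolding T_def using trunc_bounds(3)[OF a v_pos] q_pos[of x] by (intro mult_right_mono) auto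
        then show "norm (T n x * q x) \<le> p x + q x" using T0[of n x] q_pos[of x] by (simp add: p_eq distrib_right)
      qed
    qed
    then show ?thesis using p_int(2) by (simp add: p_eq[symmetric] m_def[abs_def] T_def)
  qed
  define F where "F n x = (T n x * ln (T n x) - T n x + 1) * q x" for n x
  have Feq: "F n x = ln (T n x) * T n x * q x - T n x * q x + q x" for n x by (simp add: F_def algebra_simps)
  define G where "G x = p x * ln (p x / q x) - p x + q x" for x
  have iF: "integrable lborel (F n)" for n unfolding Feq[abs_def] using iT iTl q_int(1) by simp
  have F0: "0 \<le> F n x" for n x unfolding F_def using mult_ln_ge[OF T0] q_pos[of x] by simp
  have Flim: "(\<lambda>n. F n x) \<longlonglongrightarrow> G x" for x
  proof -
    have "(\<lambda>n. F n x) \<longlonglongrightarrow> (v x * ln (v x) - v x + 1) * q x"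
      unfolding F_def using v_pos[of x] by (intro tendsto_intros Tlim) auto
    then show ?thesis unfolding G_def v_def[symmetric] by (simp add: p_eq algebra_simps)
  qed
  have Fle: "(LBINT x. F n x) \<le> m n * ln (m n) + 2 * K * d * m n - m n + 1" for n
  proof -
    have "(LBINT x. F n x) = (LBINT x. ln (T n x) * T n x * q x) - m n + 1"
      unfolding Feq using iT iTl q_int by (simp add: m_def T_def[symmetric])
    then show ?thesis using B(4)[of n] by (simp add: T_def[symmetric] lT)
  qed
  have clim: "(\<lambda>n. m n * ln (m n) + 2 * K * d * m n - m n + 1) \<longlonglongrightarrow> 1 * ln 1 + 2 * K * d * 1 - 1 + 1"
    by (intro tendsto_intros mlim) simp
  note G = Fatou_integral[OF iF F0 Flim Fle clim]
  \<comment> \<open>\<open>G\<close> differs from the entropy integrand by q - p, whose integral is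
    zero, so both have the same integral.\<close>
  have eq: "(\<lambda>x. p x * ln (p x / q x)) = (\<lambda>x. G x + p x - q x)" by (simp add: G_def)
  show "integrable lborel (\<lambda>x. p x * ln (p x / q x))" unfolding eq using G(1) p_int(1) q_int(1) by simp
  have "(LBINT x. p x * ln (p x / q x)) = (LBINT x. G x)"
    unfolding eq using G(1) p_int q_int by simp
  then show "(LBINT x. p x * ln (p x / q x)) \<le> 2 * K * d" using G(2) by simp
qed

end

lemma rel_entropy_eq_integral:
  assumes "integrable lborel (\<lambda>x. p x * ln (p x / q x))"
  shows "rel_entropy p q = ereal (LBINT x. p x * ln (p x / q x))"
proof -
  have fin: "(\<integral>\<^sup>+x. ennreal (p x * ln (p x / q x)) \<partial>lborel) < top" "(\<integral>\<^sup>+x. ennreal (- (p x * ln (p x / q x))) \<partial>lborel) < top"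
    using assms unfolding real_integrable_def by (auto simp: less_top)
  have "enn2ereal y = ereal (enn2real y)" if "y < top" for y
    using that by (cases y) (auto simp: enn2ereal_ennreal)
  then show ?thesis unfolding rel_entropy_def real_lebesgue_integral_def[OF assms] using fin by simp
qed

lemma strongly_log_concave_pdfI:
  fixes q :: "real^'n \<Rightarrow> real"
  assumes q: "steady_pdf f g q" and pos: "\<And>x. 0 < q x" and mu: "0 < mu"
    and bdd: "bdd_above (range (\<lambda>x. lambda_max (hessian (\<lambda>y. ln (q y)) x)))"
    and mu_eq: "mu = - (SUP x. lambda_max (hessian (\<lambda>y. ln (q y)) x))"
  shows "strongly_log_concave_pdf mu q"
proof -
  have C2: "C2_scalar q" using q by (auto simp: steady_pdf_def C2_pdf_def intro: C2_fun_imp_C2_scalar)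
  have ln2: "C2_scalar (\<lambda>y. ln (q y))"
  proof (rule C2_scalar_compose[OF C2, where f=ln and f'="\<lambda>y. 1 / y" and f''="\<lambda>y. - 1 / y\<^sup>2"])
    fix x
    show "(ln has_real_derivative 1 / q x) (at (q x))" using pos[of x] by (rule DERIV_ln_divide)
    show "((\<lambda>y. 1 / y) has_real_derivative - 1 / (q x)\<^sup>2) (at (q x))"
      using pos[of x] by (auto intro!: derivative_eq_intros simp: power2_eq_square)
    show "isCont (\<lambda>y. - 1 / y\<^sup>2) (q x)" using pos[of x] by (intro continuous_intros) simp
  qed
  show ?thesis unfolding strongly_log_concave_pdf_def
    using mu pos steady_integral[OF q] C1_fun_continuous[OF C2_scalarD(1)[OF C2]]
      strongly_concave[OF ln2 hessian_quadratic_le[OF ln2 bdd mu_eq]] by blast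
qed

theorem theorem6:
  fixes f fh :: "real^'n \<Rightarrow> real^'n"
    and g :: "real^'n \<Rightarrow> real^'m^'n"
    and h :: "real^'n \<Rightarrow> real^'m"
    and p ps :: "real^'n \<Rightarrow> real"
    and lam mu K thK :: real
  assumes fh_def: "fh = (\<lambda>x. f x + g x *v h x)"
    and "C1_fun f" and "C2_fun g" and "C1_fun h"
    and "\<exists>L. L-lipschitz_on UNIV f" and "\<exists>L. L-lipschitz_on UNIV g"
    and "\<exists>L. L-lipschitz_on UNIV h" and "\<exists>L. L-lipschitz_on UNIV fh"
    and "unique_steady_pdf fh g p" and "\<forall>x. 0 < p x"
    and "unique_steady_pdf f g ps" and "\<forall>x. 0 < ps x"
    and "lam = (INF x. lambda_min (diffusion g x))" and "0 < lam"
    and "bdd_above (range (\<lambda>x. lambda_max (hessian (\<lambda>y. ln (ps y)) x)))"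
    and "mu = - (SUP x. lambda_max (hessian (\<lambda>y. ln (ps y)) x))" and "0 < mu"
    and "\<not> (\<exists>c. \<forall>x. norm (h x) = c)"
    and "0 < theta_star ps h"
    and "K = 1 / (lam * mu)"
    and "is_root ps h K thK"
  shows "(\<forall>\<theta>. is_root ps h K \<theta> \<longrightarrow> \<theta> = thK)
    \<and> rel_entropy p ps \<le> ereal (nu ps h thK)
    \<and> nu ps h thK = 2 * K * deriv (Psi ps h) thK"
proof -
  interpret S: steady_pair f g h p ps
    using assms(2-6,8-12) by unfold_locales (auto simp: fh_def unique_steady_pdf_def)
  interpret E: exponential_moments ps h
    using S.pq_cont(2) S.q_pos S.q_int S.h_cont assms(18) by unfold_locales auto
  have K: "0 < K" using assms(14,17,20) by simp
  note root = E.root_gt[OF K assms(21)]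
  have slc: "strongly_log_concave_pdf mu ps"
    by (rule strongly_log_concave_pdfI[OF S.q S.q_pos assms(17,15,16)])
  \<comment> \<open>The first moment at exponent 0, available because some positive exponential
    moment is finite.\<close>
  have hi: "integrable lborel (\<lambda>x. (norm (h x))\<^sup>2 * ps x)"
    using E.moments(2)[of 0] assms(19) by (simp add: zero_ereal_def)
  have ln_mgf: "ln (LBINT x. exp (thK * (norm (h x))\<^sup>2) * ps x) = (thK - 2 * K) * deriv (Psi ps h) thK"
    using root(3) unfolding E.Psi_eq E.mgf_def .
  note entropy = S.relative_entropy_bound[OF slc assms(14) diffusion_elliptic[OF assms(13)] assms(20) hi E.moments(1)[OF root(2)]
      root(1) ln_mgf]
  have nu: "nu ps h thK = 2 * K * deriv (Psi ps h) thK"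
    using root(3) by (simp add: nu_def algebra_simps)
  show ?thesis
    using E.root_unique[OF K _ assms(21)] entropy nu by (auto simp: rel_entropy_eq_integral[OF entropy(1)])
qed

end
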